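(* Take any $p\in(0,\infty)$, $r\in\mathbb{R}$, $u\in\mathbb{R}$, and any real-valued random variable $X$ such that $\mathsf{E}|X|^r+\mathsf{E}|X|^{r+p}<\infty$. Let $f$ be the characteristic function of $X$. Take any two natural numbers $n$ and $m$ in the interval $(p,\infty)$ such that $n$ is odd and $m$ is even. Then $$\mathsf{E}X_+^{r+p} e^{iuX}=\frac1{2i^r}\int_0^{\infty-}\Big(\frac{(\Delta_t^m f^{(r)})(u)}{c^+_p(g_m)}+\frac{(\Delta_t^n f^{(r)})(u)}{c^+_p(g_n)}\Big)\frac{dt}{t^{p+1}},$$ $$\mathsf{E}X_-^{r+p} e^{iuX}=\frac{e^{i\pi r}}{2i^r}\int_0^{\infty-}\Big(\frac{(\Delta_t^m f^{(r)})(u)}{c^+_p(g_m)}-\frac{(\Delta_t^n f^{(r)})(u)}{c^+_p(g_n)}\Big)\frac{dt}{t^{p+1}}.$$ It follows, in particular (for $r=0$, so that the moment condition is $\mathsf{E}|X|^p<\infty$), that $$\mathsf{E}|X|^p e^{iuX}=\frac1{c^+_p(g_m)}\int_0^{\infty-}\frac{(\Delta_t^m f)(u)}{t^{p+1}}\,dt,\qquad \mathsf{E}X^{[p]} e^{iuX}=\frac1{c^+_p(g_n)}\int_0^{\infty-}\frac{(\Delta_t^n f)(u)}{t^{p+1}}\,dt .$$ In fact, the last identity (for $\mathsf{E}X^{[p]}e^{iuX}$) holds even for any $p\in(-1,\infty)$ and any odd natural $n>p$ (again with $\mathsf{E}|X|^p<\infty$).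
   Context: $\int_0^{\infty-}:=\lim_{T\uparrow\infty}\int_0^T$. Any claim about an integral $\int_a^b$ with $0\le a<b\le\infty$ includes by default the statement that the integral exists in the Lebesgue sense and is finite. $\Delta_v$ is the symmetric difference operator $(\Delta_v\psi)(z):=\psi(z+v)-\psi(z-v)$, and $\Delta_v^n$ is its $n$th power, so that $(\Delta_v^n\psi)(z)=\sum_{j=0}^n(-1)^j\binom nj\psi(z+(n-2j)v)$. $g_n(t):=(2i)^n\sin^n t=(e^{it}-e^{-it})^n$ for real $t$, and $c_p^+(g_n):=\lim_{\varepsilon\downarrow0,\,T\uparrow\infty}\int_\varepsilon^T\frac{g_n(t)}{t^{p+1}}\,dt$, which exists, is finite and nonzero whenever $0<p<n$ if $n$ is even, and $-1<p<n$ if $n$ is odd. For real $x$ and $s$: $x_+^s:=x^s$ if $x>0$ and $x_+^s:=0$ otherwise; $x_-^s:=(-x)_+^s$; $x^{[s]}:=x_+^s-x_-^s$. Conventions: $0^0=0$; $0^s=\infty$ if $s<0$; $0\cdot\infty=\infty\cdot0=0$. For nonzero complex $z$, $\arg z\in(-\pi,\pi]$ and $z^s:=|z|^s e^{is\arg z}$. Fractional derivatives: for $\psi\colon\mathbb{R}\to\mathbb{C}$ and real $s$, $\psi^{(s)}(t)$ is defined as follows (whenever the operations make sense). If $s\in\{0,1,2,\dots\}$, it is the usual derivative, $\psi^{(0)}=\psi$. If $s>0$ is not an integer, $k=\lfloor s\rfloor$, $\lambda=s-k$, then $\psi^{(s)}(t):=\frac1{\Gamma(-\lambda)}\int_0^\infty\frac{\psi^{(k)}(t-v)-\psi^{(k)}(t)}{v^{1+\lambda}}\,dv$.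 If $s\in(-1,0)$, then $\psi^{(s)}(t):=\frac1{\Gamma(-s)}\lim_{T\to\infty}\int_0^{T}\frac{\psi(t-v)}{v^{1+s}}\,dv$. If $s$ is a negative integer, $\psi^{(s)}(t):=\lim_{q\downarrow s}\psi^{(q)}(t)$. If $s<-1$ is not an integer, $\psi^{(s)}(t):=(\psi^{(\lceil s\rceil)})^{(s-\lceil s\rceil)}(t)$. If $f$ is the characteristic function of a random variable $X$ with $\mathsf{E}|X|^s<\infty$, then $f^{(s)}(t)$ exists for all real $t$.
   Formalization: In the last identity, for p = 0 only, the integral is taken as the joint limit of the integral from ε to T as ε↓0, T↑∞, since (Δ_t^n f)(u)/t need not be Lebesgue integrable near 0; for p ≠ 0 it is as stated. *)

theory Defs
  imports "HOL-Probability.Probability"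
begin

text \<open>Powers with the conventions that \<open>0\<close> to the power \<open>0\<close> is \<open>0\<close> and that negative powers
  of \<open>0\<close> are infinite.\<close>

definition abs_pow :: "real \<Rightarrow> real \<Rightarrow> ennreal" where
  "abs_pow x s = (if x \<noteq> 0 then ennreal (\<bar>x\<bar> powr s) else if s < 0 then \<infinity> else 0)"

definition abs_moment :: "'a measure \<Rightarrow> ('a \<Rightarrow> real) \<Rightarrow> real \<Rightarrow> ennreal" where
  "abs_moment M X s = (\<integral>\<^sup>+\<omega>. abs_pow (X \<omega>) s \<partial>M)"

definition pos_pow :: "real \<Rightarrow> real \<Rightarrow> real" where
  "pos_pow x s = (if x > 0 then x powr s else 0)"

definition neg_pow :: "real \<Rightarrow> real \<Rightarrow> real" where
  "neg_pow x s = pos_pow (- x) s"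

definition sgn_pow :: "real \<Rightarrow> real \<Rightarrow> real" where
  "sgn_pow x s = pos_pow x s - neg_pow x s"

text \<open>The integral from \<open>0\<close> to \<open>\<infinity>-\<close>: Lebesgue at the lower limit, improper at the upper one.\<close>

definition has_int_0_infm :: "(real \<Rightarrow> complex) \<Rightarrow> complex \<Rightarrow> bool" where
  "has_int_0_infm h L \<longleftrightarrow>
     (\<forall>T>0. set_integrable lborel {0<..T} h) \<and>
     ((\<lambda>T. set_lebesgue_integral lborel {0<..T} h) \<longlongrightarrow> L) at_top"

text \<open>The integral from \<open>0+\<close> to \<open>\<infinity>-\<close>: improper at both limits, as a joint limit.
  Besides defining \<open>c_plus\<close>, it is needed for the moment of order \<open>0\<close>, where the integrand
  need not be absolutely integrable near \<open>0\<close> (Wendel 1961).\<close>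

definition has_int_0p_infm :: "(real \<Rightarrow> complex) \<Rightarrow> complex \<Rightarrow> bool" where
  "has_int_0p_infm h L \<longleftrightarrow>
     (\<forall>e>0. \<forall>T>e. set_integrable lborel {e..T} h) \<and>
     ((\<lambda>(e, T). set_lebesgue_integral lborel {e..T} h) \<longlongrightarrow> L) (at_right 0 \<times>\<^sub>F at_top)"

definition g_fun :: "nat \<Rightarrow> real \<Rightarrow> complex" where
  "g_fun n t = (2 * \<i>) ^ n * of_real (sin t ^ n)"

definition c_plus :: "real \<Rightarrow> (real \<Rightarrow> complex) \<Rightarrow> complex" where
  "c_plus p g = (THE c. has_int_0p_infm (\<lambda>t. g t / of_real (t powr (p + 1))) c)"

definition delta_op :: "real \<Rightarrow> (real \<Rightarrow> complex) \<Rightarrow> real \<Rightarrow> complex" where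
  "delta_op v \<psi> = (\<lambda>z. \<psi> (z + v) - \<psi> (z - v))"

definition delta_pow :: "nat \<Rightarrow> real \<Rightarrow> (real \<Rightarrow> complex) \<Rightarrow> real \<Rightarrow> complex" where
  "delta_pow n v \<psi> = (delta_op v ^^ n) \<psi>"

fun has_nth_deriv :: "nat \<Rightarrow> (real \<Rightarrow> complex) \<Rightarrow> (real \<Rightarrow> complex) \<Rightarrow> bool" where
  "has_nth_deriv 0 \<psi> \<phi> \<longleftrightarrow> \<phi> = \<psi>"
| "has_nth_deriv (Suc k) \<psi> \<phi> \<longleftrightarrow>
     (\<exists>\<eta>. has_nth_deriv k \<psi> \<eta> \<and> (\<forall>t. (\<eta> has_vector_derivative \<phi> t) (at t)))"

text \<open>\<open>has_frac_deriv \<psi> s \<phi>\<close>: the derivative of \<open>\<psi>\<close> of real order \<open>s\<close> exists at every real point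
  (all the derivatives, integrals and limits involved exist) and equals \<open>\<phi>\<close>.  At a negative integer \<open>s\<close>,
  the limit from the right requires existence for the orders in some interval \<open>(s, b)\<close>.\<close>

inductive has_frac_deriv :: "(real \<Rightarrow> complex) \<Rightarrow> real \<Rightarrow> (real \<Rightarrow> complex) \<Rightarrow> bool" where
  nat_order:
    "has_nth_deriv k \<psi> \<phi> \<Longrightarrow> has_frac_deriv \<psi> (real k) \<phi>"
| pos_order:
    "\<lbrakk> 0 < s; s \<notin> \<int>; k = nat \<lfloor>s\<rfloor>; d = s - real k; has_nth_deriv k \<psi> \<eta>;
       \<And>t. set_integrable lborel {0<..} (\<lambda>v. (\<eta> (t - v) - \<eta> t) / of_real (v powr (1 + d)));
       \<And>t. \<phi> t = 1 / of_real (Gamma (- d)) *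
              set_lebesgue_integral lborel {0<..}
                (\<lambda>v. (\<eta> (t - v) - \<eta> t) / of_real (v powr (1 + d))) \<rbrakk>
     \<Longrightarrow> has_frac_deriv \<psi> s \<phi>"
| unit_neg_order:
    "\<lbrakk> - 1 < s; s < 0;
       \<And>t. has_int_0_infm (\<lambda>v. \<psi> (t - v) / of_real (v powr (1 + s))) (I t);
       \<And>t. \<phi> t = 1 / of_real (Gamma (- s)) * I t \<rbrakk>
     \<Longrightarrow> has_frac_deriv \<psi> s \<phi>"
| neg_int_order:
    "\<lbrakk> s < 0; s \<in> \<int>; s < b; \<And>q. s < q \<Longrightarrow> q < b \<Longrightarrow> has_frac_deriv \<psi> q (\<Phi> q);
       \<And>t. ((\<lambda>q. \<Phi> q t) \<longlongrightarrow> \<phi> t) (at_right s) \<rbrakk>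
     \<Longrightarrow> has_frac_deriv \<psi> s \<phi>"
| neg_order:
    "\<lbrakk> s < - 1; s \<notin> \<int>; has_frac_deriv \<psi> (of_int \<lceil>s\<rceil>) \<eta>;
       has_frac_deriv \<eta> (s - of_int \<lceil>s\<rceil>) \<phi> \<rbrakk>
     \<Longrightarrow> has_frac_deriv \<psi> s \<phi>"

lemma has_int_0_infm_unique:
  "has_int_0_infm h L \<Longrightarrow> has_int_0_infm h L' \<Longrightarrow> L = L'"
  unfolding has_int_0_infm_def by (meson tendsto_unique trivial_limit_at_top_linorder)

lemma has_int_0p_infm_unique:
  "has_int_0p_infm h L \<Longrightarrow> has_int_0p_infm h L' \<Longrightarrow> L = L'"
  unfolding has_int_0p_infm_def
  by (meson tendsto_unique trivial_limit_at_top_linorder trivial_limit_at_right_real prod_filter_eq_bot)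

lemma has_nth_deriv_unique:
  "has_nth_deriv k \<psi> \<phi> \<Longrightarrow> has_nth_deriv k \<psi> \<phi>' \<Longrightarrow> \<phi> = \<phi>'"
proof (induction k arbitrary: \<phi> \<phi>')
  case (Suc k)
  then obtain \<eta> where "\<And>t. (\<eta> has_vector_derivative \<phi> t) (at t)"
      "\<And>t. (\<eta> has_vector_derivative \<phi>' t) (at t)"
    by (metis has_nth_deriv.simps(2))
  then show ?case
    by (metis ext vector_derivative_at)
qed simp

lemma not_Ints_between_minus1_0: "- 1 < (s::real) \<Longrightarrow> s < 0 \<Longrightarrow> s \<notin> \<int>"
  by (auto elim!: Ints_cases)

lemma has_frac_deriv_unique:
  "has_frac_deriv \<psi> s \<phi> \<Longrightarrow> has_frac_deriv \<psi> s \<phi>' \<Longrightarrow> \<phi> = \<phi>'"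
proof (induction arbitrary: \<phi>' rule: has_frac_deriv.induct)
  case (nat_order k \<psi> \<phi>)
  from nat_order(2,1) show ?case
    by (cases rule: has_frac_deriv.cases) (auto intro: has_nth_deriv_unique)
next
  case (pos_order s k d \<psi> \<eta> \<phi>)
  note hyp = pos_order
  from hyp(8) show ?case
  proof (cases rule: has_frac_deriv.cases)
    case (pos_order k' d' \<eta>')
    then have "k' = k" "d' = d"
      using hyp(3,4) by auto
    moreover have "\<eta>' = \<eta>"
      using pos_order(5) hyp(5) \<open>k' = k\<close> has_nth_deriv_unique by blast
    ultimately show ?thesis
      using hyp(7) pos_order(7) by (intro ext) simp
  qed (use hyp(1,2) in auto)
next
  case (unit_neg_order s \<psi> I \<phi>)
  note hyp = unit_neg_order
  from hyp(5) show ?case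
  proof (cases rule: has_frac_deriv.cases)
    case (unit_neg_order I')
    have "I' t = I t" for t
      using hyp(3) unit_neg_order(3) has_int_0_infm_unique by blast
    then show ?thesis
      using hyp(4) unit_neg_order(4) by (intro ext) simp
  qed (use hyp(1,2) not_Ints_between_minus1_0[of s] in auto)
next
  case (neg_int_order s b \<psi> \<Phi> \<phi>)
  note hyp = neg_int_order and IH = neg_int_order.IH
  from hyp(7) show ?case
  proof (cases rule: has_frac_deriv.cases)
    case (neg_int_order b' \<Phi>')
    show ?thesis
    proof
      fix t
      have "eventually (\<lambda>q. q \<in> {s<..<min b b'}) (at_right s)"
        using hyp(3) neg_int_order by (intro eventually_at_right_real) auto
      then have "eventually (\<lambda>q. \<Phi>' q t = \<Phi> q t) (at_right s)"
        by eventually_elim (metis IH neg_int_order(4) greaterThanLessThan_iff min_less_iff_conj)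
      then have "((\<lambda>q. \<Phi> q t) \<longlongrightarrow> \<phi>' t) (at_right s)"
        using neg_int_order(5)[of t] by (simp cong: tendsto_cong)
      then show "\<phi> t = \<phi>' t"
        using hyp(5)[of t] by (rule tendsto_unique[OF trivial_limit_at_right_real, rotated])
    qed
  qed (use hyp(1,2) not_Ints_between_minus1_0[of s] in auto)
next
  case (neg_order s \<psi> \<eta> \<phi>)
  note hyp = neg_order and IH = neg_order.IH
  from hyp(7) show ?case
  proof (cases rule: has_frac_deriv.cases)
    case (neg_order \<eta>')
    then have "\<eta> = \<eta>'"
      using IH(1) by blast
    with neg_order show ?thesis
      using IH(2) by blast
  qed (use hyp(1,2) in auto)
qed

end

theory Submission
  imports Defs "HOL-Real_Asymp.Real_Asymp"
begin

text \<open>Write \<open>\<mu>\<close> for the law of \<open>X\<close>. If the moment of order \<open>r\<close> is finite, the fractional derivative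
  of the characteristic function is \<open>f\<^sup>(\<^sup>r\<^sup>)(t) = \<integral> (ix)\<^sup>r e\<^sup>i\<^sup>t\<^sup>x d\<mu>(x)\<close>: by Fubini and dominated convergence this
  reduces to the Gamma integrals of \<open>(e\<^sup>-\<^sup>i\<^sup>v - 1) v\<^sup>-\<^sup>1\<^sup>-\<^sup>l\<close> and \<open>e\<^sup>-\<^sup>i\<^sup>v v\<^sup>-\<^sup>l\<close> with \<open>0 < l < 1\<close>. Differences
  act by multiplying the weight \<open>(ix)\<^sup>r\<close> with \<open>g\<^sub>n(tx)\<close>, and substituting \<open>s = t|x|\<close> in the integral over \<open>t\<close>
  turns \<open>g\<^sub>n(tx) t\<^sup>-\<^sup>p\<^sup>-\<^sup>1\<close> into \<open>|x|\<^sup>p sgn(x)\<^sup>n\<close> times the constant \<open>c\<^sub>p\<close> of \<open>g\<^sub>n\<close>. Adding and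
  subtracting an even and an odd case isolates the positive and the negative part of \<open>X\<close>. The
  constants do not vanish: for even \<open>n\<close> the integrand has a fixed sign, and for odd \<open>n\<close> every period of
  the sine contributes a positive amount because the weight \<open>t\<^sup>-\<^sup>p\<^sup>-\<^sup>1\<close> decreases.\<close>

section \<open>Integrals of kernels against powers\<close>

text \<open>Expectation and integral cannot be exchanged on the whole half-line: for odd n with p
  \<le> 0, and for fractional derivatives of order in (-1, 0), the kernel integral converges only
  conditionally at infinity. So Fubini is used up to a finite T, and T tends to infinity under the
  expectation. This asks for a bound on the truncated integrals that is uniform in T; scaling by |x|
  turns such a bound at x = 1 into K |x|^p, which is the size of the moment assumed finite. At p = 0
  Fubini may fail even on (0, T], where the absolute integral grows like log |x|; there the range is
  also cut at some e > 0, and both limits are taken under the expectation. In place of a contour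
  shift, the Gamma integral is differentiated in the angle of the ray. The form with e^(-zv) - 1 is
  the one to rotate, since it stays absolutely integrable up to the imaginary axis. An atom at 0
  needs care: \<open>powr\<close> does not see it, since \<open>0 powr r\<close> is 0, yet it
  contributes to f itself and makes moments of negative order infinite.\<close>

lemma set_integrable_powr_near_0:
  assumes "a > (-1::real)" "0 \<le> b"
  shows "set_integrable lborel {0<..b} (\<lambda>x. x powr a)"
proof -
  have "(\<lambda>x. x powr a) absolutely_integrable_on {0<..b}"
    by (intro nonnegative_absolutely_integrable_1 integrable_on_powr_from_0' assms) auto
  then show ?thesis
    unfolding set_integrable_def by (subst (asm) integrable_completion) auto
qed

lemma set_integrable_powr_at_top:
  assumes "e < (-1::real)" "0 < a"
  shows "set_integrable lborel {a..} (\<lambda>x. x powr e)"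
proof -
  have "(\<lambda>x. x powr e) absolutely_integrable_on {a..}"
    by (intro nonnegative_absolutely_integrable_1 has_integral_integrable[OF has_integral_powr_to_inf[OF assms]]) auto
  then show ?thesis
    unfolding set_integrable_def by (subst (asm) integrable_completion) auto
qed

lemma set_integrable_kernel_near_0:
  fixes k :: "real \<Rightarrow> complex"
  assumes [measurable]: "k \<in> borel_measurable borel"
    and k: "\<And>t. 0 < t \<Longrightarrow> t \<le> T \<Longrightarrow> norm (k t) \<le> C * t ^ q"
    and "s < real q + 1" "0 \<le> T"
  shows "set_integrable lborel {0<..T} (\<lambda>t. k t / of_real (t powr s))"
proof (rule set_integrable_bound)
  show "set_integrable lborel {0<..T} (\<lambda>t. C * t powr (real q - s))"
    using set_integrable_powr_near_0[of "real q - s" T] assms by simp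
  show "set_borel_measurable lborel {0<..T} (\<lambda>t. k t / of_real (t powr s))"
    unfolding set_borel_measurable_def by measurable
  have "norm (k t / of_real (t powr s)) \<le> norm (C * t powr (real q - s))" if "0 < t" "t \<le> T" for t
  proof -
    have "norm (k t / of_real (t powr s)) \<le> C * t ^ q / t powr s"
      using k[of t] that by (simp add: norm_divide divide_right_mono)
    also have "\<dots> = C * t powr (real q - s)"
      using that by (simp add: powr_diff powr_realpow)
    finally show ?thesis using abs_ge_self order_trans by fastforce
  qed
  then show "AE t in lborel. t \<in> {0<..T} \<longrightarrow>
      norm (k t / of_real (t powr s)) \<le> norm (C * t powr (real q - s))"
    by auto
qed

text \<open>The range is cut at 1: vanishing to order q pays near 0, where \<open>s < q + 1\<close>
  counts, and boundedness pays at infinity, where \<open>1 < s\<close> counts.\<close>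

lemma set_integrable_kernel:
  fixes k :: "real \<Rightarrow> complex"
  assumes [measurable]: "k \<in> borel_measurable borel"
    and k: "\<And>t. 0 < t \<Longrightarrow> norm (k t) \<le> C * t ^ q" "\<And>t. 0 < t \<Longrightarrow> norm (k t) \<le> C"
    and "1 < s" "s < real q + 1"
  shows "set_integrable lborel {0<..} (\<lambda>t. k t / of_real (t powr s))"
proof -
  have "set_integrable lborel {1..} (\<lambda>t. k t / of_real (t powr s))"
  proof (rule set_integrable_bound)
    show "set_integrable lborel {1..} (\<lambda>t. C * t powr (- s))"
      using set_integrable_powr_at_top[of "- s" 1] assms by simp
    show "set_borel_measurable lborel {1..} (\<lambda>t. k t / of_real (t powr s))"
      unfolding set_borel_measurable_def by measurable
    have "norm (k t / of_real (t powr s)) \<le> norm (C * t powr (- s))" if "1 \<le> t" for t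
    proof -
      have "norm (k t / of_real (t powr s)) \<le> C / t powr s"
        using k(2)[of t] that by (simp add: norm_divide divide_right_mono)
      also have "\<dots> = C * t powr (- s)"
        using that by (simp add: powr_minus_divide)
      finally show ?thesis using abs_ge_self order_trans by fastforce
    qed
    then show "AE t in lborel. t \<in> {1..} \<longrightarrow>
        norm (k t / of_real (t powr s)) \<le> norm (C * t powr (- s))"
      by auto
  qed
  moreover have "set_integrable lborel {0<..1} (\<lambda>t. k t / of_real (t powr s))"
    by (rule set_integrable_kernel_near_0) (use assms in auto)
  ultimately have "set_integrable lborel ({0<..1} \<union> {1..}) (\<lambda>t. k t / of_real (t powr s))"
    by (intro set_integrable_Un) auto
  also have "{0<..(1::real)} \<union> {1..} = {0<..}" by auto
  finally show ?thesis .
qed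

lemma powr_tendsto_0_at_right:
  assumes "0 < (a::real)" shows "((\<lambda>t. t powr a) \<longlongrightarrow> 0) (at_right 0)"
  using assms by real_asymp

lemma powr_tendsto_0_at_top:
  assumes "(a::real) < 0" shows "((\<lambda>t. t powr a) \<longlongrightarrow> 0) at_top"
  using assms by real_asymp

lemma set_lebesgue_integral_tendsto_at_top:
  fixes h :: "real \<Rightarrow> complex"
  assumes h: "set_integrable lborel {0<..} h"
  shows "((\<lambda>T. set_lebesgue_integral lborel {0<..T} h) \<longlongrightarrow> set_lebesgue_integral lborel {0<..} h) at_top"
proof -
  have eq: "set_lebesgue_integral lborel {0<..T} h =
      (\<integral>t. indicator {..T} t *\<^sub>R (indicator {0<..} t *\<^sub>R h t) \<partial>lborel)" for T
    unfolding set_lebesgue_integral_def by (intro Bochner_Integration.integral_cong) (auto simp: indicator_def)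
  show ?thesis
    unfolding eq unfolding set_lebesgue_integral_def
    by (rule tendsto_integral_at_top) (use h in \<open>auto simp: set_integrable_def\<close>)
qed

lemma norm_set_lebesgue_integral_le:
  fixes h :: "real \<Rightarrow> complex"
  assumes h: "set_integrable lborel A h" and "B \<subseteq> A" "B \<in> sets borel"
  shows "norm (set_lebesgue_integral lborel B h) \<le> set_lebesgue_integral lborel A (\<lambda>t. norm (h t))"
proof -
  have hB: "set_integrable lborel B h"
    by (rule set_integrable_subset[OF h]) (use assms in auto)
  have "norm (set_lebesgue_integral lborel B h) \<le> (\<integral>t. norm (indicator B t *\<^sub>R h t) \<partial>lborel)"
    unfolding set_lebesgue_integral_def by (rule integral_norm_bound)
  also have "\<dots> \<le> (\<integral>t. norm (indicator A t *\<^sub>R h t) \<partial>lborel)"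
    using hB h assms(2) unfolding set_integrable_def
    by (intro integral_mono integrable_norm) (auto simp: indicator_def)
  finally show ?thesis by (simp add: set_lebesgue_integral_def)
qed

text \<open>Integration by parts replaces the conditionally convergent integral of \<open>g(t) t\<^sup>-\<^sup>s\<close> by the absolutely
  convergent integral of \<open>G(t) t\<^sup>-\<^sup>s\<^sup>-\<^sup>1\<close>.\<close>

locale oscillating_kernel =
  fixes g G :: "real \<Rightarrow> complex" and C :: real and q :: nat and s :: real
  assumes deriv_G: "\<And>t. (G has_vector_derivative g t) (at t)"
    and cont_g: "continuous_on UNIV g"
    and G_0: "G 0 = 0"
    and norm_G: "\<And>t. 0 < t \<Longrightarrow> norm (G t) \<le> C"
    and norm_g: "\<And>t. 0 < t \<Longrightarrow> norm (g t) \<le> C * t ^ q"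
    and s: "0 < s" "s < real q + 1"
begin

lemma cont_G: "continuous_on UNIV G"
  using deriv_G has_vector_derivative_continuous continuous_at_imp_continuous_on by blast

lemma C_nonneg: "0 \<le> C"
  using order_trans[OF norm_ge_zero norm_G[of 1]] by simp

text \<open>The mean value inequality gains one power of t over the bound on \<open>g\<close>. It
  compensates for the exponent s + 1 that integration by parts produces.\<close>

lemma norm_G': "0 < t \<Longrightarrow> norm (G t) \<le> C * t ^ Suc q"
proof -
  assume t: "0 < t"
  have "norm (G t - G 0) \<le> (C * t ^ q) * norm (t - 0)"
  proof (rule differentiable_bound[of "{0..t}"])
    show "(G has_derivative (\<lambda>h. h *\<^sub>R g x)) (at x within {0..t})" for x
      using deriv_G[of x] by (auto simp: has_vector_derivative_def intro: has_derivative_at_withinI)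
    show "onorm (\<lambda>h. h *\<^sub>R g x) \<le> C * t ^ q" if "x \<in> {0..t}" for x
    proof -
      have "norm (g x) \<le> C * t ^ q"
      proof (cases "x = 0")
        case True
        \<comment> \<open>\<open>norm_g\<close> is assumed only for positive arguments, so the bound
          reaches 0 by continuity.\<close>
        have "\<forall>\<^sub>F y in at_right 0. norm (g y) \<le> C * t ^ q"
          using eventually_at_right_less[of "0::real"] eventually_at_rightI[OF _ t, of "\<lambda>y. y < t"]
        proof (rule eventually_elim2)
          fix y assume "0 < y" "y < t"
          then have "norm (g y) \<le> C * y ^ q" "C * y ^ q \<le> C * t ^ q"
            using norm_g C_nonneg by (auto intro!: mult_left_mono power_mono)
          then show "norm (g y) \<le> C * t ^ q" by simp
        qed auto
        moreover have "((\<lambda>y. norm (g y)) \<longlongrightarrow> norm (g 0)) (at_right 0)"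
          using cont_g by (intro tendsto_norm) (auto simp: continuous_on_def intro: tendsto_within_subset)
        ultimately show ?thesis
          unfolding True by (intro tendsto_upperbound[where F = "at_right 0"]) auto
      next
        case False
        then have "norm (g x) \<le> C * x ^ q" "C * x ^ q \<le> C * t ^ q"
          using that norm_g C_nonneg by (auto intro!: mult_left_mono power_mono)
        then show ?thesis by simp
      qed
      then show ?thesis
        by (intro onorm_le) (simp add: mult.commute mult_left_mono)
    qed
  qed (use t in auto)
  then show ?thesis using t G_0 by (simp add: mult_ac)
qed

lemma g_measurable [measurable]: "g \<in> borel_measurable borel"
  using cont_g by (rule borel_measurable_continuous_onI)

lemma G_measurable [measurable]: "G \<in> borel_measurable borel"
  using cont_G by (rule borel_measurable_continuous_onI)

lemma set_integrable_g: "0 \<le> T \<Longrightarrow> set_integrable lborel {0<..T} (\<lambda>t. g t / of_real (t powr s))"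
  by (rule set_integrable_kernel_near_0[where C = C and q = q]) (use norm_g s in auto)

lemma set_integrable_G: "set_integrable lborel {0<..} (\<lambda>t. G t / of_real (t powr (s + 1)))"
  by (rule set_integrable_kernel[where C = C and q = "Suc q"]) (use norm_G norm_G' s in auto)

lemma by_parts:
  assumes T: "0 < T"
  shows "set_lebesgue_integral lborel {0<..T} (\<lambda>t. g t / of_real (t powr s)) =
    G T / of_real (T powr s) + s * set_lebesgue_integral lborel {0<..T} (\<lambda>t. G t / of_real (t powr (s + 1)))"
proof -
  define F where "F t = G t / of_real (t powr s)" for t
  define h where "h t = g t / of_real (t powr s) - s * (G t / of_real (t powr (s + 1)))" for t
  have iG: "set_integrable lborel {0<..T} (\<lambda>t. G t / of_real (t powr (s + 1)))"
    by (rule set_integrable_subset[OF set_integrable_G]) auto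
  have ih: "set_integrable lborel {0<..T} h"
    unfolding h_def using set_integrable_g[of T] iG T by (intro set_integral_diff set_integrable_mult_right) auto
  have "(LBINT t=0..T. h t) = F T - 0"
  proof (rule interval_integral_FTC_integrable)
    show "(F has_vector_derivative h t) (at t)" if "0 < ereal t" for t
    proof -
      have t: "0 < t" using that by simp
      have F: "F = (\<lambda>t. (t powr (- s)) *\<^sub>R G t)"
        by (auto simp: F_def fun_eq_iff powr_minus scaleR_conv_of_real field_simps)
      have "((\<lambda>t. (t powr (- s)) *\<^sub>R G t) has_vector_derivative
          (t powr (- s) *\<^sub>R g t + (- s * t powr (- s - 1)) *\<^sub>R G t)) (at t)"
        using t by (intro has_vector_derivative_scaleR deriv_G) (auto intro!: derivative_eq_intros)
      moreover have "t powr (- s) *\<^sub>R g t + (- s * t powr (- s - 1)) *\<^sub>R G t = h t"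
        using t by (simp add: h_def scaleR_conv_of_real powr_minus powr_diff powr_add field_simps)
      ultimately show ?thesis unfolding F by simp
    qed
    show "isCont h t" if "0 < ereal t" for t
      unfolding h_def using that cont_g cont_G
      by (intro continuous_intros) (auto simp: continuous_on_eq_continuous_at)
    show "set_integrable lborel (einterval 0 (ereal T)) h"
      by (rule set_integrable_subset[OF ih]) (auto simp: einterval_iff)
    \<comment> \<open>No boundary term at 0: \<open>G\<close> is of order q + 1 there, and s is
      smaller.\<close>
    have "(F \<longlongrightarrow> 0) (at_right 0)"
    proof (rule Lim_null_comparison)
      show "((\<lambda>t. C * t powr (real (Suc q) - s)) \<longlongrightarrow> 0) (at_right 0)"
        using powr_tendsto_0_at_right[of "real (Suc q) - s"] s by (intro tendsto_mult_right_zero) auto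
      show "\<forall>\<^sub>F t in at_right 0. norm (F t) \<le> C * t powr (real (Suc q) - s)"
      proof (rule eventually_at_right_less[THEN eventually_mono])
        fix t :: real assume t: "0 < t"
        have "norm (F t) \<le> C * t ^ Suc q / t powr s"
          using norm_G'[OF t] t by (simp add: F_def norm_divide divide_right_mono)
        also have "\<dots> = C * t powr (real (Suc q) - s)"
          using t by (simp only: powr_diff powr_realpow times_divide_eq_right)
        finally show "norm (F t) \<le> C * t powr (real (Suc q) - s)" .
      qed
    qed
    then show "((F \<circ> real_of_ereal) \<longlongrightarrow> 0) (at_right 0)"
      by (simp add: zero_ereal_def ereal_tendsto_simps)
    have "isCont F T"
      unfolding F_def using T cont_G
      by (intro continuous_intros) (auto simp: continuous_on_eq_continuous_at)
    then show "((F \<circ> real_of_ereal) \<longlongrightarrow> F T) (at_left (ereal T))"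
      by (simp add: ereal_tendsto_simps isCont_def filterlim_at_split)
  qed (use T in auto)
  also have "(LBINT t=0..T. h t) = set_lebesgue_integral lborel {0<..T} h"
    using T interval_integral_Ioc[of 0 T h] by (simp add: zero_ereal_def)
  also have "\<dots> = set_lebesgue_integral lborel {0<..T} (\<lambda>t. g t / of_real (t powr s)) -
      s * set_lebesgue_integral lborel {0<..T} (\<lambda>t. G t / of_real (t powr (s + 1)))"
    unfolding h_def using set_integrable_g[of T] iG T
    by (subst set_integral_diff) (simp_all del: times_divide_eq_right)
  finally show ?thesis by (simp add: F_def algebra_simps)
qed

text \<open>The boundary term at T dies because \<open>G\<close> is bounded and s is positive; the
  limit on the left may be only conditionally convergent, the integral on the right is absolutely
  convergent.\<close>

lemma tendsto_integral:
  "((\<lambda>T. set_lebesgue_integral lborel {0<..T} (\<lambda>t. g t / of_real (t powr s))) \<longlongrightarrow>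
     s * set_lebesgue_integral lborel {0<..} (\<lambda>t. G t / of_real (t powr (s + 1)))) at_top"
proof -
  have "((\<lambda>T. G T / of_real (T powr s)) \<longlongrightarrow> 0) at_top"
  proof (rule Lim_null_comparison)
    show "((\<lambda>t. C * t powr (- s)) \<longlongrightarrow> 0) at_top"
      using powr_tendsto_0_at_top[of "- s"] s by (intro tendsto_mult_right_zero) auto
    show "\<forall>\<^sub>F t in at_top. norm (G t / of_real (t powr s)) \<le> C * t powr (- s)"
      using norm_G
      by (intro eventually_mono[OF eventually_gt_at_top[of 0]])
         (auto simp: norm_divide powr_minus_divide divide_right_mono)
  qed
  then have "((\<lambda>T. G T / of_real (T powr s) + s * set_lebesgue_integral lborel {0<..T} (\<lambda>t. G t / of_real (t powr (s + 1))))
      \<longlongrightarrow> 0 + s * set_lebesgue_integral lborel {0<..} (\<lambda>t. G t / of_real (t powr (s + 1)))) at_top"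
    by (intro tendsto_intros set_lebesgue_integral_tendsto_at_top set_integrable_G)
  moreover have "\<forall>\<^sub>F T in at_top. G T / of_real (T powr s) +
      s * set_lebesgue_integral lborel {0<..T} (\<lambda>t. G t / of_real (t powr (s + 1))) =
      set_lebesgue_integral lborel {0<..T} (\<lambda>t. g t / of_real (t powr s))"
    by (rule eventually_mono[OF eventually_gt_at_top[of 0]]) (simp add: by_parts)
  ultimately show ?thesis
    using Lim_transform_eventually by fastforce
qed

text \<open>Uniformity in T is the point: after scaling, K provides the majorant for letting T tend
  to infinity under the expectation.\<close>

lemma integral_bounded:
  obtains K where "0 \<le> K" "\<And>T. norm (set_lebesgue_integral lborel {0<..T} (\<lambda>t. g t / of_real (t powr s))) \<le> K"
proof
  define I where "I = set_lebesgue_integral lborel {0<..} (\<lambda>t. norm (G t / of_real (t powr (s + 1))))"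
  have I: "0 \<le> I" unfolding I_def set_lebesgue_integral_def by (rule Bochner_Integration.integral_nonneg) simp
  show "0 \<le> C + s * I" using I s C_nonneg by simp
  fix T
  show "norm (set_lebesgue_integral lborel {0<..T} (\<lambda>t. g t / of_real (t powr s))) \<le> C + s * I"
  proof (cases "0 < T")
    case False
    then have "{0<..T} = {}" by auto
    then show ?thesis using I s C_nonneg by (simp add: set_lebesgue_integral_def)
  next
    case True
    \<comment> \<open>Up to 1 this uses the order q + 1 of \<open>G\<close> at 0, beyond 1 its
      boundedness.\<close>
    have "norm (G T) \<le> C * T powr s"
    proof (cases "T \<le> 1")
      case True
      have "T ^ Suc q = T powr real (Suc q)" using \<open>0 < T\<close> powr_realpow by metis
      also have "\<dots> \<le> T powr s" using True \<open>0 < T\<close> s by (intro powr_mono') auto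
      finally show ?thesis using norm_G'[OF \<open>0 < T\<close>] C_nonneg by (meson mult_left_mono order_trans)
    next
      case False
      then have "1 \<le> T powr s" using s by (intro ge_one_powr_ge_zero) auto
      then show ?thesis using norm_G[OF \<open>0 < T\<close>] C_nonneg by (meson mult_left_mono mult_right_mono order_trans mult_le_cancel_left1 not_le)
    qed
    then have "norm (G T / of_real (T powr s)) \<le> C"
      using True by (simp add: norm_divide divide_le_eq)
    moreover have "norm (set_lebesgue_integral lborel {0<..T} (\<lambda>t. G t / of_real (t powr (s + 1)))) \<le> I"
      unfolding I_def by (rule norm_set_lebesgue_integral_le[OF set_integrable_G]) auto
    then have "norm (s * set_lebesgue_integral lborel {0<..T} (\<lambda>t. G t / of_real (t powr (s + 1)))) \<le> s * I"
      using s by (simp add: norm_mult)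
    ultimately show ?thesis
      unfolding by_parts[OF True] by (meson add_mono norm_triangle_le)
  qed
qed

end

section \<open>Positivity of integrals, and the relation between the two improper integrals\<close>

lemma set_integral_pos:
  fixes f :: "real \<Rightarrow> real"
  assumes f: "set_integrable lborel A f" and nonneg: "\<And>x. x \<in> A \<Longrightarrow> 0 \<le> f x"
    and "c < d" "{c<..<d} \<subseteq> A" "\<And>x. x \<in> {c<..<d} \<Longrightarrow> 0 < f x"
  shows "0 < set_lebesgue_integral lborel A f"
proof -
  have h: "integrable lborel (\<lambda>x. indicator A x * f x)"
    using f by (simp add: set_integrable_def)
  have h0: "0 \<le> indicator A x * f x" for x
    using nonneg[of x] by (simp add: indicator_def)
  have "(\<integral>x. indicator A x * f x \<partial>lborel) \<noteq> 0"
  proof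
    assume "(\<integral>x. indicator A x * f x \<partial>lborel) = 0"
    then have "AE x in lborel. indicator A x * f x = 0"
      using integral_nonneg_eq_0_iff_AE[OF h] h0 by simp
    then have "AE x in lborel. x \<notin> {c<..<d}"
      by (rule AE_mp) (use assms in \<open>force simp: indicator_def\<close>)
    then have "{c<..<d} \<in> null_sets lborel"
      by (subst AE_iff_null_sets) auto
    then show False using \<open>c < d\<close> by (simp add: null_sets_def)
  qed
  moreover have "0 \<le> (\<integral>x. indicator A x * f x \<partial>lborel)"
    using h0 by (rule Bochner_Integration.integral_nonneg)
  ultimately show ?thesis by (simp add: set_lebesgue_integral_def)
qed

lemma set_lebesgue_integral_Icc_eq_diff:
  fixes h :: "real \<Rightarrow> complex"
  assumes h: "set_integrable lborel {0<..T} h" and "0 < e" "e \<le> T"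
  shows "set_lebesgue_integral lborel {e..T} h =
    set_lebesgue_integral lborel {0<..T} h - set_lebesgue_integral lborel {0<..e} h"
proof -
  have "{0<..T} = {0<..e} \<union> {e..T}" using assms by auto
  moreover have "set_lebesgue_integral lborel ({0<..e} \<union> {e..T}) h =
      set_lebesgue_integral lborel {0<..e} h + set_lebesgue_integral lborel {e..T} h"
  proof (rule set_integral_Un_AE)
    show "AE x in lborel. \<not> (x \<in> {0<..e} \<and> x \<in> {e..T})"
      using AE_lborel_singleton[of e] by eventually_elim auto
    show "set_integrable lborel {0<..e} h" "set_integrable lborel {e..T} h"
      by (rule set_integrable_subset[OF h]; use assms in auto)+
  qed auto
  ultimately show ?thesis by simp
qed

lemma set_lebesgue_integral_tendsto_0:
  fixes h :: "real \<Rightarrow> complex"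
  assumes h: "set_integrable lborel {0<..1} h"
  shows "((\<lambda>e. set_lebesgue_integral lborel {0<..e} h) \<longlongrightarrow> 0) (at_right 0)"
proof -
  have "((\<lambda>e. set_lebesgue_integral lborel {0<..1} h - set_lebesgue_integral lborel {e..1} h) \<longlongrightarrow>
      set_lebesgue_integral lborel {0<..1} h - set_lebesgue_integral lborel {0<..1} h) (at_right 0)"
    by (intro tendsto_intros tendsto_set_lebesgue_integral_at_right h) auto
  moreover have "\<forall>\<^sub>F e in at_right 0. set_lebesgue_integral lborel {0<..1} h - set_lebesgue_integral lborel {e..1} h
      = set_lebesgue_integral lborel {0<..e} h"
    by (rule eventually_mono[OF eventually_at_right_real[of 0 1]])
       (auto simp: set_lebesgue_integral_Icc_eq_diff[OF h])
  ultimately show ?thesis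
    using Lim_transform_eventually by fastforce
qed

text \<open>\<open>c_plus\<close> is defined by the joint limit at both ends, while the integrals
  below are Lebesgue at 0. The integral over [e, T] is J T - J e, and J e tends to 0, so the joint
  limit splits.\<close>

lemma has_int_0_infm_imp_0p:
  assumes "has_int_0_infm h L"
  shows "has_int_0p_infm h L"
  unfolding has_int_0p_infm_def
proof safe
  have h: "set_integrable lborel {0<..T} h" if "0 < T" for T
    using assms that by (auto simp: has_int_0_infm_def)
  show "set_integrable lborel {e..T} h" if "0 < e" "e < T" for e T :: real
    by (rule set_integrable_subset[OF h[of T]]) (use that in auto)
  define J where "J T = set_lebesgue_integral lborel {0<..T} h" for T
  have J: "(J \<longlongrightarrow> L) at_top" "(J \<longlongrightarrow> 0) (at_right 0)"
    using assms set_lebesgue_integral_tendsto_0[OF h[of 1]] by (auto simp: has_int_0_infm_def J_def[abs_def])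
  have "((\<lambda>x. J (snd x) - J (fst x)) \<longlongrightarrow> L - 0) (at_right 0 \<times>\<^sub>F at_top)"
    by (intro tendsto_diff filterlim_compose[OF J(1)] filterlim_compose[OF J(2)] filterlim_fst filterlim_snd)
  moreover have "\<forall>\<^sub>F x in at_right 0 \<times>\<^sub>F at_top. J (snd x) - J (fst x) =
      (case x of (e, T) \<Rightarrow> set_lebesgue_integral lborel {e..T} h)"
  proof -
    have "\<forall>\<^sub>F x in at_right (0::real) \<times>\<^sub>F (at_top::real filter). (0 < fst x \<and> fst x < 1) \<and> 1 < snd x"
      using eventually_prodI[OF eventually_at_right_real[of 0 1] eventually_gt_at_top[of "1::real"]]
      by (simp add: greaterThanLessThan_iff)
    then show ?thesis
    proof eventually_elim
      case (elim x)
      then show ?case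
        by (auto simp: J_def split_beta intro!: set_lebesgue_integral_Icc_eq_diff[symmetric] h)
    qed
  qed
  ultimately show "((\<lambda>(e, T). set_lebesgue_integral lborel {e..T} h) \<longlongrightarrow> L) (at_right 0 \<times>\<^sub>F at_top)"
    using Lim_transform_eventually by fastforce
qed

section \<open>The constants of the powers of the sine\<close>

text \<open>The reduction formula for powers of the sine, started at 1 - cos. Boundedness makes
  sin^n an oscillating kernel; periodicity says that sin^n has mean zero, on which the positivity
  argument rests. Both fail for positive even powers.\<close>

lemma sin_odd_power_antiderivative:
  "\<exists>G :: real \<Rightarrow> real. \<exists>C. (\<forall>t. (G has_real_derivative sin t ^ (2 * k + 1)) (at t)) \<and>
     (\<forall>t. G (t + 2 * pi) = G t) \<and> G 0 = 0 \<and> (\<forall>t. \<bar>G t\<bar> \<le> C)"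
proof (induction k)
  case 0
  have "\<bar>1 - cos t\<bar> \<le> 2" for t :: real
    using cos_le_one[of t] cos_ge_minus_one[of t] by simp
  then show ?case
    by (intro exI[of _ "\<lambda>t. 1 - cos t"] exI[of _ 2]) (auto intro!: derivative_eq_intros)
next
  case (Suc k)
  then obtain G :: "real \<Rightarrow> real" and C where
    G: "\<And>t. (G has_real_derivative sin t ^ (2 * k + 1)) (at t)" "\<And>t. G (t + 2 * pi) = G t" "G 0 = 0"
      "\<And>t. \<bar>G t\<bar> \<le> C"
    by blast
  define n where "n = 2 * k + 1"
  \<comment> \<open>From (sin^(n+1) cos)' = (n+1) sin^n - (n+2) sin^(n+2), solved for the last
    term.\<close>
  define F where "F t = (real (n + 1) * G t - sin t ^ Suc n * cos t) / real (n + 2)" for t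
  have "(F has_real_derivative sin t ^ (n + 2)) (at t)" for t
  proof -
    have "((\<lambda>t. sin t ^ Suc n) has_real_derivative (1 + real n) * (cos t * sin t ^ n)) (at t)"
      by (rule DERIV_power_Suc[OF DERIV_sin])
    from DERIV_cdivide[OF DERIV_diff[OF DERIV_cmult[OF G(1)[of t, folded n_def]] DERIV_mult[OF this DERIV_cos]]]
    have "(F has_real_derivative (real (n + 1) * sin t ^ n -
        ((1 + real n) * (cos t * sin t ^ n) * cos t + - sin t * sin t ^ Suc n)) / real (n + 2)) (at t)"
      unfolding F_def .
    also have "real (n + 1) * sin t ^ n - ((1 + real n) * (cos t * sin t ^ n) * cos t + - sin t * sin t ^ Suc n) =
        (n + 1) * sin t ^ n * (1 - (cos t)\<^sup>2) + sin t ^ (n + 2)"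
      by (simp add: algebra_simps power2_eq_square)
    also have "\<dots> = (n + 2) * sin t ^ (n + 2)"
      unfolding sin_squared_eq[symmetric] by (simp add: algebra_simps power2_eq_square)
    finally show ?thesis by simp
  qed
  moreover have "F (t + 2 * pi) = F t" "F 0 = 0" for t
    using G by (auto simp: F_def)
  moreover have "\<bar>F t\<bar> \<le> ((n + 1) * C + 1) / (n + 2)" for t
  proof -
    have "\<bar>sin t ^ Suc n\<bar> * \<bar>cos t\<bar> \<le> 1 * 1"
      unfolding power_abs by (intro mult_mono power_le_one) auto
    moreover have "\<bar>real (n + 1) * G t\<bar> \<le> (n + 1) * C"
      unfolding abs_mult using G(4)[of t] by (intro mult_mono) auto
    ultimately have "\<bar>real (n + 1) * G t - sin t ^ Suc n * cos t\<bar> \<le> (n + 1) * C + 1"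
      unfolding abs_mult[symmetric] by linarith
    then show ?thesis by (simp add: F_def abs_div divide_right_mono)
  qed
  ultimately show ?case
    unfolding n_def by (intro exI[of _ F] exI) auto
qed

text \<open>As \<open>sin\<^sup>n\<close> integrates to \<open>0\<close> over a period, the midpoint value \<open>(a + \<pi>)\<^sup>-\<^sup>s\<close> may be subtracted from
  \<open>t\<^sup>-\<^sup>s\<close>; the difference then has the sign of the sine.\<close>

lemma sin_odd_power_integral_period_pos:
  fixes s :: real
  assumes "odd n" "0 < s"
    and int: "\<And>T::real. 0 \<le> T \<Longrightarrow> set_integrable lborel {0<..T} (\<lambda>t. sin t ^ n * t powr (- s))"
    and a: "a = 2 * real N * pi"
  shows "0 < set_lebesgue_integral lborel {a<..a + 2 * pi} (\<lambda>t. sin t ^ n * t powr (- s))"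
proof -
  obtain k where n: "n = 2 * k + 1" using \<open>odd n\<close> oddE by blast
  obtain G :: "real \<Rightarrow> real" where
    G: "\<And>t. (G has_real_derivative sin t ^ n) (at t)" "\<And>t. G (t + 2 * pi) = G t"
    using sin_odd_power_antiderivative[of k] unfolding n by blast
  have a0: "0 \<le> a" using a by simp
  define b where "b = (a + pi) powr (- s)"
  have i1: "set_integrable lborel {a<..a + 2 * pi} (\<lambda>t. sin t ^ n * t powr (- s))"
    by (rule set_integrable_subset[OF int[of "a + 2 * pi"]]) (use a0 in auto)
  have "set_integrable lborel {a..a + 2 * pi} (\<lambda>t. sin t ^ n)"
    by (rule borel_integrable_atLeastAtMost') (intro continuous_intros)
  then have i2: "set_integrable lborel {a<..a + 2 * pi} (\<lambda>t. sin t ^ n)"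
    by (rule set_integrable_subset) auto
  have "(LBINT t=a..a + 2 * pi. sin t ^ n) = G (a + 2 * pi) - G a"
  proof (rule interval_integral_FTC_finite)
    show "(G has_vector_derivative sin t ^ n) (at t within {min a (a + 2 * pi)..max a (a + 2 * pi)})" for t
      using G(1)[of t] has_real_derivative_iff_has_vector_derivative has_vector_derivative_at_within by blast
  qed (intro continuous_intros)
  then have period: "set_lebesgue_integral lborel {a<..a + 2 * pi} (\<lambda>t. sin t ^ n) = 0"
    using G(2)[of a] interval_integral_Ioc[of a "a + 2 * pi" "\<lambda>t. sin t ^ n"] by simp
  have sin_shift: "sin t = sin (t - a)" for t
    unfolding a by (simp add: sin_diff)
  have "0 < set_lebesgue_integral lborel {a<..a + 2 * pi} (\<lambda>t. sin t ^ n * t powr (- s) - sin t ^ n * b)"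
  proof (rule set_integral_pos)
    show "set_integrable lborel {a<..a + 2 * pi} (\<lambda>t. sin t ^ n * t powr (- s) - sin t ^ n * b)"
      using i1 i2 by (intro set_integral_diff set_integrable_mult_left) auto
    have pos: "0 < sin t ^ n * t powr (- s) - sin t ^ n * b" if "t \<in> {a<..<a + pi}" for t
    proof -
      have "0 < sin t" using that sin_gt_zero[of "t - a"] sin_shift[of t] by simp
      moreover have "b < t powr (- s)"
        unfolding b_def using that a0 \<open>0 < s\<close> by (intro powr_less_mono2_neg) auto
      ultimately show ?thesis by (simp add: mult_strict_left_mono)
    qed
    show "0 \<le> sin t ^ n * t powr (- s) - sin t ^ n * b" if "t \<in> {a<..a + 2 * pi}" for t
    proof (cases "t < a + pi")
      case False
      \<comment> \<open>On the second half of the period both factors reverse sign. The right end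
        point is separate because \<open>sin_le_zero\<close> requires an argument strictly below 2
        \<pi>.\<close>
      have "sin t \<le> 0" using that False sin_le_zero[of "t - a"] sin_shift[of t]
        by (cases "t = a + 2 * pi") auto
      then have "sin t ^ n \<le> 0" using \<open>odd n\<close> by (simp add: power_le_zero_eq odd_pos)
      moreover have "t powr (- s) \<le> b"
        unfolding b_def using False add_nonneg_pos[OF a0 pi_gt_zero] \<open>0 < s\<close> by (intro powr_mono2') auto
      ultimately show ?thesis by (simp add: mult_left_mono_neg)
    qed (use pos[of t] that in auto)
    show "0 < sin t ^ n * t powr (- s) - sin t ^ n * b" if "t \<in> {a<..<a + pi}" for t
      using that by (rule pos)
    show "a < a + pi" "{a<..<a + pi} \<subseteq> {a<..a + 2 * pi}" by auto
  qed
  also have "set_lebesgue_integral lborel {a<..a + 2 * pi} (\<lambda>t. sin t ^ n * t powr (- s) - sin t ^ n * b) =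
      set_lebesgue_integral lborel {a<..a + 2 * pi} (\<lambda>t. sin t ^ n * t powr (- s))"
    using i1 i2 period by (subst set_integral_diff) auto
  finally show ?thesis .
qed

text \<open>Along whole periods the truncated integrals increase strictly from 0, so the limit is at
  least the contribution of the first period, which is positive.\<close>

lemma sin_odd_power_integral_limit_pos:
  fixes s :: real
  assumes "odd n" "0 < s"
    and int: "\<And>T::real. 0 \<le> T \<Longrightarrow> set_integrable lborel {0<..T} (\<lambda>t. sin t ^ n * t powr (- s))"
    and lim: "((\<lambda>T::real. set_lebesgue_integral lborel {0<..T} (\<lambda>t. sin t ^ n * t powr (- s))) \<longlongrightarrow> c) at_top"
  shows "0 < c"
proof -
  define J where "J T = set_lebesgue_integral lborel {0<..T} (\<lambda>t. sin t ^ n * t powr (- s))" for T :: real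
  have step: "J (2 * real N * pi) < J (2 * real (Suc N) * pi)" for N
  proof -
    define a where "a = 2 * real N * pi"
    have b: "2 * real (Suc N) * pi = a + 2 * pi" by (simp add: a_def algebra_simps)
    have "0 \<le> a" by (simp add: a_def)
    then have "{0<..a + 2 * pi} = {0<..a} \<union> {a<..a + 2 * pi}"
      using pi_gt_zero by (intro ivl_disj_un_two(6)[symmetric]) auto
    then have "J (a + 2 * pi) = J a + set_lebesgue_integral lborel {a<..a + 2 * pi} (\<lambda>t. sin t ^ n * t powr (- s))"
      unfolding J_def using \<open>0 \<le> a\<close> int[of a] set_integrable_subset[OF int[of "a + 2 * pi"], of "{a<..a + 2 * pi}"]
      by (simp only:) (subst set_integral_Un, auto)
    then show ?thesis
      using sin_odd_power_integral_period_pos[OF assms(1,2) int a_def] unfolding b a_def[symmetric] by simp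
  qed
  then have "incseq (\<lambda>N. J (2 * real N * pi))"
    by (intro incseq_SucI less_imp_le)
  moreover have "(\<lambda>N. J (2 * real N * pi)) \<longlonglongrightarrow> c"
  proof (rule filterlim_compose[of J])
    show "(J \<longlongrightarrow> c) at_top" using lim by (simp add: J_def[abs_def])
    show "filterlim (\<lambda>N. 2 * real N * pi) at_top sequentially" by real_asymp
  qed
  ultimately have "J (2 * real 1 * pi) \<le> c"
    by (intro incseq_le)
  moreover have "J (2 * real 0 * pi) = 0"
    by (simp add: J_def set_lebesgue_integral_def)
  ultimately show ?thesis using step[of 0] by simp
qed

lemma g_fun_continuous: "continuous_on UNIV (g_fun n)"
  unfolding g_fun_def by (intro continuous_intros)

lemma g_fun_measurable [measurable]: "g_fun n \<in> borel_measurable borel"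
  using g_fun_continuous by (rule borel_measurable_continuous_onI)

lemma norm_g_fun:
  shows "norm (g_fun n t) \<le> 2 ^ n" and "norm (g_fun n t) \<le> 2 ^ n * \<bar>t\<bar> ^ n"
proof -
  have eq: "norm (g_fun n t) = 2 ^ n * \<bar>sin t\<bar> ^ n"
    by (simp add: g_fun_def norm_mult norm_power power_abs)
  show "norm (g_fun n t) \<le> 2 ^ n" "norm (g_fun n t) \<le> 2 ^ n * \<bar>t\<bar> ^ n"
    unfolding eq by (auto intro!: power_le_one power_mono abs_sin_x_le_abs_x)
qed

lemma norm_g_fun_pos: "0 < t \<Longrightarrow> norm (g_fun n t) \<le> 2 ^ n * t ^ n"
  using norm_g_fun(2)[of n t] by simp

text \<open>For even n the positive p makes the integral absolutely convergent. For odd n it is an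
  oscillating kernel with exponent p + 1, and the range of p is exactly the condition 0 < p + 1 < n
  + 1.\<close>

lemma g_fun_integral:
  assumes "p < real n" "even n \<Longrightarrow> 0 < p" "odd n \<Longrightarrow> -1 < p"
  shows "has_int_0_infm (\<lambda>t. g_fun n t / of_real (t powr (p + 1))) (c_plus p (g_fun n))"
    and "c_plus p (g_fun n) \<noteq> 0"
    and "\<exists>K. \<forall>T. norm (set_lebesgue_integral lborel {0<..T} (\<lambda>t. g_fun n t / of_real (t powr (p + 1)))) \<le> K"
proof -
  define h where "h t = g_fun n t / of_real (t powr (p + 1))" for t
  \<comment> \<open>Dividing by (2 \<i>)^n leaves a real integrand, for which non-vanishing becomes
    a question of sign.\<close>
  define r where "r t = sin t ^ n * t powr (- (p + 1))" for t
  have h_r: "h t = (2 * \<i>) ^ n * of_real (r t)" for t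
    by (simp only: h_def r_def g_fun_def powr_minus_divide) simp
  have r_h: "r = (\<lambda>t. Re (h t / (2 * \<i>) ^ n))"
    by (simp add: h_r)
  have h0: "set_integrable lborel {0<..T} h" if "0 \<le> T" for T
    unfolding h_def
    by (rule set_integrable_kernel_near_0[where C = "2 ^ n" and q = n]) (use norm_g_fun_pos[of _ n] assms that in auto)
  have r0: "set_integrable lborel {0<..T} r" if "0 \<le> T" for T
  proof -
    have "integrable lborel (\<lambda>t. Re (indicator {0<..T} t *\<^sub>R (h t / (2 * \<i>) ^ n)))"
      using set_integrable_divide[of "(2 * \<i>) ^ n" lborel "{0<..T}" h] h0[OF that]
      unfolding set_integrable_def by (intro integrable_Re) auto
    then show ?thesis unfolding r_h set_integrable_def by simp
  qed
  have int_h_r: "set_lebesgue_integral lborel A h = (2 * \<i>) ^ n * of_real (set_lebesgue_integral lborel A r)" for A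
    unfolding h_r by (simp add: set_integral_complex_of_real)
  have "\<exists>c K. c \<noteq> 0 \<and> ((\<lambda>T. set_lebesgue_integral lborel {0<..T} h) \<longlongrightarrow> c) at_top \<and>
      (\<forall>T. norm (set_lebesgue_integral lborel {0<..T} h) \<le> K)"
  proof (cases "even n")
    case True
    have i: "set_integrable lborel {0<..} h"
      unfolding h_def
      by (rule set_integrable_kernel[where C = "2 ^ n" and q = n]) (use norm_g_fun(1) norm_g_fun_pos[of _ n] assms True in auto)
    have ir: "set_integrable lborel {0<..} r"
    proof -
      have "integrable lborel (\<lambda>t. Re (indicator {0<..} t *\<^sub>R (h t / (2 * \<i>) ^ n)))"
        using set_integrable_divide[of "(2 * \<i>) ^ n" lborel "{0<..}" h] i
        unfolding set_integrable_def by (intro integrable_Re) auto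
      then show ?thesis unfolding r_h set_integrable_def by simp
    qed
    have "0 < set_lebesgue_integral lborel {0<..} r"
      by (rule set_integral_pos[OF ir, of 0 pi])
         (use True in \<open>auto simp: r_def zero_le_even_power intro!: mult_pos_pos zero_less_power sin_gt_zero\<close>)
    then have "set_lebesgue_integral lborel {0<..} h \<noteq> 0"
      unfolding int_h_r by simp
    moreover have "norm (set_lebesgue_integral lborel {0<..T} h) \<le>
        set_lebesgue_integral lborel {0<..} (\<lambda>t. norm (h t))" for T
      by (rule norm_set_lebesgue_integral_le[OF i]) auto
    ultimately show ?thesis
      using set_lebesgue_integral_tendsto_at_top[OF i]
      by (intro exI[of _ "set_lebesgue_integral lborel {0<..} h"]
            exI[of _ "set_lebesgue_integral lborel {0<..} (\<lambda>t. norm (h t))"]) auto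
  next
    case False
    then obtain k where k: "n = 2 * k + 1" using oddE by blast
    obtain G0 :: "real \<Rightarrow> real" and C0 where
      G0: "\<And>t. (G0 has_real_derivative sin t ^ n) (at t)" "G0 0 = 0" "\<And>t. \<bar>G0 t\<bar> \<le> C0"
      using sin_odd_power_antiderivative[of k] unfolding k by blast
    have C0: "0 \<le> C0" using G0(3)[of 0] by linarith
    define G where "G t = (2 * \<i>) ^ n * of_real (G0 t)" for t
    \<comment> \<open>The locale has a single constant; \<open>max 1 C0\<close> makes it large
      enough for the kernel and for its primitive.\<close>
    interpret oscillating_kernel "g_fun n" G "2 ^ n * max 1 C0" n "p + 1"
    proof
      show "(G has_vector_derivative g_fun n t) (at t)" for t
        unfolding G_def g_fun_def
        by (intro has_vector_derivative_mult_right has_vector_derivative_of_real G0(1))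
      show "continuous_on UNIV (g_fun n)" by (rule g_fun_continuous)
      show "G 0 = 0" by (simp add: G_def G0)
      show "norm (G t) \<le> 2 ^ n * max 1 C0" for t
        using G0(3)[of t] by (simp add: G_def norm_mult norm_power)
      show "norm (g_fun n t) \<le> 2 ^ n * max 1 C0 * t ^ n" if "0 < t" for t
      proof -
        have "norm (g_fun n t) \<le> 2 ^ n * t ^ n" using that by (rule norm_g_fun_pos)
        also have "\<dots> \<le> 2 ^ n * max 1 C0 * t ^ n" using that by (intro mult_right_mono) auto
        finally show ?thesis .
      qed
    qed (use assms False in auto)
    define c where "c = of_real (p + 1) * set_lebesgue_integral lborel {0<..} (\<lambda>t. G t / of_real (t powr (p + 1 + 1)))"
    obtain K where K: "\<And>T. norm (set_lebesgue_integral lborel {0<..T} h) \<le> K"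
      using integral_bounded unfolding h_def by blast
    have lim: "((\<lambda>T. set_lebesgue_integral lborel {0<..T} h) \<longlongrightarrow> c) at_top"
      using tendsto_integral unfolding h_def[abs_def] c_def .
    then have "((\<lambda>T. Re (set_lebesgue_integral lborel {0<..T} h / (2 * \<i>) ^ n)) \<longlongrightarrow> Re (c / (2 * \<i>) ^ n)) at_top"
      by (intro tendsto_intros) auto
    then have "((\<lambda>T. set_lebesgue_integral lborel {0<..T} r) \<longlongrightarrow> Re (c / (2 * \<i>) ^ n)) at_top"
      by (simp add: int_h_r)
    then have "0 < Re (c / (2 * \<i>) ^ n)"
      unfolding r_def[abs_def]
      by (rule sin_odd_power_integral_limit_pos[rotated 3])
         (use False assms r0 in \<open>auto simp: r_def[abs_def]\<close>)
    then have "c \<noteq> 0" by auto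
    then show ?thesis using lim K by blast
  qed
  then obtain c K where c: "c \<noteq> 0" "((\<lambda>T. set_lebesgue_integral lborel {0<..T} h) \<longlongrightarrow> c) at_top"
      and K: "\<And>T. norm (set_lebesgue_integral lborel {0<..T} h) \<le> K"
    by blast
  have h_c: "has_int_0_infm h c"
    unfolding has_int_0_infm_def using c h0 by auto
  have "c_plus p (g_fun n) = c"
    unfolding c_plus_def h_def[symmetric]
    by (rule the_equality) (use has_int_0_infm_imp_0p[OF h_c] has_int_0p_infm_unique in auto)
  then show "has_int_0_infm (\<lambda>t. g_fun n t / of_real (t powr (p + 1))) (c_plus p (g_fun n))"
    "c_plus p (g_fun n) \<noteq> 0"
    "\<exists>K. \<forall>T. norm (set_lebesgue_integral lborel {0<..T} (\<lambda>t. g_fun n t / of_real (t powr (p + 1)))) \<le> K"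
    using h_c c K unfolding h_def[abs_def] by auto
qed

section \<open>Rotating the Gamma integral to the imaginary axis\<close>

lemma integral_tendsto_dominated:
  fixes s :: "real \<Rightarrow> 'a \<Rightarrow> complex" and w :: "'a \<Rightarrow> real"
  assumes [measurable]: "f \<in> borel_measurable M" "\<And>t. t \<in> S - {t0} \<Longrightarrow> s t \<in> borel_measurable M"
    and w: "integrable M w"
    and lim: "AE x in M. ((\<lambda>t. s t x) \<longlongrightarrow> f x) (at t0 within S)"
    and bound: "\<And>t. t \<in> S - {t0} \<Longrightarrow> AE x in M. norm (s t x) \<le> w x"
  shows "((\<lambda>t. \<integral>x. s t x \<partial>M) \<longlongrightarrow> (\<integral>x. f x \<partial>M)) (at t0 within S)"
  unfolding tendsto_at_iff_sequentially comp_def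
proof safe
  fix X :: "nat \<Rightarrow> real" assume X: "\<forall>i. X i \<in> S - {t0}" "X \<longlonglongrightarrow> t0"
  show "(\<lambda>n. \<integral>x. s (X n) x \<partial>M) \<longlonglongrightarrow> (\<integral>x. f x \<partial>M)"
  proof (rule integral_dominated_convergence[OF _ _ w])
    show "AE x in M. (\<lambda>i. s (X i) x) \<longlonglongrightarrow> f x"
      using lim by eventually_elim (use X in \<open>auto simp: tendsto_at_iff_sequentially comp_def\<close>)
  qed (use assms X in auto)
qed

lemma has_vector_derivative_iff_LIM:
  fixes f :: "real \<Rightarrow> 'b::real_normed_vector"
  shows "(f has_vector_derivative D) (at x) \<longleftrightarrow> ((\<lambda>h. (f (x + h) - f x) /\<^sub>R h) \<longlongrightarrow> D) (at 0)"
proof -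
  have eq: "norm (f (x + h) - f x - h *\<^sub>R D) / norm h = norm ((f (x + h) - f x) /\<^sub>R h - D)" if "h \<noteq> 0" for h
  proof -
    have "(f (x + h) - f x) /\<^sub>R h - D = (f (x + h) - f x - h *\<^sub>R D) /\<^sub>R h"
      using that by (simp add: scaleR_diff_right)
    then show ?thesis by (simp add: divide_inverse mult.commute)
  qed
  have "(f has_vector_derivative D) (at x) \<longleftrightarrow>
      ((\<lambda>h. norm (f (x + h) - f x - h *\<^sub>R D) / norm h) \<longlongrightarrow> 0) (at 0)"
    by (simp add: has_vector_derivative_def has_derivative_at bounded_linear_scaleR_left)
  also have "\<dots> \<longleftrightarrow> ((\<lambda>h. norm ((f (x + h) - f x) /\<^sub>R h - D)) \<longlongrightarrow> 0) (at 0)"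
    by (rule filterlim_cong[OF refl refl], unfold eventually_at_filter)
       (intro always_eventually allI impI eq)
  also have "\<dots> \<longleftrightarrow> ((\<lambda>h. (f (x + h) - f x) /\<^sub>R h) \<longlongrightarrow> D) (at 0)"
    by (simp add: tendsto_norm_zero_iff Lim_null[symmetric])
  finally show ?thesis .
qed

text \<open>By the mean value inequality, a bound w on the derivative also bounds every difference
  quotient with step below e, so dominated convergence applies to the quotients.\<close>

lemma has_vector_derivative_integral:
  fixes g :: "real \<Rightarrow> 'a \<Rightarrow> complex" and w :: "'a \<Rightarrow> real"
  assumes "0 < e"
    and int: "\<And>t. \<bar>t - t0\<bar> < e \<Longrightarrow> integrable M (g t)"
    and deriv: "\<And>t x. \<bar>t - t0\<bar> < e \<Longrightarrow> x \<in> space M \<Longrightarrow> ((\<lambda>t. g t x) has_vector_derivative g' t x) (at t)"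
    and [measurable]: "g' t0 \<in> borel_measurable M"
    and w: "integrable M w" and bound: "\<And>t x. \<bar>t - t0\<bar> < e \<Longrightarrow> x \<in> space M \<Longrightarrow> norm (g' t x) \<le> w x"
  shows "((\<lambda>t. \<integral>x. g t x \<partial>M) has_vector_derivative (\<integral>x. g' t0 x \<partial>M)) (at t0)"
proof -
  have "((\<lambda>h. \<integral>x. (g (t0 + h) x - g t0 x) /\<^sub>R h \<partial>M) \<longlongrightarrow> (\<integral>x. g' t0 x \<partial>M)) (at 0 within {-e<..<e})"
  proof (rule integral_tendsto_dominated[OF _ _ w])
    show "(\<lambda>x. (g (t0 + h) x - g t0 x) /\<^sub>R h) \<in> borel_measurable M" if "h \<in> {-e<..<e} - {0}" for h
      using int[of "t0 + h"] int[of t0] that \<open>0 < e\<close> by (intro borel_measurable_scaleR borel_measurable_diff) auto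
    show "AE x in M. ((\<lambda>h. (g (t0 + h) x - g t0 x) /\<^sub>R h) \<longlongrightarrow> g' t0 x) (at 0 within {-e<..<e})"
      using deriv[of t0] \<open>0 < e\<close>
      by (intro AE_I2) (auto simp: has_vector_derivative_iff_LIM intro: tendsto_within_subset)
    show "AE x in M. norm ((g (t0 + h) x - g t0 x) /\<^sub>R h) \<le> w x" if h: "h \<in> {-e<..<e} - {0}" for h
    proof (rule AE_I2)
      fix x assume x: "x \<in> space M"
      have "norm (g (t0 + h) x - g t0 x) \<le> w x * norm (t0 + h - t0)"
      proof (rule differentiable_bound[of "{t0 - e<..<t0 + e}" "\<lambda>t. g t x" "\<lambda>t h. h *\<^sub>R g' t x"])
        show "((\<lambda>t. g t x) has_derivative (\<lambda>h. h *\<^sub>R g' t x)) (at t within {t0 - e<..<t0 + e})"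
          if "t \<in> {t0 - e<..<t0 + e}" for t
          using deriv[of t x] x that
          by (auto simp: has_vector_derivative_def abs_if intro: has_derivative_at_withinI)
        show "onorm (\<lambda>h. h *\<^sub>R g' t x) \<le> w x" if "t \<in> {t0 - e<..<t0 + e}" for t
          using bound[of t x] x that
          by (intro onorm_le) (auto simp: mult.commute[of _ "norm (g' t x)"] abs_less_iff intro!: mult_right_mono)
      qed (use h \<open>0 < e\<close> in auto)
      then show "norm ((g (t0 + h) x - g t0 x) /\<^sub>R h) \<le> w x"
        using h by (simp add: divide_inverse[symmetric] mult.commute[of "inverse _"] pos_divide_le_eq del: scaleR_diff_right)
    qed
  qed auto
  also have "at 0 within {-e<..<e} = at 0"
    using \<open>0 < e\<close> by (intro at_within_open) auto
  finally have "((\<lambda>h. \<integral>x. (g (t0 + h) x - g t0 x) /\<^sub>R h \<partial>M) \<longlongrightarrow> (\<integral>x. g' t0 x \<partial>M)) (at 0)" .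
  moreover have "\<forall>\<^sub>F h in at 0. (\<integral>x. (g (t0 + h) x - g t0 x) /\<^sub>R h \<partial>M) =
      ((\<integral>x. g (t0 + h) x \<partial>M) - (\<integral>x. g t0 x \<partial>M)) /\<^sub>R h"
  proof -
    have "\<forall>\<^sub>F h in at 0. h \<in> {-e<..<e}"
      using \<open>0 < e\<close> by (intro eventually_at_in_open') auto
    then show ?thesis
      by eventually_elim (use int \<open>0 < e\<close> in auto)
  qed
  ultimately show ?thesis
    unfolding has_vector_derivative_iff_LIM by (rule Lim_transform_eventually)
qed

text \<open>The left half-plane is convex and the exponential has norm at most 1 on it, so the mean
  value inequality applies with constant 1.\<close>

lemma norm_exp_minus_1_le:
  fixes z :: complex
  assumes "Re z \<le> 0"
  shows "norm (exp z - 1) \<le> norm z" "norm (exp z - 1) \<le> 2"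
proof -
  have "norm (exp z - exp 0) \<le> 1 * norm (z - 0)"
  proof (rule field_differentiable_bound)
    show "convex {z. Re z \<le> 0}" by (rule convex_halfspace_Re_le)
    show "norm (exp w) \<le> 1" if "w \<in> {z. Re z \<le> 0}" for w using that by simp
  qed (use assms in \<open>auto intro: DERIV_subset[OF DERIV_exp]\<close>)
  then show "norm (exp z - 1) \<le> norm z" by simp
  have "norm (exp z) \<le> 1" using assms by simp
  then show "norm (exp z - 1) \<le> 2"
    using norm_triangle_ineq4[of "exp z" 1] by (simp del: norm_exp_eq_Re)
qed

text \<open>The parameter z stands for the ray: z = 1 gives the Gamma integrand, z = \<i> the
  Fourier one. Subtracting 1 makes the kernel vanish to first order at 0, while it stays bounded for
  Re z \<ge> 0.\<close>

definition frac_kernel :: "complex \<Rightarrow> real \<Rightarrow> complex" where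
  "frac_kernel z v = exp (- (z * of_real v)) - 1"

lemma frac_kernel_measurable [measurable]: "frac_kernel z \<in> borel_measurable borel"
  unfolding frac_kernel_def by measurable

lemma norm_frac_kernel:
  assumes "norm z = 1" "0 \<le> Re z" "0 < v"
  shows "norm (frac_kernel z v) \<le> 2 * v ^ 1" "norm (frac_kernel z v) \<le> 2"
proof -
  have "Re (- (z * of_real v)) \<le> 0" using assms by simp
  from norm_exp_minus_1_le[OF this]
  show "norm (frac_kernel z v) \<le> 2 * v ^ 1" "norm (frac_kernel z v) \<le> 2"
    using assms by (auto simp: frac_kernel_def norm_mult)
qed

lemma set_integrable_frac_kernel:
  assumes "norm z = 1" "0 \<le> Re z" "0 < l" "l < 1"
  shows "set_integrable lborel {0<..} (\<lambda>v. frac_kernel z v / of_real (v powr (l + 1)))"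
  by (rule set_integrable_kernel[where C = 2 and q = 1]) (use assms norm_frac_kernel in auto)

text \<open>In closed form this is \<open>Gamma (- l)\<close> times the principal power z^l. Only
  the values at 1 and \<i> are computed, the second by following z along the quarter circle.\<close>

definition frac_integral :: "real \<Rightarrow> complex \<Rightarrow> complex" where
  "frac_integral l z = set_lebesgue_integral lborel {0<..} (\<lambda>v. frac_kernel z v / of_real (v powr (l + 1)))"

text \<open>The primitive of -z e^(-zv) that vanishes at 0 is the fractional kernel, bounded even on
  the imaginary axis, where the exponential no longer decays. So \<open>tendsto_integral\<close>
  expresses the improper integral of the exponential through
  \<open>frac_integral l z\<close>.\<close>

lemma oscillating_kernel_exp:
  assumes "norm z = 1" "0 \<le> Re z" "0 < l" "l < 1"
  shows "oscillating_kernel (\<lambda>v. - z * exp (- (z * of_real v))) (frac_kernel z) 2 0 l"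
proof
  show "(frac_kernel z has_vector_derivative - z * exp (- (z * of_real v))) (at v)" for v
  proof -
    have "((\<lambda>w. exp (- (z * w)) - 1) has_field_derivative - z * exp (- (z * of_real v))) (at (of_real v))"
      by (auto intro!: derivative_eq_intros)
    from has_vector_derivative_real_field[OF this] show ?thesis
      unfolding frac_kernel_def by simp
  qed
  show "norm (- z * exp (- (z * of_real v))) \<le> 2 * v ^ 0" if "0 < v" for v
    using assms that by (simp add: norm_mult) (metis exp_le_one_iff mult_nonneg_nonneg less_imp_le neg_le_0_iff_le order_trans one_le_numeral)
qed (use assms norm_frac_kernel in \<open>auto simp: frac_kernel_def intro!: continuous_intros\<close>)

lemma set_integrable_Gamma_kernel:
  fixes a l :: real
  assumes "0 < a" "l < 1"
  shows "set_integrable lborel {0<..} (\<lambda>v. exp (- a * v) / v powr l)"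
proof -
  have "(\<lambda>v. of_real v powr (of_real (1 - l) - 1) / of_real (exp (a * v)) :: complex) absolutely_integrable_on {0<..}"
    by (rule absolutely_integrable_Gamma_integral) (use assms in auto)
  then have "set_integrable lebesgue {0<..} (\<lambda>v. norm (of_real v powr (of_real (1 - l) - 1) / of_real (exp (a * v)) :: complex))"
    by (rule set_integrable_norm)
  also have "?this \<longleftrightarrow> set_integrable lebesgue {0<..} (\<lambda>v. exp (- a * v) / v powr l)"
    by (rule set_integrable_cong)
       (auto simp: norm_divide norm_mult norm_powr_real_powr powr_minus exp_minus field_simps)
  finally show ?thesis
    unfolding set_integrable_def by (subst (asm) integrable_completion) auto
qed

lemma set_integrable_exp_kernel:
  assumes "0 < Re z" "l < 1"
  shows "set_integrable lborel {0<..} (\<lambda>v. exp (- (z * of_real v)) / of_real (v powr l))"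
proof (rule set_integrable_bound[OF set_integrable_Gamma_kernel[OF assms]])
  show "set_borel_measurable lborel {0<..} (\<lambda>v. exp (- (z * of_real v)) / of_real (v powr l))"
    unfolding set_borel_measurable_def by measurable
qed (auto simp: norm_divide)

text \<open>For Re z > 0 the exponential decays, so the improper integral in
  \<open>tendsto_integral\<close> agrees with a Lebesgue integral. In this form the derivative in
  the angle can be recognised as a multiple of \<open>frac_integral\<close>.\<close>

lemma frac_integral_by_parts:
  assumes "norm z = 1" "0 < Re z" "0 < l" "l < 1"
  shows "of_real l * frac_integral l z =
    - z * set_lebesgue_integral lborel {0<..} (\<lambda>v. exp (- (z * of_real v)) / of_real (v powr l))"
proof -
  interpret oscillating_kernel "\<lambda>v. - z * exp (- (z * of_real v))" "frac_kernel z" 2 0 l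
    using assms by (intro oscillating_kernel_exp) auto
  have "((\<lambda>T. set_lebesgue_integral lborel {0<..T} (\<lambda>v. - z * exp (- (z * of_real v)) / of_real (v powr l))) \<longlongrightarrow>
      set_lebesgue_integral lborel {0<..} (\<lambda>v. - z * exp (- (z * of_real v)) / of_real (v powr l))) at_top"
    using set_integrable_mult_right[OF set_integrable_exp_kernel[of z l], of "- z"] assms
    by (intro set_lebesgue_integral_tendsto_at_top) simp
  from tendsto_unique[OF _ tendsto_integral this]
  have "of_real l * frac_integral l z =
      set_lebesgue_integral lborel {0<..} (\<lambda>v. - z * (exp (- (z * of_real v)) / of_real (v powr l)))"
    by (simp add: frac_integral_def)
  then show ?thesis by (simp only: set_integral_mult_right)
qed

lemma Gamma_1_minus:
  fixes l :: real
  assumes "0 < l" "l < 1"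
  shows "Gamma (1 - l) = - l * Gamma (- l)" and "Gamma (- l) \<noteq> 0"
proof -
  have "- l \<notin> \<int>\<^sub>\<le>\<^sub>0"
  proof
    assume "- l \<in> \<int>\<^sub>\<le>\<^sub>0"
    then obtain k :: int where "- l = of_int k" by (auto elim!: nonpos_Ints_cases)
    with assms have "- 1 < k" "k < 0" by linarith+
    then show False by simp
  qed
  then show "Gamma (1 - l) = - l * Gamma (- l)"
    using Gamma_plus1[of "- l"] by simp
  then show "Gamma (- l) \<noteq> 0"
    using Gamma_real_pos[of "1 - l"] assms by auto
qed

text \<open>Integration by parts leads to Euler's integral for \<open>Gamma (1 - l)\<close>; the
  functional equation then returns to -l, where Euler's integral itself diverges.\<close>

lemma frac_integral_1:
  assumes "0 < l" "l < 1"
  shows "frac_integral l 1 = of_real (Gamma (- l))"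
proof -
  have i: "set_integrable lborel {0<..} (\<lambda>v. exp (- v) / v powr l)"
    using set_integrable_Gamma_kernel[of 1 l] assms by simp
  have "((\<lambda>v. exp (- v) / v powr l) has_integral Gamma (1 - l)) {0..}"
    using Gamma_integral_real[of "1 - l"] assms
    by (simp add: powr_minus exp_minus field_simps)
  then have "((\<lambda>v. exp (- v) / v powr l) has_integral Gamma (1 - l)) {0<..}"
    by (subst (asm) has_integral_spike_set_eq[where T = "{0<..}"]) (auto intro: negligible_subset[of "{0}"])
  moreover have "((\<lambda>v. exp (- v) / v powr l) has_integral
      set_lebesgue_integral lborel {0<..} (\<lambda>v. exp (- v) / v powr l)) {0<..}"
    unfolding set_borel_integral_eq_integral(2)[OF i]
    by (intro integrable_integral set_borel_integral_eq_integral(1)[OF i])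
  ultimately have "set_lebesgue_integral lborel {0<..} (\<lambda>v. exp (- v) / v powr l) = Gamma (1 - l)"
    by (rule has_integral_unique[symmetric])
  moreover have "set_lebesgue_integral lborel {0<..} (\<lambda>v. exp (- (1 * of_real v)) / of_real (v powr l) :: complex) =
      of_real (set_lebesgue_integral lborel {0<..} (\<lambda>v. exp (- v) / v powr l))"
    unfolding set_integral_complex_of_real[symmetric] by (simp add: exp_of_real[symmetric])
  ultimately have "of_real l * frac_integral l 1 = - of_real (Gamma (1 - l))"
    using frac_integral_by_parts[of 1 l] assms by simp
  moreover note Gamma_1_minus(1)[OF assms]
  ultimately show ?thesis using assms by simp
qed

text \<open>Together with the integration by parts above, this is the differential equation \<open>H' = i l H\<close> for
  \<open>H(\<theta>)\<close>, the integral along the ray of angle \<open>\<theta>\<close>; it is solved from \<open>\<theta> = 0\<close> up to \<open>\<theta> = \<pi>/2\<close>.\<close>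

lemma frac_integral_cis_deriv:
  assumes "0 < l" "l < 1" "0 < \<theta>" "\<theta> < pi / 2"
  shows "((\<lambda>\<theta>. frac_integral l (cis \<theta>)) has_vector_derivative \<i> * of_real l * frac_integral l (cis \<theta>)) (at \<theta>)"
proof -
  \<comment> \<open>The neighbourhood of \<theta> must stay away from \<pi>/2, so that one c > 0
    bounds all its cosines from below; e^(-cv) v^(-l) is then the majorant.\<close>
  define e where "e = min \<theta> ((pi / 2 - \<theta>) / 2)"
  have e: "0 < e" "e \<le> \<theta>" "\<theta> + e < pi / 2" using assms by (auto simp: e_def min_def field_simps)
  define c where "c = cos (\<theta> + e)"
  have c: "0 < c" unfolding c_def using e assms by (intro cos_gt_zero) auto
  have cos_ge: "c \<le> cos t" if "\<bar>t - \<theta>\<bar> < e" for t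
    unfolding c_def using that e assms by (intro cos_monotone_0_pi_le) (auto simp: abs_if split: if_splits)
  \<comment> \<open>Differentiating in the angle brings down a factor v, which lowers the exponent
    from l + 1 to l.\<close>
  define D where "D t v = - \<i> * cis t * (exp (- (cis t * of_real v)) / of_real (v powr l))" for t v
  have "((\<lambda>t. \<integral>v. indicator {0<..} v *\<^sub>R (frac_kernel (cis t) v / of_real (v powr (l + 1))) \<partial>lborel)
      has_vector_derivative (\<integral>v. indicator {0<..} v *\<^sub>R D \<theta> v \<partial>lborel)) (at \<theta>)"
  proof (rule has_vector_derivative_integral[OF \<open>0 < e\<close>])
    show "integrable lborel (\<lambda>v. indicator {0<..} v *\<^sub>R (frac_kernel (cis t) v / of_real (v powr (l + 1))))"
      if "\<bar>t - \<theta>\<bar> < e" for t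
      using set_integrable_frac_kernel[of "cis t" l] cos_ge[OF that] c assms by (simp add: set_integrable_def)
    show "integrable lborel (\<lambda>v. indicator {0<..} v *\<^sub>R (exp (- c * v) / v powr l))"
      using set_integrable_Gamma_kernel[OF c, of l] assms unfolding set_integrable_def by simp
    show "norm (indicator {0<..} v *\<^sub>R D t v) \<le> indicator {0<..} v *\<^sub>R (exp (- c * v) / v powr l)"
      if "\<bar>t - \<theta>\<bar> < e" for t v
    proof (cases "0 < v")
      case True
      have "norm (D t v) = exp (- (cos t * v)) / v powr l"
        by (simp add: D_def norm_mult norm_divide)
      also have "\<dots> \<le> exp (- c * v) / v powr l"
        using cos_ge[OF that] True by (intro divide_right_mono) auto
      finally show ?thesis using True by simp
    qed (simp add: indicator_def)
    show "((\<lambda>t. indicator {0<..} v *\<^sub>R (frac_kernel (cis t) v / of_real (v powr (l + 1))))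
        has_vector_derivative indicator {0<..} v *\<^sub>R D t v) (at t)" for t v
    proof (cases "0 < v")
      case True
      define E where "E = (\<lambda>w. exp (- (exp (\<i> * w) * of_real v)))"
      have "(E has_field_derivative E (of_real t) * (- (exp (\<i> * of_real t) * \<i> * of_real v))) (at (of_real t))"
        unfolding E_def by (rule derivative_eq_intros refl | simp)+
      then have "((\<lambda>w. (E w - 1) / of_real (v powr (l + 1)))
          has_field_derivative (E (of_real t) * (- (exp (\<i> * of_real t) * \<i> * of_real v)) - 0) / of_real (v powr (l + 1)))
          (at (of_real t))"
        by (intro DERIV_cdivide DERIV_diff DERIV_const)
      from has_vector_derivative_real_field[OF this]
      have "((\<lambda>t. frac_kernel (cis t) v / of_real (v powr (l + 1))) has_vector_derivative
          (exp (- (cis t * of_real v)) * (- (cis t * \<i> * of_real v))) / of_real (v powr (l + 1))) (at t)"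
        by (simp add: frac_kernel_def cis_conv_exp E_def)
      also have "(exp (- (cis t * of_real v)) * (- (cis t * \<i> * of_real v))) / of_real (v powr (l + 1)) = D t v"
        using True by (simp add: D_def powr_add field_simps)
      finally show ?thesis using True by simp
    qed (simp add: indicator_def)
    show "(\<lambda>v. indicator {0<..} v *\<^sub>R D \<theta> v) \<in> borel_measurable lborel"
      unfolding D_def by measurable
  qed
  moreover have "(\<integral>v. indicator {0<..} v *\<^sub>R D \<theta> v \<partial>lborel) =
      - \<i> * cis \<theta> * set_lebesgue_integral lborel {0<..} (\<lambda>v. exp (- (cis \<theta> * of_real v)) / of_real (v powr l))"
    unfolding set_integral_mult_right[symmetric] by (simp add: D_def set_lebesgue_integral_def)
  moreover have "\<dots> = \<i> * (of_real l * frac_integral l (cis \<theta>))"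
    using assms by (subst frac_integral_by_parts) (auto intro!: cos_gt_zero)
  ultimately show ?thesis
    by (simp add: frac_integral_def set_lebesgue_integral_def mult.assoc)
qed

text \<open>This reaches the end point \<pi>/2, where the exponential decay used for the derivative
  is lost. The kernel itself is dominated by min 2 (2v) at every angle.\<close>

lemma frac_integral_cis_continuous:
  assumes "0 < l" "l < 1"
  shows "continuous_on {0..pi / 2} (\<lambda>\<theta>. frac_integral l (cis \<theta>))"
  unfolding continuous_on_def frac_integral_def set_lebesgue_integral_def
proof
  fix \<theta> assume \<theta>: "\<theta> \<in> {0..pi / 2}"
  show "((\<lambda>\<theta>. \<integral>v. indicator {0<..} v *\<^sub>R (frac_kernel (cis \<theta>) v / of_real (v powr (l + 1))) \<partial>lborel) \<longlongrightarrow>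
      (\<integral>v. indicator {0<..} v *\<^sub>R (frac_kernel (cis \<theta>) v / of_real (v powr (l + 1))) \<partial>lborel)) (at \<theta> within {0..pi / 2})"
  proof (rule integral_tendsto_dominated)
    have "set_integrable lborel {0<..} (\<lambda>v. of_real (min 2 (2 * v)) / of_real (v powr (l + 1)) :: complex)"
      by (rule set_integrable_kernel[where C = 2 and q = 1]) (use assms in auto)
    from set_integrable_norm[OF this]
    show "integrable lborel (\<lambda>v. indicator {0<..} v *\<^sub>R norm (of_real (min 2 (2 * v)) / of_real (v powr (l + 1)) :: complex))"
      by (simp add: set_integrable_def)
    show "AE v in lborel. norm (indicator {0<..} v *\<^sub>R (frac_kernel (cis t) v / of_real (v powr (l + 1)))) \<le>
        indicator {0<..} v *\<^sub>R norm (of_real (min 2 (2 * v)) / of_real (v powr (l + 1)) :: complex)"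
      if "t \<in> {0..pi / 2} - {\<theta>}" for t
    proof (rule AE_I2)
      fix v
      show "norm (indicator {0<..} v *\<^sub>R (frac_kernel (cis t) v / of_real (v powr (l + 1)))) \<le>
          indicator {0<..} v *\<^sub>R norm (of_real (min 2 (2 * v)) / of_real (v powr (l + 1)) :: complex)"
      proof (cases "0 < v")
        case True
        have "0 \<le> cos t" using that by (intro cos_ge_zero) auto
        then have "norm (frac_kernel (cis t) v) \<le> \<bar>min 2 (2 * v)\<bar>"
          using norm_frac_kernel[of "cis t" v] True by simp
        then show ?thesis using True by (simp add: norm_divide divide_right_mono)
      qed simp
    qed
    show "AE v in lborel. ((\<lambda>t. indicator {0<..} v *\<^sub>R (frac_kernel (cis t) v / of_real (v powr (l + 1)))) \<longlongrightarrow>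
        indicator {0<..} v *\<^sub>R (frac_kernel (cis \<theta>) v / of_real (v powr (l + 1)))) (at \<theta> within {0..pi / 2})"
    proof (rule AE_I2)
      fix v
      have "continuous_on {0..pi / 2} (\<lambda>t. indicator {0<..} v *\<^sub>R (frac_kernel (cis t) v / of_real (v powr (l + 1))))"
        unfolding frac_kernel_def divide_inverse cis_conv_exp by (intro continuous_intros)
      then show "((\<lambda>t. indicator {0<..} v *\<^sub>R (frac_kernel (cis t) v / of_real (v powr (l + 1)))) \<longlongrightarrow>
        indicator {0<..} v *\<^sub>R (frac_kernel (cis \<theta>) v / of_real (v powr (l + 1)))) (at \<theta> within {0..pi / 2})"
        using \<theta> by (auto simp: continuous_on_def)
    qed
  qed auto
qed

lemma frac_integral_ii:
  assumes "0 < l" "l < 1"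
  shows "frac_integral l \<i> = of_real (Gamma (- l)) * cis (l * pi / 2)"
proof -
  \<comment> \<open>The factor cis (- l \<theta>) is the integrating factor of the differential
    equation, so K has derivative zero inside the interval. The two end points, where only
    continuity is known, form the finite exceptional set.\<close>
  define K where "K \<theta> = cis (- l * \<theta>) * frac_integral l (cis \<theta>)" for \<theta>
  have "K (pi / 2) = of_real (Gamma (- l))"
  proof (rule has_derivative_zero_unique_strong_interval)
    show "finite {0, pi / 2}" by simp
    show "continuous_on {0..pi / 2} K"
      unfolding K_def cis_conv_exp[of "- l * _"] using frac_integral_cis_continuous[OF assms]
      by (intro continuous_intros) auto
    show "K 0 = of_real (Gamma (- l))"
      using frac_integral_1[OF assms] by (simp add: K_def)
    show "(K has_derivative (\<lambda>h. 0)) (at \<theta> within {0..pi / 2})" if "\<theta> \<in> {0..pi / 2} - {0, pi / 2}" for \<theta>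
    proof -
      have "((\<lambda>w. exp (\<i> * (- of_real l * w))) has_field_derivative
          (- \<i> * of_real l) * exp (\<i> * (- of_real l * of_real \<theta>))) (at (of_real \<theta>))"
        by (auto intro!: derivative_eq_intros)
      from has_vector_derivative_real_field[OF this]
      have "((\<lambda>\<theta>. cis (- l * \<theta>)) has_vector_derivative (- \<i> * of_real l) * cis (- l * \<theta>)) (at \<theta>)"
        by (simp add: cis_conv_exp)
      moreover have "((\<lambda>\<theta>. frac_integral l (cis \<theta>)) has_vector_derivative \<i> * of_real l * frac_integral l (cis \<theta>)) (at \<theta>)"
        using that assms by (intro frac_integral_cis_deriv) auto
      ultimately have "(K has_vector_derivative cis (- l * \<theta>) * (\<i> * of_real l * frac_integral l (cis \<theta>)) +
          ((- \<i> * of_real l) * cis (- l * \<theta>)) * frac_integral l (cis \<theta>)) (at \<theta>)"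
        unfolding K_def by (rule has_vector_derivative_mult)
      then have "(K has_vector_derivative 0) (at \<theta>)" by (simp add: algebra_simps)
      then show ?thesis
        by (auto simp: has_vector_derivative_def intro: has_derivative_at_withinI)
    qed
  qed simp
  then have "cis (- (l * pi / 2)) * frac_integral l \<i> = of_real (Gamma (- l))"
    by (simp add: K_def)
  moreover have "frac_integral l \<i> = cis (l * pi / 2) * (cis (- (l * pi / 2)) * frac_integral l \<i>)"
    unfolding mult.assoc[symmetric] cis_mult by simp
  ultimately show ?thesis
    by (metis mult.commute)
qed

section \<open>Integrals over the law of a random variable\<close>

text \<open>The principal power \<open>(ix)\<^sup>r\<close>, except that \<open>(i0)\<^sup>0 = 1\<close>, so that order \<open>0\<close> gives back the
  characteristic function itself, atom at \<open>0\<close> included.\<close>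

definition ipow :: "real \<Rightarrow> real \<Rightarrow> complex" where
  "ipow r x = (if x = 0 then of_bool (r = 0) else of_real (\<bar>x\<bar> powr r) * cis (r * pi / 2 * sgn x))"

lemma ipow_measurable [measurable]: "ipow r \<in> borel_measurable borel"
  unfolding ipow_def cis_conv_exp sgn_if by measurable

lemma norm_ipow: "x \<noteq> 0 \<Longrightarrow> norm (ipow r x) = \<bar>x\<bar> powr r"
  by (simp add: ipow_def norm_mult)

text \<open>At x = 0 this would fail for s = -r with r nonzero: the left side is 1 and the right
  side 0.\<close>

lemma ipow_add: "x \<noteq> 0 \<Longrightarrow> ipow (r + s) x = ipow r x * ipow s x"
  by (simp add: ipow_def powr_add cis_mult[symmetric] distrib_right add_divide_distrib)

lemma ipow_0: "ipow 0 x = 1"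
  by (simp add: ipow_def)

lemma ipow_1 [simp]: "ipow 1 x = \<i> * of_real x"
  by (cases "0 < x") (auto simp: ipow_def sgn_if complex_eq_iff)

lemma ipow_Suc: "ipow (real (Suc k)) x = \<i> * of_real x * ipow (real k) x"
proof (cases "x = 0")
  case False
  then show ?thesis using ipow_add[of x "real k" 1] by (simp add: add.commute mult.commute)
qed (simp add: ipow_def)

text \<open>The exponent l - 1 is l from the power less 1 from dv. Since A lies in the positive
  half-line, the power of the product cv splits.\<close>

lemma
  fixes k :: "real \<Rightarrow> complex"
  assumes "0 < c" "A \<subseteq> {0<..}"
  shows set_integral_kernel_scale:
      "set_lebesgue_integral lborel {v. c * v \<in> A} (\<lambda>v. k (c * v) / of_real (v powr l)) =
       of_real (c powr (l - 1)) * set_lebesgue_integral lborel A (\<lambda>v. k v / of_real (v powr l))"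
    and set_integrable_kernel_scale:
      "set_integrable lborel A (\<lambda>v. k v / of_real (v powr l)) \<Longrightarrow>
       set_integrable lborel {v. c * v \<in> A} (\<lambda>v. k (c * v) / of_real (v powr l))"
proof -
  define f where "f v = indicator A v *\<^sub>R (k v / of_real (v powr l))" for v
  have f: "f (0 + c * v) = of_real (c powr (- l)) *
      (indicator {v. c * v \<in> A} v *\<^sub>R (k (c * v) / of_real (v powr l)))" for v
  proof (cases "c * v \<in> A")
    case True
    then have "0 < v" using assms by (auto simp: zero_less_mult_iff dest!: subsetD)
    then show ?thesis using True \<open>0 < c\<close> by (simp add: f_def powr_mult powr_minus field_simps)
  qed (simp add: f_def)
  have "set_lebesgue_integral lborel A (\<lambda>v. k v / of_real (v powr l)) = (\<integral>v. f v \<partial>lborel)"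
    by (simp add: f_def set_lebesgue_integral_def)
  also have "\<dots> = \<bar>c\<bar> *\<^sub>R (\<integral>v. f (0 + c * v) \<partial>lborel)"
    using \<open>0 < c\<close> by (intro lborel_integral_real_affine) auto
  also have "\<dots> = of_real (c powr (1 - l)) *
      set_lebesgue_integral lborel {v. c * v \<in> A} (\<lambda>v. k (c * v) / of_real (v powr l))"
    unfolding f integral_mult_right_zero set_lebesgue_integral_def
    using \<open>0 < c\<close> by (simp add: scaleR_conv_of_real powr_diff powr_minus field_simps)
  finally have "of_real (c powr (l - 1)) * set_lebesgue_integral lborel A (\<lambda>v. k v / of_real (v powr l)) =
      of_real (c powr (l - 1) * c powr (1 - l)) *
      set_lebesgue_integral lborel {v. c * v \<in> A} (\<lambda>v. k (c * v) / of_real (v powr l))"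
    by (simp add: mult.assoc)
  also have "c powr (l - 1) * c powr (1 - l) = 1"
    using \<open>0 < c\<close> by (simp add: powr_add[symmetric])
  finally show "set_lebesgue_integral lborel {v. c * v \<in> A} (\<lambda>v. k (c * v) / of_real (v powr l)) =
       of_real (c powr (l - 1)) * set_lebesgue_integral lborel A (\<lambda>v. k v / of_real (v powr l))"
    by simp
  assume "set_integrable lborel A (\<lambda>v. k v / of_real (v powr l))"
  then have "integrable lborel (\<lambda>v. of_real (c powr l) * f (0 + c * v))"
    using \<open>0 < c\<close>
    by (intro integrable_mult_right lborel_integrable_real_affine) (auto simp: f_def set_integrable_def)
  then show "set_integrable lborel {v. c * v \<in> A} (\<lambda>v. k (c * v) / of_real (v powr l))"
    unfolding f set_integrable_def using \<open>0 < c\<close> by (simp add: powr_minus field_simps)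
qed

text \<open>Only |x| is scaled out, because the domain must remain the positive half-line; the sign
  of x stays in the kernel and is treated by conjugation or parity.\<close>

lemma kernel_scaled_eq:
  fixes k :: "real \<Rightarrow> complex"
  assumes "x \<noteq> 0"
  shows "set_lebesgue_integral lborel {0<..T} (\<lambda>v. k (v * x) / of_real (v powr l)) =
      of_real (\<bar>x\<bar> powr (l - 1)) *
      set_lebesgue_integral lborel {0<..\<bar>x\<bar> * T} (\<lambda>v. k (sgn x * v) / of_real (v powr l))"
    and "set_lebesgue_integral lborel {0<..} (\<lambda>v. k (v * x) / of_real (v powr l)) =
      of_real (\<bar>x\<bar> powr (l - 1)) *
      set_lebesgue_integral lborel {0<..} (\<lambda>v. k (sgn x * v) / of_real (v powr l))"
proof -
  have sets: "{v. \<bar>x\<bar> * v \<in> {0<..\<bar>x\<bar> * T}} = {0<..T}" "{v. \<bar>x\<bar> * v \<in> {0<..}} = {0<..}"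
    using assms by (auto simp: zero_less_mult_iff)
  have sgn: "sgn x * (\<bar>x\<bar> * v) = v * x" for v
    by (simp add: sgn_if)
  have x: "0 < \<bar>x\<bar>" using assms by simp
  show "set_lebesgue_integral lborel {0<..T} (\<lambda>v. k (v * x) / of_real (v powr l)) =
      of_real (\<bar>x\<bar> powr (l - 1)) *
      set_lebesgue_integral lborel {0<..\<bar>x\<bar> * T} (\<lambda>v. k (sgn x * v) / of_real (v powr l))"
    by (rule set_integral_kernel_scale[OF x, of "{0<..\<bar>x\<bar> * T}" "\<lambda>v. k (sgn x * v)" l, unfolded sets sgn]) auto
  show "set_lebesgue_integral lborel {0<..} (\<lambda>v. k (v * x) / of_real (v powr l)) =
      of_real (\<bar>x\<bar> powr (l - 1)) *
      set_lebesgue_integral lborel {0<..} (\<lambda>v. k (sgn x * v) / of_real (v powr l))"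
    by (rule set_integral_kernel_scale[OF x, of "{0<..}" "\<lambda>v. k (sgn x * v)" l, unfolded sets sgn]) auto
qed

lemma norm_kernel_scaled_eq:
  fixes k :: "real \<Rightarrow> complex"
  assumes "x \<noteq> 0"
  shows "(\<integral>v\<in>{0<..}. norm (k (v * x) / of_real (v powr l)) \<partial>lborel) =
      \<bar>x\<bar> powr (l - 1) * (\<integral>v\<in>{0<..}. norm (k (sgn x * v) / of_real (v powr l)) \<partial>lborel)"
proof -
  \<comment> \<open>Read as a complex kernel, the norm falls under the complex scaling
    lemma.\<close>
  have "of_real (norm (k v / of_real (w powr l))) = (of_real (norm (k v)) / of_real (w powr l) :: complex)" for v w
    by (simp add: norm_divide)
  then have "complex_of_real (\<integral>v\<in>{0<..}. norm (k (v * x) / of_real (v powr l)) \<partial>lborel) =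
      of_real (\<bar>x\<bar> powr (l - 1) * (\<integral>v\<in>{0<..}. norm (k (sgn x * v) / of_real (v powr l)) \<partial>lborel))"
    unfolding of_real_mult set_integral_complex_of_real[symmetric]
    using kernel_scaled_eq(2)[OF assms, of "\<lambda>y. of_real (norm (k y))" l] by simp
  then show ?thesis by (simp only: of_real_eq_iff)
qed

lemma kernel_scaled_integrable:
  fixes k :: "real \<Rightarrow> complex"
  assumes "x \<noteq> 0" "set_integrable lborel {0<..} (\<lambda>v. k (sgn x * v) / of_real (v powr l))"
  shows "set_integrable lborel {0<..} (\<lambda>v. k (v * x) / of_real (v powr l))"
proof -
  have sets: "{v. \<bar>x\<bar> * v \<in> {0<..}} = {0<..}"
    using assms by (auto simp: zero_less_mult_iff)
  have sgn: "sgn x * (\<bar>x\<bar> * v) = v * x" for v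
    by (simp add: sgn_if)
  show ?thesis
    using set_integrable_kernel_scale[of "\<bar>x\<bar>" "{0<..}" "\<lambda>v. k (sgn x * v)" l, unfolded sets sgn] assms by simp
qed

lemma set_integral_cnj:
  "set_lebesgue_integral M A (\<lambda>x. cnj (f x)) = cnj (set_lebesgue_integral M A f)"
proof -
  have "indicator A x *\<^sub>R cnj (f x) = cnj (indicator A x *\<^sub>R f x)" for x
    by (simp add: indicator_def)
  then show ?thesis by (simp only: set_lebesgue_integral_def Bochner_Integration.integral_cnj)
qed

text \<open>This integral is only conditionally convergent, so it is obtained from
  \<open>tendsto_integral\<close> at z = \<i> rather than from
  \<open>frac_integral_by_parts\<close>. Conjugation deals with negative x.\<close>

lemma integral_iexp_kernel:
  assumes "0 < l" "l < 1" "x \<noteq> 0"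
  shows "((\<lambda>T. set_lebesgue_integral lborel {0<..T} (\<lambda>v. iexp (- (v * x)) / of_real (v powr l))) \<longlongrightarrow>
     of_real (Gamma (1 - l)) * ipow (l - 1) x) at_top"
proof -
  define J where "J T = set_lebesgue_integral lborel {0<..T} (\<lambda>v. iexp (- v) / of_real (v powr l))" for T
  interpret oscillating_kernel "\<lambda>v. - \<i> * exp (- (\<i> * of_real v))" "frac_kernel \<i>" 2 0 l
    using assms by (intro oscillating_kernel_exp) auto
  have "((\<lambda>T. \<i> * set_lebesgue_integral lborel {0<..T} (\<lambda>v. - \<i> * exp (- (\<i> * of_real v)) / of_real (v powr l))) \<longlongrightarrow>
      \<i> * (of_real l * frac_integral l \<i>)) at_top"
    unfolding frac_integral_def by (intro tendsto_intros tendsto_integral)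
  also have "(\<lambda>T. \<i> * set_lebesgue_integral lborel {0<..T} (\<lambda>v. - \<i> * exp (- (\<i> * of_real v)) / of_real (v powr l))) = J"
    unfolding J_def set_integral_mult_right[symmetric] by (simp add: mult.assoc[symmetric])
  \<comment> \<open>As \<open>l * Gamma (- l)\<close> is \<open>- Gamma (1 - l)\<close>, a factor
    -\<i> remains: a rotation by -\<pi>/2, which turns l into l - 1 in the angle.\<close>
  also have "\<i> * (of_real l * frac_integral l \<i>) = of_real (Gamma (1 - l)) * cis ((l - 1) * pi / 2)"
  proof -
    have "Gamma (1 - l) = - l * Gamma (- l)"
      using assms by (intro Gamma_1_minus)
    moreover have "cis ((l - 1) * pi / 2) = - \<i> * cis (l * pi / 2)"
    proof -
      have "(l - 1) * pi / 2 = - (pi / 2) + l * pi / 2" by (simp add: field_simps)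
      then show ?thesis by (simp only: cis_mult[symmetric]) (simp add: complex_eq_iff)
    qed
    ultimately show ?thesis
      using frac_integral_ii[of l] assms by simp
  qed
  finally have J: "(J \<longlongrightarrow> of_real (Gamma (1 - l)) * cis ((l - 1) * pi / 2)) at_top" .
  have x: "filterlim (\<lambda>T. \<bar>x\<bar> * T) at_top at_top"
    using \<open>x \<noteq> 0\<close> by (intro filterlim_tendsto_pos_mult_at_top[OF tendsto_const]) (auto intro: filterlim_ident)
  show ?thesis
  proof (cases "0 < x")
    case True
    have "((\<lambda>T. of_real (\<bar>x\<bar> powr (l - 1)) * J (\<bar>x\<bar> * T)) \<longlongrightarrow>
        of_real (\<bar>x\<bar> powr (l - 1)) * (of_real (Gamma (1 - l)) * cis ((l - 1) * pi / 2))) at_top"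
      by (intro tendsto_intros filterlim_compose[OF J x])
    then show ?thesis
      using kernel_scaled_eq(1)[OF \<open>x \<noteq> 0\<close>, of _ "\<lambda>v. iexp (- v)" l] True
      by (simp add: J_def ipow_def mult_ac)
  next
    case False
    have "((\<lambda>T. of_real (\<bar>x\<bar> powr (l - 1)) * cnj (J (\<bar>x\<bar> * T))) \<longlongrightarrow>
        of_real (\<bar>x\<bar> powr (l - 1)) * cnj (of_real (Gamma (1 - l)) * cis ((l - 1) * pi / 2))) at_top"
      by (intro tendsto_intros filterlim_compose[OF J x])
    moreover have "ipow (l - 1) x = of_real (\<bar>x\<bar> powr (l - 1)) * cnj (cis ((l - 1) * pi / 2))"
      using False \<open>x \<noteq> 0\<close> by (simp add: ipow_def sgn_if cis_cnj)
    ultimately show ?thesis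
      using kernel_scaled_eq(1)[OF \<open>x \<noteq> 0\<close>, of _ "\<lambda>v. iexp (- v)" l] False \<open>x \<noteq> 0\<close>
      by (simp add: J_def ipow_def mult_ac set_integral_cnj[symmetric] exp_cnj sgn_if)
  qed
qed

lemma integral_iexp_kernel_bounded:
  assumes "0 < l" "l < 1"
  obtains K where "\<And>x T. x \<noteq> 0 \<Longrightarrow>
    norm (set_lebesgue_integral lborel {0<..T} (\<lambda>v. iexp (- (v * x)) / of_real (v powr l))) \<le> K * \<bar>x\<bar> powr (l - 1)"
proof -
  define J where "J T = set_lebesgue_integral lborel {0<..T} (\<lambda>v. iexp (- v) / of_real (v powr l))" for T
  interpret oscillating_kernel "\<lambda>v. - \<i> * exp (- (\<i> * of_real v))" "frac_kernel \<i>" 2 0 l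
    using assms by (intro oscillating_kernel_exp) auto
  obtain K where K: "\<And>T. norm (set_lebesgue_integral lborel {0<..T} (\<lambda>v. - \<i> * exp (- (\<i> * of_real v)) / of_real (v powr l))) \<le> K"
    using integral_bounded by blast
  have "set_lebesgue_integral lborel {0<..T} (\<lambda>v. - \<i> * exp (- (\<i> * of_real v)) / of_real (v powr l)) = - \<i> * J T" for T
    unfolding J_def set_integral_mult_right[symmetric] by (simp add: mult.assoc[symmetric])
  with K have J: "norm (J T) \<le> K" for T
    by (simp add: norm_mult)
  \<comment> \<open>For negative x the integral is the conjugate, so one bound serves both
    signs.\<close>
  have sgn: "set_lebesgue_integral lborel {0<..T} (\<lambda>v. iexp (- (sgn x * v)) / of_real (v powr l)) \<in> {J T, cnj (J T)}"
    if "x \<noteq> 0" for x T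
    using that by (auto simp: J_def set_integral_cnj[symmetric] exp_cnj sgn_if)
  have "norm (set_lebesgue_integral lborel {0<..T} (\<lambda>v. iexp (- (sgn x * v)) / of_real (v powr l))) \<le> K"
    if "x \<noteq> 0" for x T
    using sgn[OF that, of T] J[of T] by auto
  then show ?thesis
    using kernel_scaled_eq(1)[of _ _ "\<lambda>v. iexp (- v)" l]
    by (intro that[of K]) (simp add: norm_mult mult.commute mult_left_mono)
qed

text \<open>These are the inputs of Fubini for derivatives of positive non-integer order: inner
  integrability, the inner value, and an absolute bound of size |x|^l.\<close>

lemma integral_iexp_minus_1_kernel:
  assumes "0 < l" "l < 1"
  shows "set_integrable lborel {0<..} (\<lambda>v. (iexp (- (v * x)) - 1) / of_real (v powr (1 + l)))"
    and "set_lebesgue_integral lborel {0<..} (\<lambda>v. (iexp (- (v * x)) - 1) / of_real (v powr (1 + l))) =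
      of_real (Gamma (- l)) * ipow l x"
    and "(\<integral>v\<in>{0<..}. norm ((iexp (- (v * x)) - 1) / of_real (v powr (1 + l))) \<partial>lborel) \<le>
      \<bar>x\<bar> powr l * (\<integral>v\<in>{0<..}. norm (frac_kernel \<i> v / of_real (v powr (1 + l))) \<partial>lborel)"
proof -
  define k where "k v = iexp (- v) - 1" for v
  have k: "k (sgn x * v) = (if 0 < x then frac_kernel \<i> v else cnj (frac_kernel \<i> v))" if "x \<noteq> 0" for v
    using that by (simp add: k_def frac_kernel_def sgn_if exp_cnj)
  have fi: "set_integrable lborel {0<..} (\<lambda>v. frac_kernel \<i> v / of_real (v powr (1 + l)))"
    using set_integrable_frac_kernel[of \<i> l] assms by (simp add: add.commute)
  have fcnj: "cnj (frac_kernel \<i> v) / of_real (v powr (1 + l)) = cnj (frac_kernel \<i> v / of_real (v powr (1 + l)))" for v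
    by simp
  have fi': "set_integrable lborel {0<..} (\<lambda>v. cnj (frac_kernel \<i> v) / of_real (v powr (1 + l)))"
  proof -
    have "integrable lborel (\<lambda>v. cnj (indicator {0<..} v *\<^sub>R (frac_kernel \<i> v / of_real (v powr (1 + l)))))"
      using fi by (subst complex_integrable_cnj) (simp add: set_integrable_def)
    then show ?thesis by (simp add: set_integrable_def scaleR_conv_of_real)
  qed
  show "set_integrable lborel {0<..} (\<lambda>v. (iexp (- (v * x)) - 1) / of_real (v powr (1 + l)))"
  proof (cases "x = 0")
    case False
    then show ?thesis
      using kernel_scaled_integrable[OF False, of k "1 + l"] fi fi' unfolding k[OF False]
      by (cases "0 < x") (simp_all add: k_def)
  qed (simp add: set_integrable_def)
  show "set_lebesgue_integral lborel {0<..} (\<lambda>v. (iexp (- (v * x)) - 1) / of_real (v powr (1 + l))) =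
      of_real (Gamma (- l)) * ipow l x"
  proof (cases "x = 0")
    case False
    have F: "set_lebesgue_integral lborel {0<..} (\<lambda>v. frac_kernel \<i> v / of_real (v powr (1 + l))) =
        of_real (Gamma (- l)) * cis (l * pi / 2)"
      using frac_integral_ii[OF assms] by (simp add: frac_integral_def add.commute)
    have "set_lebesgue_integral lborel {0<..} (\<lambda>v. k (v * x) / of_real (v powr (1 + l))) =
      of_real (\<bar>x\<bar> powr l) * (of_real (Gamma (- l)) * cis (l * pi / 2 * sgn x))"
    proof (cases "0 < x")
      case True
      then show ?thesis
        using kernel_scaled_eq(2)[OF False, of k "1 + l"] F unfolding k[OF False] by simp
    next
      case neg: False
      then show ?thesis
        using kernel_scaled_eq(2)[OF False, of k "1 + l"] F False
        unfolding k[OF False] by (simp only: if_False fcnj set_integral_cnj) (simp add: cis_cnj sgn_if)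
    qed
    then show ?thesis using False by (simp add: k_def ipow_def)
  qed (use assms in \<open>simp add: ipow_def\<close>)
  show "(\<integral>v\<in>{0<..}. norm ((iexp (- (v * x)) - 1) / of_real (v powr (1 + l))) \<partial>lborel) \<le>
      \<bar>x\<bar> powr l * (\<integral>v\<in>{0<..}. norm (frac_kernel \<i> v / of_real (v powr (1 + l))) \<partial>lborel)"
  proof (cases "x = 0")
    case False
    have "norm (k (sgn x * v) / of_real (v powr (1 + l))) = norm (frac_kernel \<i> v / of_real (v powr (1 + l)))" for v
      using False by (simp add: k norm_divide)
    then show ?thesis
      using norm_kernel_scaled_eq[OF False, of k "1 + l"] by (simp add: k_def)
  qed simp
qed

section \<open>Fubini and the limit under the expectation\<close>

lemma kernel_integral_measurable:
  fixes k :: "real \<Rightarrow> complex"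
  assumes [measurable]: "k \<in> borel_measurable borel" "A \<in> sets borel"
  shows "(\<lambda>x. set_lebesgue_integral lborel A (\<lambda>t. k (t * x) / of_real (t powr l))) \<in> borel_measurable borel"
  unfolding set_lebesgue_integral_def by measurable

text \<open>Absolute integrability on the product is checked with the t-integral inside: B bounds
  it, and the weight W times B is integrable. The set A is general because (0, \<infinity>), (0, T]
  and [e, T] all occur.\<close>

lemma (in real_distribution)
  fixes W k :: "real \<Rightarrow> complex" and B :: "real \<Rightarrow> real"
  assumes W [measurable]: "W \<in> borel_measurable borel"
    and k [measurable]: "k \<in> borel_measurable borel"
    and A [measurable]: "A \<in> sets borel"
    and int: "AE x in M. set_integrable lborel A (\<lambda>t. k (t * x) / of_real (t powr l))"
    and bound: "AE x in M. (\<integral>t\<in>A. norm (k (t * x) / of_real (t powr l)) \<partial>lborel) \<le> B x"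
    and B: "integrable M (\<lambda>x. norm (W x) * B x)"
  shows fubini_kernel_integrable:
      "set_integrable lborel A (\<lambda>t. (\<integral>x. W x * k (t * x) \<partial>M) / of_real (t powr l))"
    and fubini_kernel:
      "set_lebesgue_integral lborel A (\<lambda>t. (\<integral>x. W x * k (t * x) \<partial>M) / of_real (t powr l)) =
       (\<integral>x. W x * set_lebesgue_integral lborel A (\<lambda>t. k (t * x) / of_real (t powr l)) \<partial>M)"
proof -
  have [measurable_cong]: "sets M = sets borel" by simp
  interpret pair_sigma_finite M lborel ..
  define f where "f x t = indicator A t *\<^sub>R (W x * (k (t * x) / of_real (t powr l)))" for x t
  have [measurable]: "case_prod f \<in> borel_measurable (M \<Otimes>\<^sub>M lborel)"
    unfolding f_def by measurable
  have f_W: "f x t = W x * (indicator A t *\<^sub>R (k (t * x) / of_real (t powr l)))" for x t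
    by (simp add: f_def)
  have "integrable (M \<Otimes>\<^sub>M lborel) (case_prod f)"
  proof (rule Fubini_integrable)
    have norm_f: "(\<integral>t. norm (case_prod f (x, t)) \<partial>lborel) =
        norm (W x) * (\<integral>t\<in>A. norm (k (t * x) / of_real (t powr l)) \<partial>lborel)" for x
    proof -
      have "norm (case_prod f (x, t)) =
          norm (W x) * (indicator A t *\<^sub>R norm (k (t * x) / of_real (t powr l)))" for t
        by (simp add: f_W norm_mult del: times_divide_eq_right)
      then show ?thesis
        by (simp only: set_lebesgue_integral_def integral_mult_right_zero)
    qed
    show "integrable M (\<lambda>x. \<integral>t. norm (case_prod f (x, t)) \<partial>lborel)"
    proof (rule Bochner_Integration.integrable_bound[OF B])
      show "AE x in M. norm (\<integral>t. norm (case_prod f (x, t)) \<partial>lborel) \<le> norm (norm (W x) * B x)"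
        using bound
      proof eventually_elim
        case (elim x)
        have "0 \<le> (\<integral>t\<in>A. norm (k (t * x) / of_real (t powr l)) \<partial>lborel)"
          unfolding set_lebesgue_integral_def by (rule Bochner_Integration.integral_nonneg) simp
        then show ?case
          using elim unfolding norm_f by (simp add: abs_mult mult_left_mono)
      qed
    qed measurable
    show "AE x in M. integrable lborel (\<lambda>t. case_prod f (x, t))"
      using int unfolding case_prod_conv f_W set_integrable_def by eventually_elim (rule integrable_mult_right)
  qed measurable
  note I = this
  have inner: "(\<integral>x. f x t \<partial>M) = indicator A t *\<^sub>R ((\<integral>x. W x * k (t * x) \<partial>M) / of_real (t powr l))" for t
    by (simp add: f_def)
  show "set_integrable lborel A (\<lambda>t. (\<integral>x. W x * k (t * x) \<partial>M) / of_real (t powr l))"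
    using integrable_snd[OF I] unfolding inner set_integrable_def .
  show "set_lebesgue_integral lborel A (\<lambda>t. (\<integral>x. W x * k (t * x) \<partial>M) / of_real (t powr l)) =
       (\<integral>x. W x * set_lebesgue_integral lborel A (\<lambda>t. k (t * x) / of_real (t powr l)) \<partial>M)"
    using Fubini_integral[OF I] unfolding inner unfolding f_W integral_mult_right_zero set_lebesgue_integral_def .
qed

text \<open>Two majorants with different tasks. \<open>B T\<close> bounds the integral of the norm
  and may depend on T; it serves Fubini on (0, T]. D bounds the norm of the integral uniformly in T;
  it serves the limit. Keeping them apart is what admits conditional convergence at
  infinity.\<close>

lemma (in real_distribution) has_int_0_infm_expectation:
  fixes W k c :: "real \<Rightarrow> complex" and B :: "real \<Rightarrow> real \<Rightarrow> real" and D :: "real \<Rightarrow> real"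
  assumes [measurable]: "W \<in> borel_measurable borel" "k \<in> borel_measurable borel" "c \<in> borel_measurable borel"
    and int: "\<And>T. 0 < T \<Longrightarrow> AE x in M. set_integrable lborel {0<..T} (\<lambda>t. k (t * x) / of_real (t powr l))"
    and bound: "\<And>T. 0 < T \<Longrightarrow> AE x in M. (\<integral>t\<in>{0<..T}. norm (k (t * x) / of_real (t powr l)) \<partial>lborel) \<le> B T x"
    and B: "\<And>T. 0 < T \<Longrightarrow> integrable M (\<lambda>x. norm (W x) * B T x)"
    and lim: "AE x in M. W x \<noteq> 0 \<longrightarrow>
      ((\<lambda>T. set_lebesgue_integral lborel {0<..T} (\<lambda>t. k (t * x) / of_real (t powr l))) \<longlongrightarrow> c x) at_top"
    and D_bound: "\<And>T. 0 < T \<Longrightarrow> AE x in M. W x \<noteq> 0 \<longrightarrow>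
      norm (set_lebesgue_integral lborel {0<..T} (\<lambda>t. k (t * x) / of_real (t powr l))) \<le> D x"
    and D: "integrable M (\<lambda>x. norm (W x) * D x)"
  shows "has_int_0_infm (\<lambda>t. (\<integral>x. W x * k (t * x) \<partial>M) / of_real (t powr l)) (\<integral>x. W x * c x \<partial>M)"
  unfolding has_int_0_infm_def
proof safe
  have [measurable_cong]: "sets M = sets borel" by simp
  fix T :: real assume T: "0 < T"
  show "set_integrable lborel {0<..T} (\<lambda>t. (\<integral>x. W x * k (t * x) \<partial>M) / of_real (t powr l))"
    by (rule fubini_kernel_integrable[OF _ _ _ int[OF T] bound[OF T] B[OF T]]) auto
next
  have [measurable_cong]: "sets M = sets borel" by simp
  define J where "J T x = set_lebesgue_integral lborel {0<..T} (\<lambda>t. k (t * x) / of_real (t powr l))" for T x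
  have [measurable]: "J T \<in> borel_measurable borel" for T
    unfolding J_def by (rule kernel_integral_measurable) auto
  have "((\<lambda>T. \<integral>x. W x * J T x \<partial>M) \<longlongrightarrow> (\<integral>x. W x * c x \<partial>M)) at_top"
  proof (rule integral_dominated_convergence_at_top[OF _ _ D])
    show "AE x in M. ((\<lambda>T. W x * J T x) \<longlongrightarrow> W x * c x) at_top"
      using lim
    proof eventually_elim
      case (elim x)
      then show ?case by (cases "W x = 0") (auto simp: J_def intro!: tendsto_intros)
    qed
    show "\<forall>\<^sub>F T in at_top. AE x in M. norm (W x * J T x) \<le> norm (W x) * D x"
      using eventually_gt_at_top[of 0]
    proof eventually_elim
      case (elim T)
      from D_bound[OF elim] show ?case
      proof eventually_elim
        case (elim x)
        then show ?case by (cases "W x = 0") (auto simp: norm_mult J_def intro!: mult_left_mono)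
      qed
    qed
  qed measurable
  moreover have "\<forall>\<^sub>F T in at_top. (\<integral>x. W x * J T x \<partial>M) =
      set_lebesgue_integral lborel {0<..T} (\<lambda>t. (\<integral>x. W x * k (t * x) \<partial>M) / of_real (t powr l))"
    using eventually_gt_at_top[of 0]
  proof eventually_elim
    case (elim T)
    show ?case unfolding J_def
      by (rule fubini_kernel[symmetric, OF _ _ _ int[OF elim] bound[OF elim] B[OF elim]]) auto
  qed
  ultimately show "((\<lambda>T. set_lebesgue_integral lborel {0<..T}
      (\<lambda>t. (\<integral>x. W x * k (t * x) \<partial>M) / of_real (t powr l))) \<longlongrightarrow> (\<integral>x. W x * c x \<partial>M)) at_top"
    by (rule Lim_transform_eventually)
qed

section \<open>Fractional derivatives of the characteristic function\<close>

text \<open>The Fourier transform of the complex measure with density W with respect to M.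
  Derivatives, fractional integrals and differences all stay within this class and change only the
  weight.\<close>

definition wchar :: "real measure \<Rightarrow> (real \<Rightarrow> complex) \<Rightarrow> real \<Rightarrow> complex" where
  "wchar M W t = (\<integral>x. W x * iexp (t * x) \<partial>M)"

lemma (in real_distribution) integrable_mult_iexp:
  assumes "integrable M W"
  shows "integrable M (\<lambda>x. W x * iexp (t * x))"
proof (rule Bochner_Integration.integrable_bound[OF assms])
  have [measurable_cong]: "sets M = sets borel" by simp
  have [measurable]: "W \<in> borel_measurable M" using assms by auto
  show "(\<lambda>x. W x * iexp (t * x)) \<in> borel_measurable M" by measurable
qed (simp add: norm_mult)

lemma (in real_distribution) char_eq_wchar: "char M = wchar M (ipow 0)"
  by (simp add: fun_eq_iff char_def wchar_def ipow_0)

lemma (in real_distribution) has_vector_derivative_wchar: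
  assumes W: "integrable M W" "integrable M (\<lambda>x. norm (W x) * \<bar>x\<bar>)"
  shows "(wchar M W has_vector_derivative wchar M (\<lambda>x. \<i> * of_real x * W x) t) (at t)"
  unfolding wchar_def
proof (rule has_vector_derivative_integral[OF zero_less_one _ _ _ W(2)])
  have [measurable_cong]: "sets M = sets borel" by simp
  have [measurable]: "W \<in> borel_measurable M" using W by auto
  show "integrable M (\<lambda>x. W x * iexp (s * x))" for s
    by (rule integrable_mult_iexp[OF W(1)])
  show "((\<lambda>t. W x * iexp (t * x)) has_vector_derivative \<i> * of_real x * W x * iexp (s * x)) (at s)" for s x
  proof -
    have "((\<lambda>w. W x * exp (\<i> * (w * of_real x))) has_field_derivative
        \<i> * of_real x * W x * exp (\<i> * (of_real s * of_real x))) (at (of_real s))"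
      by (auto intro!: derivative_eq_intros)
    from has_vector_derivative_real_field[OF this] show ?thesis by simp
  qed
  show "(\<lambda>x. \<i> * of_real x * W x * iexp (t * x)) \<in> borel_measurable M" by measurable
qed (simp add: norm_mult)

lemma g_fun_Suc: "g_fun (Suc n) t = g_fun n t * (iexp t - iexp (- t))"
proof -
  have "iexp t - iexp (- t) = 2 * \<i> * of_real (sin t)"
    by (simp add: complex_eq_iff Re_exp Im_exp)
  then show ?thesis by (simp add: g_fun_def)
qed

lemma (in real_distribution) delta_pow_wchar:
  assumes W: "integrable M W"
  shows "delta_pow n v (wchar M W) = wchar M (\<lambda>x. W x * g_fun n (v * x))"
proof (induction n)
  case 0
  then show ?case by (simp add: delta_pow_def g_fun_def)
next
  case (Suc n)
  have [measurable_cong]: "sets M = sets borel" by simp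
  have [measurable]: "W \<in> borel_measurable M" using W by auto
  have "integrable M (\<lambda>x. W x * g_fun n (v * x))"
  proof (rule Bochner_Integration.integrable_bound[OF integrable_mult_right[OF W, of "2 ^ n"]])
    show "AE x in M. norm (W x * g_fun n (v * x)) \<le> norm (2 ^ n * W x)"
      by (auto simp: norm_mult norm_power mult.commute[of "2 ^ n"] intro!: mult_left_mono norm_g_fun)
  qed measurable
  note I = integrable_mult_iexp[OF this]
  have "delta_pow (Suc n) v (wchar M W) = delta_op v (wchar M (\<lambda>x. W x * g_fun n (v * x)))"
    using Suc by (simp add: delta_pow_def)
  also have "\<dots> = wchar M (\<lambda>x. W x * g_fun (Suc n) (v * x))"
  proof
    fix z
    have "delta_op v (wchar M (\<lambda>x. W x * g_fun n (v * x))) z =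
        (\<integral>x. W x * g_fun n (v * x) * iexp ((z + v) * x) - W x * g_fun n (v * x) * iexp ((z - v) * x) \<partial>M)"
      unfolding delta_op_def wchar_def by (rule Bochner_Integration.integral_diff[symmetric, OF I I])
    also have "\<dots> = wchar M (\<lambda>x. W x * g_fun (Suc n) (v * x)) z"
      unfolding wchar_def
    proof (rule Bochner_Integration.integral_cong[OF refl])
      fix x
      have "iexp ((z + v) * x) = iexp (v * x) * iexp (z * x)" "iexp ((z - v) * x) = iexp (- (v * x)) * iexp (z * x)"
        unfolding exp_add[symmetric] by (simp_all add: algebra_simps)
      then show "W x * g_fun n (v * x) * iexp ((z + v) * x) - W x * g_fun n (v * x) * iexp ((z - v) * x) =
          W x * g_fun (Suc n) (v * x) * iexp (z * x)"
        unfolding g_fun_Suc by (simp only: algebra_simps)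
    qed
    finally show "delta_op v (wchar M (\<lambda>x. W x * g_fun n (v * x))) z = wchar M (\<lambda>x. W x * g_fun (Suc n) (v * x)) z" .
  qed
  finally show ?case .
qed

section \<open>Finite moments and the existence of fractional derivatives\<close>

lemma abs_powr_between:
  fixes x :: real
  assumes "a \<le> s" "s \<le> b"
  shows "\<bar>x\<bar> powr s \<le> \<bar>x\<bar> powr a + \<bar>x\<bar> powr b"
proof (cases "x = 0 \<or> \<bar>x\<bar> \<ge> 1")
  case True
  then have "\<bar>x\<bar> powr s \<le> \<bar>x\<bar> powr b" using assms by (auto intro: powr_mono)
  then show ?thesis by (simp add: add_increasing)
next
  case False
  then have "\<bar>x\<bar> powr s \<le> \<bar>x\<bar> powr a" using assms by (intro powr_mono') auto
  then show ?thesis by (simp add: add_increasing2)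
qed

context real_distribution
begin

text \<open>Since \<open>0 powr r\<close> is 0, integrability alone would overlook an atom at 0,
  which makes a moment of negative order infinite; the second clause excludes it.\<close>

definition finite_moment :: "real \<Rightarrow> bool" where
  "finite_moment r \<longleftrightarrow> integrable M (\<lambda>x. \<bar>x\<bar> powr r) \<and> (r < 0 \<longrightarrow> (AE x in M. x \<noteq> 0))"

lemma integrable_abs_powr_between:
  assumes "integrable M (\<lambda>x. \<bar>x\<bar> powr a)" "integrable M (\<lambda>x. \<bar>x\<bar> powr b)" "a \<le> s" "s \<le> b"
  shows "integrable M (\<lambda>x. \<bar>x\<bar> powr s)"
proof (rule Bochner_Integration.integrable_bound[OF Bochner_Integration.integrable_add[OF assms(1,2)]])
  have [measurable_cong]: "sets M = sets borel" by simp
  show "(\<lambda>x. \<bar>x\<bar> powr s) \<in> borel_measurable M" by measurable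
  show "AE x in M. norm (\<bar>x\<bar> powr s) \<le> norm (\<bar>x\<bar> powr a + \<bar>x\<bar> powr b)"
  proof (rule AE_I2)
    fix x
    show "norm (\<bar>x\<bar> powr s) \<le> norm (\<bar>x\<bar> powr a + \<bar>x\<bar> powr b)"
      using abs_powr_between[OF assms(3,4), of x] by simp
  qed
qed

lemma finite_moment_0: "finite_moment 0"
  unfolding finite_moment_def
proof (intro conjI integrable_const_bound[of _ 1])
  have [measurable_cong]: "sets M = sets borel" by simp
  show "(\<lambda>x. \<bar>x\<bar> powr 0) \<in> borel_measurable M" by measurable
qed auto

text \<open>The moment of order 0 is always finite, so finiteness at r passes to all orders between
  0 and r. The recursive definition of the derivative visits exactly such intermediate
  orders.\<close>

lemma finite_moment_between:
  assumes "finite_moment r" "0 \<le> s \<and> s \<le> r \<or> r \<le> s \<and> s \<le> 0"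
  shows "finite_moment s"
proof -
  have "integrable M (\<lambda>x. \<bar>x\<bar> powr s)"
    using assms finite_moment_0 integrable_abs_powr_between[of 0 r s] integrable_abs_powr_between[of r 0 s]
    unfolding finite_moment_def by blast
  moreover have "s < 0 \<Longrightarrow> r < 0" using assms(2) by auto
  ultimately show ?thesis using assms(1) by (simp add: finite_moment_def)
qed

lemma integrable_ipow:
  assumes "finite_moment r"
  shows "integrable M (ipow r)"
proof (rule Bochner_Integration.integrable_bound)
  have [measurable_cong]: "sets M = sets borel" by simp
  \<comment> \<open>The summand 1 covers x = 0, where \<open>ipow 0\<close> is 1 but
    \<open>powr\<close> gives 0.\<close>
  show "integrable M (\<lambda>x. \<bar>x\<bar> powr r + 1)" using assms by (simp add: finite_moment_def)
  show "ipow r \<in> borel_measurable M" by measurable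
  show "AE x in M. norm (ipow r x) \<le> norm (\<bar>x\<bar> powr r + 1)"
  proof (rule AE_I2)
    fix x show "norm (ipow r x) \<le> norm (\<bar>x\<bar> powr r + 1)"
      by (cases "x = 0") (auto simp: norm_ipow ipow_def[of _ 0])
  qed
qed

lemma norm_ipow_mult_powr: "norm (ipow r x) * \<bar>x\<bar> powr p = \<bar>x\<bar> powr (r + p)"
  by (cases "x = 0") (auto simp: norm_ipow powr_add)

lemma has_nth_deriv_char:
  "finite_moment (real k) \<Longrightarrow> has_nth_deriv k (char M) (wchar M (ipow (real k)))"
proof (induction k)
  case 0
  then show ?case by (simp add: char_eq_wchar)
next
  case (Suc k)
  have k: "finite_moment (real k)"
    by (rule finite_moment_between[OF Suc.prems]) auto
  have "(wchar M (ipow (real k)) has_vector_derivative wchar M (ipow (real (Suc k))) t) (at t)" for t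
    unfolding ipow_Suc[abs_def]
  proof (rule has_vector_derivative_wchar[OF integrable_ipow[OF k]])
    have "norm (ipow (real k) x) * \<bar>x\<bar> = \<bar>x\<bar> powr (real (Suc k))" for x
      using norm_ipow_mult_powr[of "real k" x 1] by (cases "x = 0") (auto simp: add.commute)
    then show "integrable M (\<lambda>x. norm (ipow (real k) x) * \<bar>x\<bar>)"
      using Suc.prems by (simp add: finite_moment_def)
  qed
  then show ?case
    using Suc.IH[OF k] by auto
qed

text \<open>Here Fubini works on the whole half-line: the subtracted kernel has an absolute integral
  of size |x|^d, and k + d is the order s of the finite moment.\<close>

lemma has_frac_deriv_char_pos:
  assumes "0 < s" "s \<notin> \<int>" "finite_moment s"
  shows "has_frac_deriv (char M) s (wchar M (ipow s))"
proof -
  define k where "k = nat \<lfloor>s\<rfloor>"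
  define d where "d = s - real k"
  have "real k = of_int \<lfloor>s\<rfloor>" using assms by (simp add: k_def)
  moreover have "of_int \<lfloor>s\<rfloor> \<noteq> s" using assms(2) Ints_of_int by metis
  ultimately have d: "0 < d" "d < 1"
    unfolding d_def by linarith+
  have s: "s = real k + d" by (simp add: d_def)
  have k: "finite_moment (real k)"
    by (rule finite_moment_between[OF assms(3)]) (use d in \<open>simp add: s\<close>)
  have [measurable_cong]: "sets M = sets borel" by simp
  define I where "I = (\<integral>v\<in>{0<..}. norm (frac_kernel \<i> v / of_real (v powr (1 + d))) \<partial>lborel)"
  have eq: "wchar M (ipow (real k)) (t - v) - wchar M (ipow (real k)) t =
      (\<integral>x. (ipow (real k) x * iexp (t * x)) * (iexp (- (v * x)) - 1) \<partial>M)" for t v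
  proof -
    have "wchar M (ipow (real k)) (t - v) - wchar M (ipow (real k)) t =
        (\<integral>x. ipow (real k) x * iexp ((t - v) * x) - ipow (real k) x * iexp (t * x) \<partial>M)"
      unfolding wchar_def
      by (rule Bochner_Integration.integral_diff[symmetric]; rule integrable_mult_iexp[OF integrable_ipow[OF k]])
    also have "\<dots> = (\<integral>x. (ipow (real k) x * iexp (t * x)) * (iexp (- (v * x)) - 1) \<partial>M)"
    proof (rule Bochner_Integration.integral_cong[OF refl])
      fix x
      have "iexp ((t - v) * x) = iexp (t * x) * iexp (- (v * x))"
        unfolding exp_add[symmetric] by (simp add: algebra_simps)
      then show "ipow (real k) x * iexp ((t - v) * x) - ipow (real k) x * iexp (t * x) =
          (ipow (real k) x * iexp (t * x)) * (iexp (- (v * x)) - 1)"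
        by (simp only: algebra_simps mult_1_left mult_1_right)
    qed
    finally show ?thesis .
  qed
  have fub: "AE x in M. set_integrable lborel {0<..} (\<lambda>v. (iexp (- (v * x)) - 1) / of_real (v powr (1 + d)))"
    "AE x in M. (\<integral>v\<in>{0<..}. norm ((iexp (- (v * x)) - 1) / of_real (v powr (1 + d))) \<partial>lborel) \<le> \<bar>x\<bar> powr d * I"
    "integrable M (\<lambda>x. norm (ipow (real k) x * iexp (t * x)) * (\<bar>x\<bar> powr d * I))"
    "(\<lambda>x. ipow (real k) x * iexp (t * x)) \<in> borel_measurable borel"
    "(\<lambda>y. iexp (- y) - 1) \<in> borel_measurable borel" for t
  proof -
    show "integrable M (\<lambda>x. norm (ipow (real k) x * iexp (t * x)) * (\<bar>x\<bar> powr d * I))"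
      using assms(3) by (simp add: norm_mult mult.assoc[symmetric] norm_ipow_mult_powr finite_moment_def s)
    show "AE x in M. set_integrable lborel {0<..} (\<lambda>v. (iexp (- (v * x)) - 1) / of_real (v powr (1 + d)))"
      by (intro AE_I2 integral_iexp_minus_1_kernel(1) d)
    show "AE x in M. (\<integral>v\<in>{0<..}. norm ((iexp (- (v * x)) - 1) / of_real (v powr (1 + d))) \<partial>lborel) \<le> \<bar>x\<bar> powr d * I"
      unfolding I_def by (intro AE_I2 integral_iexp_minus_1_kernel(3) d)
  qed measurable
  show ?thesis
  proof (rule has_frac_deriv.pos_order[OF assms(1,2) k_def d_def has_nth_deriv_char[OF k]])
    fix t
    show "set_integrable lborel {0<..}
        (\<lambda>v. (wchar M (ipow (real k)) (t - v) - wchar M (ipow (real k)) t) / of_real (v powr (1 + d)))"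
      unfolding eq by (rule fubini_kernel_integrable[OF fub(4,5) _ fub(1,2,3)]) simp
    have "set_lebesgue_integral lborel {0<..}
        (\<lambda>v. (wchar M (ipow (real k)) (t - v) - wchar M (ipow (real k)) t) / of_real (v powr (1 + d))) =
        (\<integral>x. (ipow (real k) x * iexp (t * x)) * (of_real (Gamma (- d)) * ipow d x) \<partial>M)"
      unfolding eq integral_iexp_minus_1_kernel(2)[OF d, symmetric]
      by (rule fubini_kernel[OF fub(4,5) _ fub(1,2,3)]) simp
    also have "\<dots> = (\<integral>x. of_real (Gamma (- d)) * (ipow s x * iexp (t * x)) \<partial>M)"
    proof (rule Bochner_Integration.integral_cong[OF refl])
      fix x
      \<comment> \<open>At x = 0 both sides vanish because d and s are positive, even for k = 0,
        where the first factor is 1.\<close>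
      have "ipow s x = ipow (real k) x * ipow d x"
        by (cases "x = 0") (use d in \<open>auto simp: s ipow_add ipow_def[of _ 0]\<close>)
      then show "(ipow (real k) x * iexp (t * x)) * (of_real (Gamma (- d)) * ipow d x) =
          of_real (Gamma (- d)) * (ipow s x * iexp (t * x))"
        by simp
    qed
    also have "\<dots> = of_real (Gamma (- d)) * wchar M (ipow s) t"
      by (simp add: wchar_def)
    finally show "wchar M (ipow s) t = 1 / of_real (Gamma (- d)) * set_lebesgue_integral lborel {0<..}
        (\<lambda>v. (wchar M (ipow (real k)) (t - v) - wchar M (ipow (real k)) t) / of_real (v powr (1 + d)))"
      using Gamma_1_minus(2)[OF d] by simp
  qed
qed

text \<open>The weight is general because orders below -1 start from a transform with weight
  \<open>ipow (- real k)\<close>. With l = 1 + s in (0, 1) the kernel is absolutely integrable near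
  0, and its limit at infinity is the conditional one of
  \<open>integral_iexp_kernel\<close>.\<close>

lemma has_frac_deriv_wchar_unit_neg:
  assumes "- 1 < s" "s < 0" and [measurable]: "V \<in> borel_measurable borel"
    and V: "integrable M V" "integrable M (\<lambda>x. norm (V x) * \<bar>x\<bar> powr s)" "AE x in M. x \<noteq> 0"
  shows "has_frac_deriv (wchar M V) s (wchar M (\<lambda>x. V x * ipow s x))"
proof (rule has_frac_deriv.unit_neg_order[OF assms(1,2)])
  fix t
  have [measurable_cong]: "sets M = sets borel" by simp
  obtain K where K: "\<And>x T. x \<noteq> 0 \<Longrightarrow>
      norm (set_lebesgue_integral lborel {0<..T} (\<lambda>v. iexp (- (v * x)) / of_real (v powr (1 + s)))) \<le> K * \<bar>x\<bar> powr s"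
    using integral_iexp_kernel_bounded[of "1 + s"] assms by auto
  have "has_int_0_infm (\<lambda>v. (\<integral>x. (V x * iexp (t * x)) * iexp (- (v * x)) \<partial>M) / of_real (v powr (1 + s)))
      (\<integral>x. (V x * iexp (t * x)) * (of_real (Gamma (- s)) * ipow s x) \<partial>M)"
  proof (rule has_int_0_infm_expectation)
    fix T :: real assume T: "0 < T"
    have i: "set_integrable lborel {0<..T} (\<lambda>v. iexp (- (v * x)) / of_real (v powr (1 + s)))" for x
      by (rule set_integrable_kernel_near_0[where C = 1 and q = 0]) (use assms T in auto)
    then show "AE x in M. set_integrable lborel {0<..T} (\<lambda>v. iexp (- (v * x)) / of_real (v powr (1 + s)))"
      by simp
    \<comment> \<open>The exponential has norm 1, so this majorant depends on T but not on
      x.\<close>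
    show "AE x in M. (\<integral>v\<in>{0<..T}. norm (iexp (- (v * x)) / of_real (v powr (1 + s))) \<partial>lborel) \<le>
        (\<integral>v\<in>{0<..T}. 1 / v powr (1 + s) \<partial>lborel)"
      by (simp add: norm_divide)
    show "integrable M (\<lambda>x. norm (V x * iexp (t * x)) * (\<integral>v\<in>{0<..T}. 1 / v powr (1 + s) \<partial>lborel))"
      using V(1) by (simp add: norm_mult)
    show "AE x in M. V x * iexp (t * x) \<noteq> 0 \<longrightarrow>
        norm (set_lebesgue_integral lborel {0<..T} (\<lambda>v. iexp (- (v * x)) / of_real (v powr (1 + s)))) \<le> K * \<bar>x\<bar> powr s"
      using V(3) by eventually_elim (intro impI K)
  next
    show "AE x in M. V x * iexp (t * x) \<noteq> 0 \<longrightarrow>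
        ((\<lambda>T. set_lebesgue_integral lborel {0<..T} (\<lambda>v. iexp (- (v * x)) / of_real (v powr (1 + s)))) \<longlongrightarrow>
         of_real (Gamma (- s)) * ipow s x) at_top"
      using V(3) by eventually_elim (use integral_iexp_kernel[of "1 + s"] assms in auto)
    show "integrable M (\<lambda>x. norm (V x * iexp (t * x)) * (K * \<bar>x\<bar> powr s))"
      using integrable_mult_right[OF V(2), of K] by (simp add: norm_mult mult_ac)
  qed measurable
  moreover have "(\<integral>x. (V x * iexp (t * x)) * iexp (- (v * x)) \<partial>M) = wchar M V (t - v)" for v
    unfolding wchar_def mult.assoc exp_add[symmetric] by (simp add: algebra_simps)
  moreover have "(\<integral>x. (V x * iexp (t * x)) * (of_real (Gamma (- s)) * ipow s x) \<partial>M) =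
      of_real (Gamma (- s)) * wchar M (\<lambda>x. V x * ipow s x) t"
    unfolding wchar_def integral_mult_right_zero[symmetric] by (simp add: mult_ac)
  ultimately show "has_int_0_infm (\<lambda>v. wchar M V (t - v) / of_real (v powr (1 + s)))
      (of_real (Gamma (- s)) * wchar M (\<lambda>x. V x * ipow s x) t)"
    by simp
  have "0 < Gamma (- s)" using assms by (intro Gamma_real_pos) simp
  then have "Gamma (- s) \<noteq> 0" by (rule less_imp_neq[THEN not_sym])
  then show "wchar M (\<lambda>x. V x * ipow s x) t = 1 / of_real (Gamma (- s)) *
      (of_real (Gamma (- s)) * wchar M (\<lambda>x. V x * ipow s x) t)"
    by simp
qed

text \<open>One fractional integration of order q + k in (-1, 0), applied to the derivative of order
  -k. For k = 0 this is the rule for orders in (-1, 0); for larger k it is the rule through the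
  ceiling of q, which is -k.\<close>

lemma has_frac_deriv_char_neg_step:
  assumes IH: "has_frac_deriv (char M) (- real k) (wchar M (ipow (- real k)))"
    and q: "- real k - 1 < q" "q < - real k" "finite_moment q"
  shows "has_frac_deriv (char M) q (wchar M (ipow q))"
proof -
  have [measurable_cong]: "sets M = sets borel" by simp
  define s where "s = q + real k"
  have s: "- 1 < s" "s < 0" using q by (auto simp: s_def)
  have nz: "AE x in M. x \<noteq> 0" using q by (auto simp: finite_moment_def)
  have k: "finite_moment (- real k)"
    by (rule finite_moment_between[OF q(3)]) (use q in auto)
  have "has_frac_deriv (wchar M (ipow (- real k))) s (wchar M (\<lambda>x. ipow (- real k) x * ipow s x))"
  proof (rule has_frac_deriv_wchar_unit_neg[OF s _ integrable_ipow[OF k] _ nz])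
    show "integrable M (\<lambda>x. norm (ipow (- real k) x) * \<bar>x\<bar> powr s)"
      using q(3) by (simp add: norm_ipow_mult_powr s_def finite_moment_def)
  qed measurable
  also have "wchar M (\<lambda>x. ipow (- real k) x * ipow s x) = wchar M (ipow q)"
    unfolding wchar_def
  proof (intro ext integral_cong_AE)
    fix t
    show "AE x in M. ipow (- real k) x * ipow s x * iexp (t * x) = ipow q x * iexp (t * x)"
      using nz by eventually_elim (simp add: ipow_add[symmetric] s_def)
  qed measurable
  finally have step: "has_frac_deriv (wchar M (ipow (- real k))) s (wchar M (ipow q))" .
  show ?thesis
  proof (cases k)
    case 0
    then show ?thesis using step by (simp add: char_eq_wchar s_def)
  next
    case (Suc j)
    have c: "of_int \<lceil>q\<rceil> = - real k"
    proof -
      have "\<lceil>q\<rceil> = - int k" using q by (intro ceiling_unique) auto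
      then show ?thesis by simp
    qed
    have "q \<notin> \<int>"
    proof
      assume "q \<in> \<int>"
      then have "of_int \<lceil>q\<rceil> = q" by (metis Ints_cases ceiling_of_int)
      then show False using c q by simp
    qed
    have "q < - 1" using q Suc by simp
    have eta: "has_frac_deriv (char M) (of_int \<lceil>q\<rceil>) (wchar M (ipow (- real k)))"
      unfolding c by (rule IH)
    have phi: "has_frac_deriv (wchar M (ipow (- real k))) (q - of_int \<lceil>q\<rceil>) (wchar M (ipow q))"
      using step unfolding c s_def diff_minus_eq_add .
    show ?thesis
      by (rule has_frac_deriv.neg_order[OF \<open>q < - 1\<close> \<open>q \<notin> \<int>\<close> eta phi])
  qed
qed

text \<open>Order -(k+1) is the limit of the orders in (-(k+1), -k), each one fractional integration
  away from order -k, hence the induction. The majorant is |x|^(-(k+1)) + |x|^(-k).\<close>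

lemma has_frac_deriv_char_neg_nat:
  "finite_moment (- real k) \<Longrightarrow> has_frac_deriv (char M) (- real k) (wchar M (ipow (- real k)))"
proof (induction k)
  case 0
  have "has_nth_deriv 0 (char M) (wchar M (ipow 0))" by (simp add: char_eq_wchar)
  from has_frac_deriv.nat_order[OF this] show ?case by simp
next
  case (Suc k)
  have [measurable_cong]: "sets M = sets borel" by simp
  have k: "finite_moment (- real k)"
    by (rule finite_moment_between[OF Suc.prems]) auto
  have nz: "AE x in M. x \<noteq> 0" using Suc.prems by (auto simp: finite_moment_def)
  have mom: "finite_moment q" if "- real (Suc k) < q" "q < - real k" for q
    by (rule finite_moment_between[OF Suc.prems]) (use that in auto)
  show ?case
  proof (rule has_frac_deriv.neg_int_order[where \<Phi> = "\<lambda>q. wchar M (ipow q)" and b = "- real k"])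
    show "- real (Suc k) \<in> \<int>" by auto
    show "has_frac_deriv (char M) q (wchar M (ipow q))" if "- real (Suc k) < q" "q < - real k" for q
      by (rule has_frac_deriv_char_neg_step[OF Suc.IH[OF k]]) (use that mom[OF that] in auto)
    fix t
    have "((\<lambda>q. \<integral>x. ipow q x * iexp (t * x) \<partial>M) \<longlongrightarrow> (\<integral>x. ipow (- real (Suc k)) x * iexp (t * x) \<partial>M))
        (at (- real (Suc k)) within {- real (Suc k)<..<- real k})"
    proof (rule integral_tendsto_dominated)
      show "integrable M (\<lambda>x. \<bar>x\<bar> powr (- real (Suc k)) + \<bar>x\<bar> powr (- real k))"
        using k Suc.prems by (simp add: finite_moment_def)
      show "AE x in M. norm (ipow q x * iexp (t * x)) \<le> \<bar>x\<bar> powr (- real (Suc k)) + \<bar>x\<bar> powr (- real k)"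
        if "q \<in> {- real (Suc k)<..<- real k} - {- real (Suc k)}" for q
        using nz by eventually_elim
          (use that abs_powr_between[of "- real (Suc k)" q "- real k"] in \<open>auto simp: norm_mult norm_ipow\<close>)
      show "AE x in M. ((\<lambda>q. ipow q x * iexp (t * x)) \<longlongrightarrow> ipow (- real (Suc k)) x * iexp (t * x))
          (at (- real (Suc k)) within {- real (Suc k)<..<- real k})"
        using nz
      proof eventually_elim
        case (elim x)
        have "((\<lambda>q. of_real (\<bar>x\<bar> powr q) * exp (\<i> * of_real (q * pi / 2 * sgn x)) * iexp (t * x)) \<longlongrightarrow>
            of_real (\<bar>x\<bar> powr (- real (Suc k))) * exp (\<i> * of_real (- real (Suc k) * pi / 2 * sgn x)) * iexp (t * x))
            (at (- real (Suc k)) within {- real (Suc k)<..<- real k})"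
          using elim by (intro tendsto_intros) auto
        then show ?case
          using elim by (simp only: ipow_def cis_conv_exp if_False)
      qed
    qed measurable
    also have "at (- real (Suc k)) within {- real (Suc k)<..<- real k} = at_right (- real (Suc k))"
      by (rule at_within_nhd[where S = "{..<- real k}"]) auto
    finally show "((\<lambda>q. wchar M (ipow q) t) \<longlongrightarrow> wchar M (ipow (- real (Suc k))) t) (at_right (- real (Suc k)))"
      unfolding wchar_def .
  qed auto
qed

lemma has_frac_deriv_char:
  assumes "finite_moment r"
  shows "has_frac_deriv (char M) r (wchar M (ipow r))"
proof (cases "r \<in> \<int>")
  case True
  then obtain j where j: "r = of_int j" by (auto elim: Ints_cases)
  show ?thesis
  proof (cases "0 \<le> j")
    case True
    then have "r = real (nat j)" using j by simp
    then show ?thesis using has_frac_deriv.nat_order[OF has_nth_deriv_char[of "nat j"]] assms by simp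
  next
    case False
    then have "r = - real (nat (- j))" using j by simp
    then show ?thesis using has_frac_deriv_char_neg_nat[of "nat (- j)"] assms by simp
  qed
next
  case False
  show ?thesis
  proof (cases "0 < r")
    case True
    then show ?thesis using has_frac_deriv_char_pos False assms by simp
  next
    case neg: False
    have "r \<noteq> 0" using False by auto
    define k where "k = nat (- \<lceil>r\<rceil>)"
    have "\<lceil>r\<rceil> \<le> 0" using neg by simp
    then have k: "- real k = of_int \<lceil>r\<rceil>" by (simp add: k_def)
    have "of_int \<lceil>r\<rceil> \<noteq> r" using False Ints_of_int by metis
    then have r: "- real k - 1 < r" "r < - real k"
      unfolding k by linarith+
    have "finite_moment (- real k)"
      by (rule finite_moment_between[OF assms]) (use r in auto)
    from has_frac_deriv_char_neg_step[OF has_frac_deriv_char_neg_nat[OF this] r assms]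
    show ?thesis .
  qed
qed

end

section \<open>Differences of the characteristic function\<close>

lemma has_int_0_infm_lincomb:
  assumes "has_int_0_infm h1 L1" "has_int_0_infm h2 L2"
  shows "has_int_0_infm (\<lambda>t. a * h1 t + b * h2 t) (a * L1 + b * L2)"
  unfolding has_int_0_infm_def
proof safe
  have i: "set_integrable lborel {0<..T} h1" "set_integrable lborel {0<..T} h2" if "0 < T" for T
    using assms that by (auto simp: has_int_0_infm_def)
  show "set_integrable lborel {0<..T} (\<lambda>t. a * h1 t + b * h2 t)" if "0 < T" for T
    using i[OF that] by (intro set_integral_add set_integrable_mult_right)
  have "((\<lambda>T. a * set_lebesgue_integral lborel {0<..T} h1 + b * set_lebesgue_integral lborel {0<..T} h2)
      \<longlongrightarrow> a * L1 + b * L2) at_top"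
    using assms by (intro tendsto_intros) (auto simp: has_int_0_infm_def)
  moreover have "\<forall>\<^sub>F T in at_top. a * set_lebesgue_integral lborel {0<..T} h1 + b * set_lebesgue_integral lborel {0<..T} h2 =
      set_lebesgue_integral lborel {0<..T} (\<lambda>t. a * h1 t + b * h2 t)"
    using eventually_gt_at_top[of 0]
    by eventually_elim (simp add: i set_integral_add)
  ultimately show "((\<lambda>T. set_lebesgue_integral lborel {0<..T} (\<lambda>t. a * h1 t + b * h2 t)) \<longlongrightarrow> a * L1 + b * L2) at_top"
    by (rule Lim_transform_eventually)
qed

lemma g_fun_sgn: "x \<noteq> 0 \<Longrightarrow> g_fun n (sgn x * v) = of_real (sgn x ^ n) * g_fun n v"
  by (cases "0 < x") (auto simp: g_fun_def power_minus[of "sin v"] power_minus[of "of_real (sin v)"])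

text \<open>The limit for fixed x of the integrals of g_n(tx) t^(-p-1) over (0, T]; the power of
  \<open>sgn x\<close> is the parity of g_n. At x = 0 it is 0 for every p, also for p \<le> 0,
  because \<open>powr\<close> vanishes there.\<close>

definition g_limit :: "nat \<Rightarrow> real \<Rightarrow> real \<Rightarrow> complex" where
  "g_limit n p x = of_real (\<bar>x\<bar> powr p * sgn x ^ n) * c_plus p (g_fun n)"

lemma g_limit_measurable [measurable]: "g_limit n p \<in> borel_measurable borel"
  unfolding g_limit_def sgn_if by measurable

lemma g_fun_0: "0 < n \<Longrightarrow> g_fun n 0 = 0"
  by (simp add: g_fun_def)

lemma g_fun_scaled_integral:
  assumes p: "p < real n" "even n \<Longrightarrow> 0 < p" "odd n \<Longrightarrow> -1 < p"
  shows "((\<lambda>T. set_lebesgue_integral lborel {0<..T} (\<lambda>t. g_fun n (t * x) / of_real (t powr (p + 1)))) \<longlongrightarrow> g_limit n p x) at_top"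
proof (cases "x = 0")
  case True
  have "0 < n" using p by (cases n) auto
  then show ?thesis using True by (simp add: g_fun_0 g_limit_def)
next
  case False
  define J where "J T = set_lebesgue_integral lborel {0<..T} (\<lambda>t. g_fun n t / of_real (t powr (p + 1)))" for T
  have J: "(J \<longlongrightarrow> c_plus p (g_fun n)) at_top"
    using g_fun_integral(1)[OF p] by (simp add: has_int_0_infm_def J_def[abs_def])
  have "filterlim (\<lambda>T. \<bar>x\<bar> * T) at_top at_top"
    using False by (intro filterlim_tendsto_pos_mult_at_top[OF tendsto_const]) (auto intro: filterlim_ident)
  then have "((\<lambda>T. of_real (\<bar>x\<bar> powr p) * (of_real (sgn x ^ n) * J (\<bar>x\<bar> * T))) \<longlongrightarrow>
      of_real (\<bar>x\<bar> powr p) * (of_real (sgn x ^ n) * c_plus p (g_fun n))) at_top"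
    by (intro tendsto_intros filterlim_compose[OF J])
  moreover have "set_lebesgue_integral lborel {0<..T} (\<lambda>t. g_fun n (t * x) / of_real (t powr (p + 1))) =
      of_real (\<bar>x\<bar> powr p) * (of_real (sgn x ^ n) * J (\<bar>x\<bar> * T))" for T
    unfolding kernel_scaled_eq(1)[OF False] g_fun_sgn[OF False] J_def set_integral_mult_right[symmetric]
    by (simp add: mult.assoc)
  ultimately show ?thesis by (simp add: g_limit_def mult.assoc)
qed

text \<open>Scaling maps the truncation T to |x| T, so the bound at x = 1 must be uniform in T to
  give one K for all x.\<close>

lemma g_fun_scaled_integral_bounded:
  assumes p: "p < real n" "even n \<Longrightarrow> 0 < p" "odd n \<Longrightarrow> -1 < p"
  obtains K where "\<And>x T. norm (set_lebesgue_integral lborel {0<..T} (\<lambda>t. g_fun n (t * x) / of_real (t powr (p + 1)))) \<le> K * \<bar>x\<bar> powr p"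
proof -
  define J where "J T = set_lebesgue_integral lborel {0<..T} (\<lambda>t. g_fun n t / of_real (t powr (p + 1)))" for T
  obtain K where K: "norm (J T) \<le> K" for T
    using g_fun_integral(3)[OF p] by (auto simp: J_def)
  have "norm (set_lebesgue_integral lborel {0<..T} (\<lambda>t. g_fun n (t * x) / of_real (t powr (p + 1)))) \<le> K * \<bar>x\<bar> powr p" for x T
  proof (cases "x = 0")
    case True
    have "0 < n" using p by (cases n) auto
    then show ?thesis using True by (simp add: g_fun_0)
  next
    case False
    have "set_lebesgue_integral lborel {0<..T} (\<lambda>t. g_fun n (t * x) / of_real (t powr (p + 1))) =
        of_real (\<bar>x\<bar> powr p) * (of_real (sgn x ^ n) * J (\<bar>x\<bar> * T))"
      unfolding kernel_scaled_eq(1)[OF False] g_fun_sgn[OF False] J_def set_integral_mult_right[symmetric]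
      by (simp add: mult.assoc)
    moreover have "\<bar>sgn x ^ n\<bar> = 1" using False by (simp add: power_abs abs_sgn_eq)
    ultimately show ?thesis
      using K[of "\<bar>x\<bar> * T"] by (simp add: norm_mult norm_power power_abs abs_sgn_eq False mult.commute mult_right_mono)
  qed
  then show ?thesis by (rule that)
qed

lemma g_fun_scaled_integrable:
  assumes p: "p < real n" "0 \<le> T"
  shows "set_integrable lborel {0<..T} (\<lambda>t. g_fun n (t * x) / of_real (t powr (p + 1)))"
proof (rule set_integrable_kernel_near_0[where C = "2 ^ n * \<bar>x\<bar> ^ n" and q = n])
  show "norm (g_fun n (t * x)) \<le> 2 ^ n * \<bar>x\<bar> ^ n * t ^ n" if "0 < t" for t
    using norm_g_fun(2)[of n "t * x"] that by (simp add: abs_mult power_mult_distrib mult_ac)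
qed (use p in auto)

context real_distribution
begin

text \<open>The majorant for Fubini on (0, T] depends on the sign of p: for p > 0 the integral over
  the whole half-line scales to I |x|^p, for p < 0 the power t^(-p-1) is integrable near 0 and the
  kernel is bounded. At p = 0 neither works.\<close>

lemma has_int_0_infm_g_fun:
  assumes p: "p < real n" "even n \<Longrightarrow> 0 < p" "odd n \<Longrightarrow> -1 < p" "p \<noteq> 0"
    and [measurable]: "W \<in> borel_measurable borel"
    and W: "integrable M W" "integrable M (\<lambda>x. norm (W x) * \<bar>x\<bar> powr p)"
  shows "has_int_0_infm (\<lambda>t. (\<integral>x. W x * g_fun n (t * x) \<partial>M) / of_real (t powr (p + 1)))
    (\<integral>x. W x * g_limit n p x \<partial>M)"
proof -
  obtain K where K: "norm (set_lebesgue_integral lborel {0<..T} (\<lambda>t. g_fun n (t * x) / of_real (t powr (p + 1)))) \<le> K * \<bar>x\<bar> powr p" for x T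
    using g_fun_scaled_integral_bounded[OF p(1,2,3)] by blast
  have KW: "integrable M (\<lambda>x. norm (W x) * (K * \<bar>x\<bar> powr p))"
    using integrable_mult_right[OF W(2), of K] by (simp add: mult_ac)
  have "0 < n" using p by (cases n) auto
  show ?thesis
  proof (cases "0 < p")
    case True
    define I where "I = (\<integral>t\<in>{0<..}. norm (g_fun n t / of_real (t powr (p + 1))) \<partial>lborel)"
    have i: "set_integrable lborel {0<..} (\<lambda>t. g_fun n t / of_real (t powr (p + 1)))"
      by (rule set_integrable_kernel[where C = "2 ^ n" and q = n])
         (use norm_g_fun(1) norm_g_fun_pos[of _ n] p True in auto)
    have bound: "(\<integral>t\<in>{0<..T}. norm (g_fun n (t * x) / of_real (t powr (p + 1))) \<partial>lborel) \<le> I * \<bar>x\<bar> powr p"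
      if "0 < T" for x T
    proof (cases "x = 0")
      case False
      have sgn: "norm (g_fun n (sgn x * t) / of_real (t powr (p + 1))) = norm (g_fun n t / of_real (t powr (p + 1)))" for t
        by (simp add: g_fun_sgn[OF False] norm_mult norm_divide norm_power abs_sgn_eq False)
      have "set_integrable lborel {0<..} (\<lambda>t. g_fun n (sgn x * t) / of_real (t powr (p + 1)))"
        using set_integrable_mult_right[OF i, of "of_real (sgn x ^ n)"] by (simp add: g_fun_sgn[OF False])
      then have ix: "set_integrable lborel {0<..} (\<lambda>t. g_fun n (t * x) / of_real (t powr (p + 1)))"
        by (rule kernel_scaled_integrable[OF False])
      have "(\<integral>t\<in>{0<..T}. norm (g_fun n (t * x) / of_real (t powr (p + 1))) \<partial>lborel) \<le>
          (\<integral>t\<in>{0<..}. norm (g_fun n (t * x) / of_real (t powr (p + 1))) \<partial>lborel)"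
        unfolding set_lebesgue_integral_def
        using set_integrable_norm[OF ix] set_integrable_norm[OF g_fun_scaled_integrable[OF p(1), of T x]] that
        by (intro integral_mono) (auto simp: set_integrable_def indicator_def)
      also have "\<dots> = \<bar>x\<bar> powr p * I"
        using norm_kernel_scaled_eq[OF False, of "g_fun n" "p + 1"] by (simp only: sgn I_def) simp
      finally show ?thesis by (simp add: mult.commute)
    qed (use \<open>0 < n\<close> in \<open>simp add: g_fun_0\<close>)
    show ?thesis
    proof (rule has_int_0_infm_expectation[where D = "\<lambda>x. K * \<bar>x\<bar> powr p" and B = "\<lambda>T x. I * \<bar>x\<bar> powr p"])
      show "integrable M (\<lambda>x. norm (W x) * (I * \<bar>x\<bar> powr p))"
        using integrable_mult_right[OF W(2), of I] by (simp add: mult_ac)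
    qed (use K KW bound g_fun_scaled_integral[OF p(1,2,3)] g_fun_scaled_integrable[OF p(1)] in auto)
  next
    case False
    have bound: "(\<integral>t\<in>{0<..T}. norm (g_fun n (t * x) / of_real (t powr (p + 1))) \<partial>lborel) \<le>
        (\<integral>t\<in>{0<..T}. 2 ^ n * t powr (- (p + 1)) \<partial>lborel)" if "0 < T" for x T
    proof (rule set_integral_mono)
      show "set_integrable lborel {0<..T} (\<lambda>t. norm (g_fun n (t * x) / of_real (t powr (p + 1))))"
        using set_integrable_norm[OF g_fun_scaled_integrable[OF p(1)]] that by simp
      show "set_integrable lborel {0<..T} (\<lambda>t. 2 ^ n * t powr (- (p + 1)))"
        using set_integrable_powr_near_0[of "- (p + 1)" T] that False p by simp
      show "norm (g_fun n (t * x) / of_real (t powr (p + 1))) \<le> 2 ^ n * t powr (- (p + 1))" for t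
        using norm_g_fun(1)[of n "t * x"] by (simp only: powr_minus_divide) (simp add: norm_divide divide_right_mono)
    qed
    show ?thesis
    proof (rule has_int_0_infm_expectation[where D = "\<lambda>x. K * \<bar>x\<bar> powr p"
          and B = "\<lambda>T x. \<integral>t\<in>{0<..T}. 2 ^ n * t powr (- (p + 1)) \<partial>lborel"])
      show "integrable M (\<lambda>x. norm (W x) * (\<integral>t\<in>{0<..T}. 2 ^ n * t powr (- (p + 1)) \<partial>lborel))" for T
        using W(1) by simp
    qed (use K KW bound g_fun_scaled_integral[OF p(1,2,3)] g_fun_scaled_integrable[OF p(1)] in auto)
  qed
qed

text \<open>Away from 0 the boundedness of the kernel gives a Fubini majorant independent of x, for
  p = 0 as well. The result is J T - J e with both terms dominated by K |x|^p, so the two limits can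
  be taken separately.\<close>

lemma has_int_0p_infm_g_fun:
  assumes p: "p < real n" "even n \<Longrightarrow> 0 < p" "odd n \<Longrightarrow> -1 < p"
    and [measurable]: "W \<in> borel_measurable borel"
    and W: "integrable M W" "integrable M (\<lambda>x. norm (W x) * \<bar>x\<bar> powr p)"
  shows "has_int_0p_infm (\<lambda>t. (\<integral>x. W x * g_fun n (t * x) \<partial>M) / of_real (t powr (p + 1)))
    (\<integral>x. W x * g_limit n p x \<partial>M)"
  unfolding has_int_0p_infm_def
proof safe
  have [measurable_cong]: "sets M = sets borel" by simp
  define h where "h t = (\<integral>x. W x * g_fun n (t * x) \<partial>M) / of_real (t powr (p + 1))" for t
  define J where "J T x = set_lebesgue_integral lborel {0<..T} (\<lambda>t. g_fun n (t * x) / of_real (t powr (p + 1)))" for T x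
  have [measurable]: "J T \<in> borel_measurable borel" for T
    unfolding J_def by (rule kernel_integral_measurable) auto
  obtain K where K: "norm (J T x) \<le> K * \<bar>x\<bar> powr p" for x T
    unfolding J_def using g_fun_scaled_integral_bounded[OF p] by blast
  have KW: "integrable M (\<lambda>x. norm (W x) * (K * \<bar>x\<bar> powr p))"
    using integrable_mult_right[OF W(2), of K] by (simp add: mult_ac)
  have norm_WJ: "norm (W x * J T x) \<le> norm (W x) * (K * \<bar>x\<bar> powr p)" for x T
    using K[of T x] by (simp add: norm_mult mult_left_mono)
  have WJ: "integrable M (\<lambda>x. W x * J T x)" for T
    by (rule Bochner_Integration.integrable_bound[OF KW])
       (use norm_WJ in \<open>auto intro: order_trans[OF _ abs_ge_self]\<close>)
  have i: "set_integrable lborel {0<..T} (\<lambda>t. g_fun n (t * x) / of_real (t powr (p + 1)))" if "0 < T" for T x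
    using g_fun_scaled_integrable[OF p(1)] that by simp
  have fub: "set_integrable lborel {e..T} h \<and> set_lebesgue_integral lborel {e..T} h =
      (\<integral>x. W x * J T x \<partial>M) - (\<integral>x. W x * J e x \<partial>M)" if e: "0 < e" "e < T" for e T
  proof -
    have iT: "set_integrable lborel {e..T} (\<lambda>t. g_fun n (t * x) / of_real (t powr (p + 1)))" for x
      by (rule set_integrable_subset[OF i[of T x]]) (use e in auto)
    define I where "I = (\<integral>t\<in>{e..T}. 2 ^ n * t powr (- (p + 1)) \<partial>lborel)"
    have bound: "(\<integral>t\<in>{e..T}. norm (g_fun n (t * x) / of_real (t powr (p + 1))) \<partial>lborel) \<le> I" for x
      unfolding I_def
    proof (rule set_integral_mono)
      show "set_integrable lborel {e..T} (\<lambda>t. norm (g_fun n (t * x) / of_real (t powr (p + 1))))"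
        by (rule set_integrable_norm[OF iT])
      show "set_integrable lborel {e..T} (\<lambda>t. 2 ^ n * t powr (- (p + 1)))"
        using e by (intro borel_integrable_atLeastAtMost' continuous_intros) auto
      show "norm (g_fun n (t * x) / of_real (t powr (p + 1))) \<le> 2 ^ n * t powr (- (p + 1))" for t
        using norm_g_fun(1)[of n "t * x"] by (simp only: powr_minus_divide) (simp add: norm_divide divide_right_mono)
    qed
    have WI: "integrable M (\<lambda>x. norm (W x) * I)" using W(1) by simp
    have AE: "AE x in M. set_integrable lborel {e..T} (\<lambda>t. g_fun n (t * x) / of_real (t powr (p + 1)))"
      "AE x in M. (\<integral>t\<in>{e..T}. norm (g_fun n (t * x) / of_real (t powr (p + 1))) \<partial>lborel) \<le> I"
      using iT bound by auto
    have "set_lebesgue_integral lborel {e..T} h =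
        (\<integral>x. W x * set_lebesgue_integral lborel {e..T} (\<lambda>t. g_fun n (t * x) / of_real (t powr (p + 1))) \<partial>M)"
      unfolding h_def by (rule fubini_kernel[OF _ _ _ AE WI]) auto
    also have "\<dots> = (\<integral>x. W x * J T x - W x * J e x \<partial>M)"
    proof (rule Bochner_Integration.integral_cong[OF refl])
      fix x
      show "W x * set_lebesgue_integral lborel {e..T} (\<lambda>t. g_fun n (t * x) / of_real (t powr (p + 1))) =
          W x * J T x - W x * J e x"
        using e by (subst set_lebesgue_integral_Icc_eq_diff[OF i]) (auto simp: J_def right_diff_distrib)
    qed
    also have "\<dots> = (\<integral>x. W x * J T x \<partial>M) - (\<integral>x. W x * J e x \<partial>M)"
      by (rule Bochner_Integration.integral_diff[OF WJ WJ])
    finally show ?thesis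
      using fubini_kernel_integrable[OF _ _ _ AE WI] by (simp add: h_def[abs_def])
  qed
  show "set_integrable lborel {e..T} h" if "0 < e" "e < T" for e T
    using fub that by blast
  have top: "((\<lambda>T. \<integral>x. W x * J T x \<partial>M) \<longlongrightarrow> (\<integral>x. W x * g_limit n p x \<partial>M)) at_top"
  proof (rule integral_dominated_convergence_at_top[OF _ _ KW])
    show "AE x in M. ((\<lambda>T. W x * J T x) \<longlongrightarrow> W x * g_limit n p x) at_top"
      unfolding J_def by (intro AE_I2 tendsto_intros g_fun_scaled_integral p)
    show "\<forall>\<^sub>F T in at_top. AE x in M. norm (W x * J T x) \<le> norm (W x) * (K * \<bar>x\<bar> powr p)"
      using norm_WJ by simp
  qed measurable
  \<comment> \<open>For each x, \<open>J e x\<close> tends to 0 by integrability near 0; the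
    majorant is the one used at infinity.\<close>
  have "((\<lambda>e. \<integral>x. W x * J e x \<partial>M) \<longlongrightarrow> (\<integral>x. W x * 0 \<partial>M)) (at_right 0)"
  proof (rule integral_tendsto_dominated[OF _ _ KW])
    show "AE x in M. ((\<lambda>e. W x * J e x) \<longlongrightarrow> W x * 0) (at_right 0)"
      unfolding J_def by (intro AE_I2 tendsto_mult tendsto_const set_lebesgue_integral_tendsto_0 i) simp
  qed (use norm_WJ in auto)
  then have bot: "((\<lambda>e. \<integral>x. W x * J e x \<partial>M) \<longlongrightarrow> 0) (at_right 0)" by simp
  have "((\<lambda>y. (\<integral>x. W x * J (snd y) x \<partial>M) - (\<integral>x. W x * J (fst y) x \<partial>M)) \<longlongrightarrow>
      (\<integral>x. W x * g_limit n p x \<partial>M) - 0) (at_right 0 \<times>\<^sub>F at_top)"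
    by (intro tendsto_diff filterlim_compose[OF top] filterlim_compose[OF bot] filterlim_fst filterlim_snd)
  moreover have "\<forall>\<^sub>F y in at_right 0 \<times>\<^sub>F at_top. (\<integral>x. W x * J (snd y) x \<partial>M) - (\<integral>x. W x * J (fst y) x \<partial>M) =
      (case y of (e, T) \<Rightarrow> set_lebesgue_integral lborel {e..T} h)"
  proof -
    have "\<forall>\<^sub>F y in at_right (0::real) \<times>\<^sub>F (at_top::real filter). (0 < fst y \<and> fst y < 1) \<and> 1 < snd y"
      using eventually_prodI[OF eventually_at_right_real[of 0 1] eventually_gt_at_top[of "1::real"]]
      by (simp add: greaterThanLessThan_iff)
    then show ?thesis
      by eventually_elim (auto simp: fub split_beta)
  qed
  ultimately show "((\<lambda>(e, T). set_lebesgue_integral lborel {e..T} h) \<longlongrightarrow> (\<integral>x. W x * g_limit n p x \<partial>M)) (at_right 0 \<times>\<^sub>F at_top)"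
    using Lim_transform_eventually by fastforce
qed

lemma delta_pow_wchar_eq_integral:
  assumes "integrable M W"
  shows "delta_pow n t (wchar M W) u = (\<integral>x. (W x * iexp (u * x)) * g_fun n (t * x) \<partial>M)"
  unfolding delta_pow_wchar[OF assms] wchar_def by (simp add: mult_ac)

end

section \<open>Transfer between the random variable and its law\<close>

lemma finite_moment_distr:
  assumes "prob_space M" and X [measurable]: "X \<in> borel_measurable M" and "abs_moment M X s < \<infinity>"
  shows "real_distribution.finite_moment (distr M borel X) s"
proof -
  interpret prob_space M by fact
  interpret N: real_distribution "distr M borel X" by (rule real_distribution_distr) (rule X)
  have [measurable]: "(\<lambda>\<omega>. abs_pow (X \<omega>) s) \<in> borel_measurable M"
    unfolding abs_pow_def by measurable
  have fin: "(\<integral>\<^sup>+\<omega>. abs_pow (X \<omega>) s \<partial>M) < \<infinity>"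
    using assms(3) by (simp add: abs_moment_def)
  have "integrable M (\<lambda>\<omega>. \<bar>X \<omega>\<bar> powr s)"
  proof (rule integrableI_bounded)
    have "(\<integral>\<^sup>+\<omega>. ennreal (norm (\<bar>X \<omega>\<bar> powr s)) \<partial>M) \<le> (\<integral>\<^sup>+\<omega>. abs_pow (X \<omega>) s \<partial>M)"
      by (intro nn_integral_mono) (simp add: abs_pow_def)
    then show "(\<integral>\<^sup>+\<omega>. ennreal (norm (\<bar>X \<omega>\<bar> powr s)) \<partial>M) < \<infinity>"
      using fin by (rule le_less_trans)
  qed measurable
  then have "integrable (distr M borel X) (\<lambda>x. \<bar>x\<bar> powr s)"
    by (subst integrable_distr_eq) auto
  moreover have "AE x in distr M borel X. x \<noteq> 0" if "s < 0"
  proof -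
    \<comment> \<open>\<open>abs_pow\<close> is infinite at 0 for negative s, so a finite moment
      leaves X no mass at 0.\<close>
    have "AE \<omega> in M. abs_pow (X \<omega>) s \<noteq> \<infinity>"
      by (rule nn_integral_PInf_AE) (use fin in auto)
    then have "AE \<omega> in M. X \<omega> \<noteq> 0"
      by eventually_elim (use that in \<open>auto simp: abs_pow_def\<close>)
    then show ?thesis by (subst AE_distr_iff) auto
  qed
  ultimately show ?thesis by (simp add: N.finite_moment_def)
qed

lemma has_bochner_integral_from_distr:
  fixes F :: "real \<Rightarrow> complex"
  assumes "X \<in> borel_measurable M" "F \<in> borel_measurable borel" "integrable (distr M borel X) F"
    and "(\<integral>x. F x \<partial>distr M borel X) = v"
  shows "has_bochner_integral M (\<lambda>\<omega>. F (X \<omega>)) v"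
  using assms(3,4) integrable_distr_eq[OF assms(1,2)] integral_distr[OF assms(1,2)]
  by (simp add: has_bochner_integral_iff)

lemma ii_powr: "\<i> powr of_real r = cis (r * pi / 2)"
  by (simp add: powr_def Ln_ii cis_conv_exp mult_ac)

text \<open>Away from 0, 1 + sgn x is twice the indicator of the positive half-line; this is the
  origin of the factor 1/2 in the formulas.\<close>

lemma ipow_pos_pow:
  "ipow r x * of_real (\<bar>x\<bar> powr p * (1 + sgn x)) = 2 * \<i> powr of_real r * of_real (pos_pow x (r + p))"
proof (cases "0 < x")
  case False
  then show ?thesis by (cases "x = 0") (auto simp: pos_pow_def)
qed (simp add: ipow_def pos_pow_def ii_powr powr_add)

text \<open>For x < 0 the principal power of ix has angle -r \<pi>/2 instead of r \<pi>/2. The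
  factor e^(\<i> \<pi> r) makes up the difference, so that \<i>^r can be divided out here
  too.\<close>

lemma ipow_neg_pow:
  "iexp (pi * r) * (ipow r x * of_real (\<bar>x\<bar> powr p * (1 - sgn x))) =
    2 * \<i> powr of_real r * of_real (neg_pow x (r + p))"
proof (cases "x < 0")
  case True
  have "iexp (pi * r) * cis (- (r * pi / 2)) = cis (r * pi / 2)"
    unfolding cis_conv_exp[symmetric] cis_mult by (simp add: field_simps)
  then show ?thesis
    using True by (simp add: ipow_def neg_pow_def pos_pow_def ii_powr powr_add mult_ac)
next
  case False
  then show ?thesis by (cases "x = 0") (auto simp: neg_pow_def pos_pow_def)
qed

lemma sgn_pow_eq: "sgn_pow x p = \<bar>x\<bar> powr p * sgn x"
  by (simp add: sgn_pow_def neg_pow_def pos_pow_def sgn_if)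

lemma g_limit_even:
  "even n \<Longrightarrow> 0 < n \<Longrightarrow> g_limit n p x = of_real (\<bar>x\<bar> powr p) * c_plus p (g_fun n)"
  by (cases "x = 0") (auto simp: g_limit_def sgn_if)

lemma g_limit_odd: "odd n \<Longrightarrow> g_limit n p x = of_real (\<bar>x\<bar> powr p * sgn x) * c_plus p (g_fun n)"
  by (cases "x = 0") (auto simp: g_limit_def sgn_if)

lemma ii_powr_nonzero: "\<i> powr of_real r \<noteq> 0"
  by (simp add: ii_powr)

section \<open>The moment identities for the law\<close>

context real_distribution
begin

text \<open>The sign \<epsilon> selects the positive or the negative part of x. With the weight
  (ix)^r e^(iux), the majorant |x|^p of the kernel integrals becomes |x|^(r+p), the second moment
  assumed finite.\<close>

lemma frac_moment_identity:
  assumes p: "0 < p" "p < real n" "odd n" "p < real m" "even m"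
    and r: "finite_moment r" "integrable M (\<lambda>x. \<bar>x\<bar> powr (r + p))" and "\<epsilon> = 1 \<or> \<epsilon> = - 1"
  shows "has_int_0_infm
      (\<lambda>t. (delta_pow m t (wchar M (ipow r)) u / c_plus p (g_fun m) +
            of_real \<epsilon> * (delta_pow n t (wchar M (ipow r)) u / c_plus p (g_fun n))) / of_real (t powr (p + 1)))
      (\<integral>x. ipow r x * of_real (\<bar>x\<bar> powr p * (1 + \<epsilon> * sgn x)) * iexp (u * x) \<partial>M)"
    and "integrable M (\<lambda>x. ipow r x * of_real (\<bar>x\<bar> powr p * (1 + \<epsilon> * sgn x)) * iexp (u * x))"
proof -
  have [measurable_cong]: "sets M = sets borel" by simp
  define W where "W x = ipow r x * iexp (u * x)" for x
  have [measurable]: "W \<in> borel_measurable borel" unfolding W_def by measurable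
  have W: "integrable M W" "integrable M (\<lambda>x. norm (W x) * \<bar>x\<bar> powr p)"
    using integrable_mult_iexp[OF integrable_ipow[OF r(1)], of u] r(2)
    by (simp_all add: W_def[abs_def] norm_mult norm_ipow_mult_powr)
  have m: "p < real m" "even m \<Longrightarrow> 0 < p" "odd m \<Longrightarrow> - 1 < p" "p \<noteq> 0"
    and n: "p < real n" "even n \<Longrightarrow> 0 < p" "odd n \<Longrightarrow> - 1 < p"
    using p by auto
  have nz: "c_plus p (g_fun m) \<noteq> 0" "c_plus p (g_fun n) \<noteq> 0"
    using g_fun_integral(2)[OF m(1-3)] g_fun_integral(2)[OF n] by auto
  have "0 < m" using p by (cases m) auto
  have Wp: "integrable M (\<lambda>x. W x * of_real (\<bar>x\<bar> powr p))"
    by (rule Bochner_Integration.integrable_bound[OF W(2)]) (auto simp: norm_mult)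
  have Ws: "integrable M (\<lambda>x. W x * of_real (\<bar>x\<bar> powr p * sgn x))"
    by (rule Bochner_Integration.integrable_bound[OF W(2)])
       (auto simp: norm_mult abs_mult abs_sgn_eq)
  have eq: "ipow r x * of_real (\<bar>x\<bar> powr p * (1 + \<epsilon> * sgn x)) * iexp (u * x) =
      W x * of_real (\<bar>x\<bar> powr p) + of_real \<epsilon> * (W x * of_real (\<bar>x\<bar> powr p * sgn x))" for x
    by (simp add: W_def algebra_simps)
  show "integrable M (\<lambda>x. ipow r x * of_real (\<bar>x\<bar> powr p * (1 + \<epsilon> * sgn x)) * iexp (u * x))"
    unfolding eq by (intro Bochner_Integration.integrable_add integrable_mult_right Wp Ws)
  have int: "(\<integral>x. W x * g_limit m p x \<partial>M) = (\<integral>x. W x * of_real (\<bar>x\<bar> powr p) \<partial>M) * c_plus p (g_fun m)"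
    "(\<integral>x. W x * g_limit n p x \<partial>M) = (\<integral>x. W x * of_real (\<bar>x\<bar> powr p * sgn x) \<partial>M) * c_plus p (g_fun n)"
    unfolding g_limit_even[OF p(5) \<open>0 < m\<close>] g_limit_odd[OF p(3)] mult.assoc[symmetric]
    by (rule integral_mult_left_zero)+
  note L = has_int_0_infm_lincomb[OF has_int_0_infm_g_fun[OF m _ W] has_int_0_infm_g_fun[OF n m(4) _ W],
      of "1 / c_plus p (g_fun m)" "of_real \<epsilon> / c_plus p (g_fun n)"]
  have "has_int_0_infm
      (\<lambda>t. (delta_pow m t (wchar M (ipow r)) u / c_plus p (g_fun m) +
            of_real \<epsilon> * (delta_pow n t (wchar M (ipow r)) u / c_plus p (g_fun n))) / of_real (t powr (p + 1)))
      (1 / c_plus p (g_fun m) * (\<integral>x. W x * g_limit m p x \<partial>M) +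
       of_real \<epsilon> / c_plus p (g_fun n) * (\<integral>x. W x * g_limit n p x \<partial>M))"
    unfolding delta_pow_wchar_eq_integral[OF integrable_ipow[OF r(1)]] W_def[symmetric]
    using L by (simp add: add_divide_distrib)
  also have "1 / c_plus p (g_fun m) * (\<integral>x. W x * g_limit m p x \<partial>M) +
       of_real \<epsilon> / c_plus p (g_fun n) * (\<integral>x. W x * g_limit n p x \<partial>M) =
      (\<integral>x. W x * of_real (\<bar>x\<bar> powr p) \<partial>M) + of_real \<epsilon> * (\<integral>x. W x * of_real (\<bar>x\<bar> powr p * sgn x) \<partial>M)"
    unfolding int using nz by simp
  also have "\<dots> = (\<integral>x. ipow r x * of_real (\<bar>x\<bar> powr p * (1 + \<epsilon> * sgn x)) * iexp (u * x) \<partial>M)"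
    unfolding eq by (subst Bochner_Integration.integral_add[OF Wp integrable_mult_right[OF Ws]]) simp
  finally show "has_int_0_infm
      (\<lambda>t. (delta_pow m t (wchar M (ipow r)) u / c_plus p (g_fun m) +
            of_real \<epsilon> * (delta_pow n t (wchar M (ipow r)) u / c_plus p (g_fun n))) / of_real (t powr (p + 1)))
      (\<integral>x. ipow r x * of_real (\<bar>x\<bar> powr p * (1 + \<epsilon> * sgn x)) * iexp (u * x) \<partial>M)" .
qed

text \<open>P stands for |x|^p when n is even and for the signed power when n is odd, so both
  parities share one proof. The Lebesgue version near 0 is restricted to nonzero p.\<close>

lemma char_moment_identity:
  assumes p: "p < real n" "even n \<Longrightarrow> 0 < p" "odd n \<Longrightarrow> - 1 < p"
    and P: "\<And>x. P x = \<bar>x\<bar> powr p * sgn x ^ n" and moment: "integrable M (\<lambda>x. \<bar>x\<bar> powr p)"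
  shows "has_int_0p_infm (\<lambda>t. delta_pow n t (char M) u / of_real (t powr (p + 1)))
      (c_plus p (g_fun n) * (\<integral>x. of_real (P x) * iexp (u * x) \<partial>M))"
    and "p \<noteq> 0 \<Longrightarrow> has_int_0_infm (\<lambda>t. delta_pow n t (char M) u / of_real (t powr (p + 1)))
      (c_plus p (g_fun n) * (\<integral>x. of_real (P x) * iexp (u * x) \<partial>M))"
    and "integrable M (\<lambda>x. of_real (P x) * iexp (u * x) :: complex)"
    and "c_plus p (g_fun n) \<noteq> 0"
proof -
  have [measurable_cong]: "sets M = sets borel" by simp
  have [measurable]: "P \<in> borel_measurable borel" unfolding P[abs_def] sgn_if by measurable
  have W: "integrable M (\<lambda>x. iexp (u * x))" "integrable M (\<lambda>x. norm (iexp (u * x)) * \<bar>x\<bar> powr p)"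
    using integrable_mult_iexp[of "\<lambda>_. 1" u] moment by simp_all
  have lim: "(\<integral>x. iexp (u * x) * g_limit n p x \<partial>M) =
      c_plus p (g_fun n) * (\<integral>x. of_real (P x) * iexp (u * x) \<partial>M)"
    unfolding g_limit_def P integral_mult_right_zero[symmetric] by (simp only: mult_ac)
  have D: "delta_pow n t (char M) u = (\<integral>x. iexp (u * x) * g_fun n (t * x) \<partial>M)" for t
    unfolding char_eq_wchar delta_pow_wchar_eq_integral[OF integrable_ipow[OF finite_moment_0]] by (simp add: ipow_0)
  show "has_int_0p_infm (\<lambda>t. delta_pow n t (char M) u / of_real (t powr (p + 1)))
      (c_plus p (g_fun n) * (\<integral>x. of_real (P x) * iexp (u * x) \<partial>M))"
    unfolding D lim[symmetric] by (rule has_int_0p_infm_g_fun[OF p _ W]) measurable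
  show "has_int_0_infm (\<lambda>t. delta_pow n t (char M) u / of_real (t powr (p + 1)))
      (c_plus p (g_fun n) * (\<integral>x. of_real (P x) * iexp (u * x) \<partial>M))" if "p \<noteq> 0"
    unfolding D lim[symmetric] by (rule has_int_0_infm_g_fun[OF p that _ W]) measurable
  show "integrable M (\<lambda>x. of_real (P x) * iexp (u * x) :: complex)"
  proof (rule integrable_mult_iexp, rule Bochner_Integration.integrable_bound[OF moment])
    have "\<bar>sgn x ^ n\<bar> \<le> 1" for x :: real
      unfolding power_abs by (intro power_le_one) (auto simp: abs_sgn_eq)
    then have "\<bar>P x\<bar> \<le> \<bar>x\<bar> powr p" for x
      unfolding P abs_mult by (simp add: mult_left_le)
    then show "AE x in M. norm (of_real (P x) :: complex) \<le> norm (\<bar>x\<bar> powr p)"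
      by simp
  qed measurable
  show "c_plus p (g_fun n) \<noteq> 0" by (rule g_fun_integral(2)[OF p])
qed

end

text \<open>Quantifying over L makes the existence of each integral part of the claim, and
  \<open>has_bochner_integral\<close> does the same for the moments. At p = 0 the last integral is
  taken as a limit at both ends, because absolute integrability near 0 is not guaranteed
  there.\<close>

theorem corollary3p7:
  fixes M :: "'a measure" and X :: "'a \<Rightarrow> real" and f :: "real \<Rightarrow> complex"
  assumes "prob_space M"
    and "X \<in> borel_measurable M"
    and f: "f = char (distr M borel X)"
  shows
    "(\<forall>(p::real) (r::real) (u::real) (n::nat) (m::nat).
        0 < p \<and> abs_moment M X r + abs_moment M X (r + p) < \<infinity> \<and>
        p < real n \<and> odd n \<and> p < real m \<and> even m \<longrightarrow>
        (\<exists>fr. has_frac_deriv f r fr \<and>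
          (\<exists>L. has_int_0_infm
                 (\<lambda>t. (delta_pow m t fr u / c_plus p (g_fun m) + delta_pow n t fr u / c_plus p (g_fun n))
                        / of_real (t powr (p + 1))) L \<and>
               has_bochner_integral M
                 (\<lambda>\<omega>. of_real (pos_pow (X \<omega>) (r + p)) * iexp (u * X \<omega>))
                 (1 / (2 * \<i> powr of_real r) * L)) \<and>
          (\<exists>L. has_int_0_infm
                 (\<lambda>t. (delta_pow m t fr u / c_plus p (g_fun m) - delta_pow n t fr u / c_plus p (g_fun n))
                        / of_real (t powr (p + 1))) L \<and>
               has_bochner_integral M
                 (\<lambda>\<omega>. of_real (neg_pow (X \<omega>) (r + p)) * iexp (u * X \<omega>))
                 (iexp (pi * r) / (2 * \<i> powr of_real r) * L))))
     \<and>
     (\<forall>(p::real) (u::real) (n::nat) (m::nat).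
        0 < p \<and> abs_moment M X p < \<infinity> \<and>
        p < real n \<and> odd n \<and> p < real m \<and> even m \<longrightarrow>
        (\<exists>L. has_int_0_infm (\<lambda>t. delta_pow m t f u / of_real (t powr (p + 1))) L \<and>
             has_bochner_integral M
               (\<lambda>\<omega>. of_real (\<bar>X \<omega>\<bar> powr p) * iexp (u * X \<omega>))
               (1 / c_plus p (g_fun m) * L)) \<and>
        (\<exists>L. has_int_0_infm (\<lambda>t. delta_pow n t f u / of_real (t powr (p + 1))) L \<and>
             has_bochner_integral M
               (\<lambda>\<omega>. of_real (sgn_pow (X \<omega>) p) * iexp (u * X \<omega>))
               (1 / c_plus p (g_fun n) * L)))
     \<and>
     (\<forall>(p::real) (u::real) (n::nat).
        - 1 < p \<and> abs_moment M X p < \<infinity> \<and> p < real n \<and> odd n \<longrightarrow>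
        (\<exists>L. has_int_0p_infm (\<lambda>t. delta_pow n t f u / of_real (t powr (p + 1))) L \<and>
             (p \<noteq> 0 \<longrightarrow> has_int_0_infm (\<lambda>t. delta_pow n t f u / of_real (t powr (p + 1))) L) \<and>
             has_bochner_integral M
               (\<lambda>\<omega>. of_real (sgn_pow (X \<omega>) p) * iexp (u * X \<omega>))
               (1 / c_plus p (g_fun n) * L)))"
proof -
  interpret P: prob_space M by fact
  have X [measurable]: "X \<in> borel_measurable M" by fact
  interpret N: real_distribution "distr M borel X" by (rule P.real_distribution_distr) (rule X)
  note moment = finite_moment_distr[OF assms(1,2)]
  note transfer = has_bochner_integral_from_distr[OF X]
  have [measurable]: "(\<lambda>x. pos_pow x s) \<in> borel_measurable borel" "(\<lambda>x. neg_pow x s) \<in> borel_measurable borel"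
    "(\<lambda>x. sgn_pow x s) \<in> borel_measurable borel" for s
    unfolding pos_pow_def neg_pow_def sgn_pow_def by measurable
  have char_part: "\<exists>L. has_int_0p_infm (\<lambda>t. delta_pow n t f u / of_real (t powr (p + 1))) L \<and>
      (p \<noteq> 0 \<longrightarrow> has_int_0_infm (\<lambda>t. delta_pow n t f u / of_real (t powr (p + 1))) L) \<and>
      has_bochner_integral M (\<lambda>\<omega>. of_real (Q (X \<omega>)) * iexp (u * X \<omega>)) (1 / c_plus p (g_fun n) * L)"
    if p: "p < real n" "even n \<Longrightarrow> 0 < p" "odd n \<Longrightarrow> - 1 < p" "abs_moment M X p < \<infinity>"
      and Q: "\<And>x. Q x = \<bar>x\<bar> powr p * sgn x ^ n" for p u :: real and n :: nat and Q :: "real \<Rightarrow> real"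
  proof -
    have "integrable (distr M borel X) (\<lambda>x. \<bar>x\<bar> powr p)"
      using moment[OF p(4)] by (simp add: N.finite_moment_def)
    note id = N.char_moment_identity[OF p(1-3) Q this]
    have [measurable]: "Q \<in> borel_measurable borel" unfolding Q[abs_def] sgn_if by measurable
    have "has_bochner_integral M (\<lambda>\<omega>. of_real (Q (X \<omega>)) * iexp (u * X \<omega>))
        (1 / c_plus p (g_fun n) * (c_plus p (g_fun n) * (\<integral>x. of_real (Q x) * iexp (u * x) \<partial>distr M borel X)))"
      by (rule transfer[OF _ id(3)]) (use id(4) in auto)
    then show ?thesis
      unfolding f using id(1,2) by blast
  qed
  show ?thesis
  proof (intro conjI allI impI; elim conjE)
    fix p r u :: real and n m :: nat
    assume p: "0 < p" "p < real n" "odd n" "p < real m" "even m"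
      and "abs_moment M X r + abs_moment M X (r + p) < \<infinity>"
    then have mom: "abs_moment M X r < \<infinity>" "abs_moment M X (r + p) < \<infinity>"
      by (auto simp: ennreal_add_less_top)
    have r: "N.finite_moment r" "integrable (distr M borel X) (\<lambda>x. \<bar>x\<bar> powr (r + p))"
      using moment[OF mom(1)] moment[OF mom(2)] by (auto simp: N.finite_moment_def)
    define fr where "fr = wchar (distr M borel X) (ipow r)"
    note id_pos = N.frac_moment_identity[OF p r, of 1 u, folded fr_def, simplified]
    note id_neg = N.frac_moment_identity[OF p r, of "- 1" u, folded fr_def, simplified]
    show "\<exists>fr. has_frac_deriv f r fr \<and>
          (\<exists>L. has_int_0_infm
                 (\<lambda>t. (delta_pow m t fr u / c_plus p (g_fun m) + delta_pow n t fr u / c_plus p (g_fun n))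
                        / of_real (t powr (p + 1))) L \<and>
               has_bochner_integral M
                 (\<lambda>\<omega>. of_real (pos_pow (X \<omega>) (r + p)) * iexp (u * X \<omega>))
                 (1 / (2 * \<i> powr of_real r) * L)) \<and>
          (\<exists>L. has_int_0_infm
                 (\<lambda>t. (delta_pow m t fr u / c_plus p (g_fun m) - delta_pow n t fr u / c_plus p (g_fun n))
                        / of_real (t powr (p + 1))) L \<and>
               has_bochner_integral M
                 (\<lambda>\<omega>. of_real (neg_pow (X \<omega>) (r + p)) * iexp (u * X \<omega>))
                 (iexp (pi * r) / (2 * \<i> powr of_real r) * L))"
    proof (intro exI conjI)
      show "has_frac_deriv f r fr"
        unfolding f fr_def by (rule N.has_frac_deriv_char[OF r(1)])
      show "has_int_0_infm
          (\<lambda>t. (delta_pow m t fr u / c_plus p (g_fun m) + delta_pow n t fr u / c_plus p (g_fun n)) / of_real (t powr (p + 1)))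
          (\<integral>x. ipow r x * of_real (\<bar>x\<bar> powr p * (1 + sgn x)) * iexp (u * x) \<partial>distr M borel X)"
        using id_pos(1) by simp
      have pos: "of_real (pos_pow x (r + p)) * iexp (u * x) = 1 / (2 * \<i> powr of_real r) *
          (ipow r x * of_real (\<bar>x\<bar> powr p * (1 + sgn x)) * iexp (u * x))" for x
        unfolding ipow_pos_pow using ii_powr_nonzero[of r] by simp
      show "has_bochner_integral M (\<lambda>\<omega>. of_real (pos_pow (X \<omega>) (r + p)) * iexp (u * X \<omega>))
          (1 / (2 * \<i> powr of_real r) *
           (\<integral>x. ipow r x * of_real (\<bar>x\<bar> powr p * (1 + sgn x)) * iexp (u * x) \<partial>distr M borel X))"
      proof (rule transfer)
        show "integrable (distr M borel X) (\<lambda>x. of_real (pos_pow x (r + p)) * iexp (u * x) :: complex)"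
          unfolding pos by (rule integrable_mult_right) (use id_pos(2) in simp)
      qed (simp_all only: pos integral_mult_right_zero, measurable)
      show "has_int_0_infm
          (\<lambda>t. (delta_pow m t fr u / c_plus p (g_fun m) - delta_pow n t fr u / c_plus p (g_fun n)) / of_real (t powr (p + 1)))
          (\<integral>x. ipow r x * of_real (\<bar>x\<bar> powr p * (1 - sgn x)) * iexp (u * x) \<partial>distr M borel X)"
        using id_neg(1) by simp
      have neg: "of_real (neg_pow x (r + p)) * iexp (u * x) = iexp (pi * r) / (2 * \<i> powr of_real r) *
          (ipow r x * of_real (\<bar>x\<bar> powr p * (1 - sgn x)) * iexp (u * x))" for x
      proof -
        have "iexp (pi * r) / (2 * \<i> powr of_real r) * (ipow r x * of_real (\<bar>x\<bar> powr p * (1 - sgn x)) * iexp (u * x)) =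
            (iexp (pi * r) * (ipow r x * of_real (\<bar>x\<bar> powr p * (1 - sgn x)))) * iexp (u * x) / (2 * \<i> powr of_real r)"
          by (simp only: times_divide_eq_left times_divide_eq_right mult.assoc)
        then show ?thesis
          unfolding ipow_neg_pow using ii_powr_nonzero[of r] by simp
      qed
      show "has_bochner_integral M (\<lambda>\<omega>. of_real (neg_pow (X \<omega>) (r + p)) * iexp (u * X \<omega>))
          (iexp (pi * r) / (2 * \<i> powr of_real r) *
           (\<integral>x. ipow r x * of_real (\<bar>x\<bar> powr p * (1 - sgn x)) * iexp (u * x) \<partial>distr M borel X))"
      proof (rule transfer)
        show "integrable (distr M borel X) (\<lambda>x. of_real (neg_pow x (r + p)) * iexp (u * x) :: complex)"
          unfolding neg by (rule integrable_mult_right) (use id_neg(2) in simp)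
      qed (simp_all only: neg integral_mult_right_zero, measurable)
    qed
  next
    fix p u :: real and n m :: nat
    assume p: "0 < p" "abs_moment M X p < \<infinity>" "p < real n" "odd n" "p < real m" "even m"
    then have "0 < m" by (cases m) auto
    \<comment> \<open>At x = 0 the power of the sign is 0, but so is \<open>powr\<close>.\<close>
    have "\<bar>x\<bar> powr p = \<bar>x\<bar> powr p * sgn x ^ m" for x :: real
      using \<open>even m\<close> by (cases "x = 0") (auto simp: sgn_if)
    from char_part[of p m, OF _ _ _ _ this] p
    show "\<exists>L. has_int_0_infm (\<lambda>t. delta_pow m t f u / of_real (t powr (p + 1))) L \<and>
             has_bochner_integral M (\<lambda>\<omega>. of_real (\<bar>X \<omega>\<bar> powr p) * iexp (u * X \<omega>))
               (1 / c_plus p (g_fun m) * L)"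
      by blast
  next
    fix p u :: real and n m :: nat
    assume p: "0 < p" "abs_moment M X p < \<infinity>" "p < real n" "odd n" "p < real m" "even m"
    have "sgn_pow x p = \<bar>x\<bar> powr p * sgn x ^ n" for x
      using \<open>odd n\<close> by (cases "x = 0") (auto simp: sgn_pow_eq sgn_if)
    from char_part[of p n, OF _ _ _ _ this] p
    show "\<exists>L. has_int_0_infm (\<lambda>t. delta_pow n t f u / of_real (t powr (p + 1))) L \<and>
             has_bochner_integral M (\<lambda>\<omega>. of_real (sgn_pow (X \<omega>) p) * iexp (u * X \<omega>))
               (1 / c_plus p (g_fun n) * L)"
      by fastforce
  next
    fix p u :: real and n :: nat
    assume p: "- 1 < p" "abs_moment M X p < \<infinity>" "p < real n" "odd n"
    have "sgn_pow x p = \<bar>x\<bar> powr p * sgn x ^ n" for x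
      using \<open>odd n\<close> by (cases "x = 0") (auto simp: sgn_pow_eq sgn_if)
    from char_part[of p n, OF _ _ _ _ this] p
    show "\<exists>L. has_int_0p_infm (\<lambda>t. delta_pow n t f u / of_real (t powr (p + 1))) L \<and>
             (p \<noteq> 0 \<longrightarrow> has_int_0_infm (\<lambda>t. delta_pow n t f u / of_real (t powr (p + 1))) L) \<and>
             has_bochner_integral M (\<lambda>\<omega>. of_real (sgn_pow (X \<omega>) p) * iexp (u * X \<omega>))
               (1 / c_plus p (g_fun n) * L)"
      by blast
  qed
qed

end
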